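(* Let $\mathcal{A}$ be a CQG Hopf $*$-algebra and $\mathcal{B}$ a unital left coideal $*$-subalgebra of $\mathcal{A}$. Let $\mathcal{I}_c$ be the stabilizer dual of $\mathcal{B}$. Suppose $(\pi,\mathcal{H})$ is a $*$-representation of $\mathcal{B}\bowtie\mathcal{I}_c$ and $C$ is a $(\pi,\epsilon)$-$1$-cocycle of $\mathcal{B}$. Then the following are equivalent. (1) The cocycle $C$ satisfies the Yetter--Drinfeld condition: $\pi(\omega)C(x)=C(x\lhd S^{-1}(\omega))$ for all $x\in\mathcal{B}$ and $\omega\in\mathcal{I}_c$. (2) The cocycle $C$ extends to a $1$-cocycle $\tilde C$ on the Drinfeld double coideal $\mathcal{B}\bowtie\mathcal{I}_c$ such that $\tilde C(x\omega)=C(x)\epsilon(\omega)$ for all $x\in\mathcal{B}$ and $\omega\in\mathcal{I}_c$.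
   Context: Sweedler notation is used. Let $(H_\alpha,U_\alpha)_\alpha$ be a maximal family of mutually inequivalent irreducible finite-dimensional unitary corepresentations of the CQG Hopf $*$-algebra $\mathcal{A}$ (a Hopf $*$-algebra spanned by matrix coefficients of its finite-dimensional unitary corepresentations). $\mathcal{U}=\mathrm{Hom}(\mathcal{A},\mathbb{C})=\prod_\alpha\mathbb{B}(H_\alpha)$, with pairing $(a,h)=h(a)$, product dual to the coproduct of $\mathcal{A}$, and coproduct $\Delta:\mathcal{U}\to\mathcal{U}\,\overline\otimes\,\mathcal{U}=\mathrm{Hom}(\mathcal{A}\otimes\mathcal{A},\mathbb{C})$ dual to the product of $\mathcal{A}$; $\epsilon(h)=h(1)$. For $a\in\mathcal{A}$, $h\in\mathcal{U}$: $a\lhd h=(a_{(1)},h)a_{(2)}$. A left coideal satisfies $\Delta(\mathcal{B})\subset\mathcal{A}\otimes\mathcal{B}$. Stabilizer dual: with $\mathcal{B}_+=\mathcal{B}\cap\ker\epsilon$, put $\mathcal{C}=\mathcal{A}/\mathcal{B}_+\mathcal{A}$ and $\mathcal{I}=\mathrm{Hom}(\mathcal{C},\mathbb{C})$, regarded as a subalgebra of $\mathcal{U}$ via the quotient map $\mathcal{A}\to\mathcal{C}$. Then $\mathcal{I}=\prod_\beta\mathbb{B}(G_\beta)$, where $(G_\beta)_\beta$ is a maximal family of mutually inequivalent irreducible $*$-representations of $\mathcal{I}$ arising as subrepresentations of the $H_\alpha$; $\Delta$ restricts to $\mathcal{I}\to\mathcal{I}\,\overline\otimes\,\mathcal{U}=\prod_{\alpha,\beta}\mathbb{B}(G_\beta)\otimes\mathbb{B}(H_\alpha)$.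 $\mathcal{I}_c=\bigoplus_\beta\mathbb{B}(G_\beta)\subset\mathcal{I}$. $\mathcal{B}\bowtie\mathcal{I}_c$ is the Drinfeld double coideal: the $*$-subalgebra generated by $\mathcal{B}$ and $\mathcal{I}_c$ inside the Drinfeld double $\mathcal{A}\bowtie\mathcal{U}$; its commutation relations are $x\omega=\omega_{(1)}(x\lhd\omega_{(2)})$ and $\omega x=(x\lhd S^{-1}(\omega_{(2)}))\omega_{(1)}$ for $x\in\mathcal{B}$, $\omega\in\mathcal{I}_c$, and $\epsilon(x\omega)=\epsilon(x)\epsilon(\omega)$. $*$-representations are on pre-Hilbert spaces by adjointable linear maps. For a $*$-algebra $\mathcal{X}$ with counit $\epsilon$ and a $*$-representation $\pi$ of $\mathcal{X}$ on $\mathcal{H}$, a linear map $C:\mathcal{X}\to\mathcal{H}$ is a $(\pi,\epsilon)$-$1$-cocycle if $C(xy)=\pi(x)C(y)+C(x)\epsilon(y)$ for all $x,y\in\mathcal{X}$. In the theorem, the representation $\pi$ of $\mathcal{B}\bowtie\mathcal{I}_c$ is also used as a representation of $\mathcal{B}$. *)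

theory Defs
  imports Complex_Main "HOL-Library.Function_Algebras"
begin

section \<open>Complex vector spaces\<close>

class scaleC =
  fixes scaleC :: "complex \<Rightarrow> 'a \<Rightarrow> 'a"  (infixr \<open>*\<^sub>C\<close> 75)

class complex_vector = scaleC + ab_group_add +
  assumes scaleC_add_right: "c *\<^sub>C (x + y) = c *\<^sub>C x + c *\<^sub>C y"
    and scaleC_add_left: "(c + d) *\<^sub>C x = c *\<^sub>C x + d *\<^sub>C x"
    and scaleC_scaleC: "c *\<^sub>C d *\<^sub>C x = (c * d) *\<^sub>C x"
    and scaleC_one: "1 *\<^sub>C x = x"

global_interpretation complex_vector:
  vector_space "scaleC :: complex \<Rightarrow> 'a \<Rightarrow> 'a::complex_vector"
  by unfold_locales
    (simp_all add: scaleC_add_right scaleC_add_left scaleC_scaleC scaleC_one)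

abbreviation clinear :: "('a::complex_vector \<Rightarrow> 'b::complex_vector) \<Rightarrow> bool"
  where "clinear \<equiv> Vector_Spaces.linear scaleC scaleC"

lemma clinear_iff:
  "clinear f \<longleftrightarrow> (\<forall>x y. f (x + y) = f x + f y) \<and> (\<forall>c x. f (c *\<^sub>C x) = c *\<^sub>C f x)"
proof
  assume "clinear f"
  then interpret f: Vector_Spaces.linear scaleC scaleC f .
  show "(\<forall>x y. f (x + y) = f x + f y) \<and> (\<forall>c x. f (c *\<^sub>C x) = c *\<^sub>C f x)"
    by (simp add: f.add f.scale)
next
  assume "(\<forall>x y. f (x + y) = f x + f y) \<and> (\<forall>c x. f (c *\<^sub>C x) = c *\<^sub>C f x)"
  then show "clinear f"
    by unfold_locales auto
qed

instantiation complex :: complex_vector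
begin
definition scaleC_complex_def [simp]: "c *\<^sub>C (x::complex) = c * x"
instance by standard (simp_all add: algebra_simps)
end

instantiation "fun" :: (type, complex_vector) complex_vector
begin
definition scaleC_fun_def: "c *\<^sub>C f = (\<lambda>x. c *\<^sub>C f x)"
instance
  by standard
    (simp_all add: scaleC_fun_def fun_eq_iff scaleC_add_right scaleC_add_left scaleC_scaleC scaleC_one)
end

text \<open>Linearity of a map of which only the values on a subspace \<open>X\<close> matter.\<close>

definition clinear_on :: "'a::complex_vector set \<Rightarrow> ('a \<Rightarrow> 'b::complex_vector) \<Rightarrow> bool" where
  "clinear_on X f \<longleftrightarrow>
     (\<forall>x\<in>X. \<forall>y\<in>X. f (x + y) = f x + f y) \<and> (\<forall>c. \<forall>x\<in>X. f (c *\<^sub>C x) = c *\<^sub>C f x)"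

class complex_inner = complex_vector +
  fixes cinner :: "'a \<Rightarrow> 'a \<Rightarrow> complex"
  assumes cinner_commute: "cinner x y = cnj (cinner y x)"
    and cinner_add_right: "cinner x (y + z) = cinner x y + cinner x z"
    and cinner_scaleC_right: "cinner x (c *\<^sub>C y) = c * cinner x y"
    and cinner_ge_zero: "0 \<le> Re (cinner x x)"
    and cinner_eq_zero: "cinner x x = 0 \<Longrightarrow> x = 0"


section \<open>Algebraic tensor products\<close>

text \<open>
  A list \<open>[(a\<^sub>1, b\<^sub>1), \<dots>, (a\<^sub>n, b\<^sub>n)]\<close> is read as the formal sum of its entries; the tensor product
  is the quotient of the formal sums by the congruence generated by the bilinearity relations.
\<close>

inductive tensor_eq :: "('a::complex_vector \<times> 'b::complex_vector) list \<Rightarrow> ('a \<times> 'b) list \<Rightarrow> bool" where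
  tensor_eq_refl: "tensor_eq xs xs"
| tensor_eq_sym: "tensor_eq xs ys \<Longrightarrow> tensor_eq ys xs"
| tensor_eq_trans: "tensor_eq xs ys \<Longrightarrow> tensor_eq ys zs \<Longrightarrow> tensor_eq xs zs"
| tensor_eq_append: "tensor_eq xs xs' \<Longrightarrow> tensor_eq ys ys' \<Longrightarrow> tensor_eq (xs @ ys) (xs' @ ys')"
| tensor_eq_commute: "tensor_eq (xs @ ys) (ys @ xs)"
| tensor_eq_add_left: "tensor_eq [(a + a', b)] [(a, b), (a', b)]"
| tensor_eq_add_right: "tensor_eq [(a, b + b')] [(a, b), (a, b')]"
| tensor_eq_scale: "tensor_eq [(c *\<^sub>C a, b)] [(a, c *\<^sub>C b)]"
| tensor_eq_zero: "tensor_eq [(0, b)] []"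

declare tensor_eq_trans [trans]

quotient_type (overloaded) ('a, 'b) tensor =
  "('a::complex_vector \<times> 'b::complex_vector) list" / tensor_eq
  by (intro equivpI reflpI sympI transpI) (blast intro: tensor_eq.intros)+

lift_definition tensor :: "'a::complex_vector \<Rightarrow> 'b::complex_vector \<Rightarrow> ('a, 'b) tensor"  (infixr \<open>\<otimes>\<close> 76)
  is "\<lambda>a b. [(a, b)]" .

lemma tensor_eq_map_scale:
  assumes "tensor_eq xs ys"
  shows "tensor_eq (map (\<lambda>(a, b). (c *\<^sub>C a, b)) xs) (map (\<lambda>(a, b). (c *\<^sub>C a, b)) ys)"
  using assms
proof induction
  case (tensor_eq_scale d a b)
  have "tensor_eq [(d *\<^sub>C c *\<^sub>C a, b)] [(c *\<^sub>C a, d *\<^sub>C b)]"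
    by (rule tensor_eq.tensor_eq_scale)
  then show ?case
    by (simp add: scaleC_scaleC mult.commute)
qed (auto simp: scaleC_add_right intro: tensor_eq.intros)

lemma tensor_eq_cancel:
  "tensor_eq (map (\<lambda>(a, b). ((-1) *\<^sub>C a, b)) xs @ xs) []"
proof (induction xs)
  case Nil
  then show ?case by (simp add: tensor_eq_refl)
next
  case (Cons x xs)
  obtain a b where x: "x = (a, b)" by fastforce
  let ?m = "map (\<lambda>(a, b). ((-1) *\<^sub>C a, b))"
  have "tensor_eq (?m (x # xs) @ x # xs) (x # xs @ ?m (x # xs))"
    using tensor_eq_commute[of "?m (x # xs)" "x # xs"] by simp
  also have "tensor_eq ... ([x] @ (?m (x # xs) @ xs))"
    using tensor_eq_append[OF tensor_eq_refl tensor_eq_commute, of "[x]" xs "?m (x # xs)"] by simp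
  also have "... = [(a, b), ((-1) *\<^sub>C a, b)] @ (?m xs @ xs)"
    by (simp add: x)
  also have "tensor_eq ... ([(a + (-1) *\<^sub>C a, b)] @ [])"
    by (intro tensor_eq_append Cons.IH tensor_eq_sym[OF tensor_eq_add_left])
  also have "... = [(0, b)]"
    by simp
  also have "tensor_eq ... []"
    by (rule tensor_eq_zero)
  finally show ?case .
qed

instantiation tensor :: (complex_vector, complex_vector) complex_vector
begin

lift_definition zero_tensor :: "('a, 'b) tensor" is "[]" .

lift_definition plus_tensor :: "('a, 'b) tensor \<Rightarrow> ('a, 'b) tensor \<Rightarrow> ('a, 'b) tensor"
  is "(@)" by (rule tensor_eq_append)

lift_definition scaleC_tensor :: "complex \<Rightarrow> ('a, 'b) tensor \<Rightarrow> ('a, 'b) tensor"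
  is "\<lambda>c. map (\<lambda>(a, b). (c *\<^sub>C a, b))" by (rule tensor_eq_map_scale)

definition uminus_tensor :: "('a, 'b) tensor \<Rightarrow> ('a, 'b) tensor"
  where "- t = (-1) *\<^sub>C t" for t :: "('a, 'b) tensor"

definition minus_tensor :: "('a, 'b) tensor \<Rightarrow> ('a, 'b) tensor \<Rightarrow> ('a, 'b) tensor"
  where "s - t = s + (- t)" for s t :: "('a, 'b) tensor"

instance
proof
  fix r s t :: "('a, 'b) tensor" and c d :: complex
  show "r + s + t = r + (s + t)"
    by transfer (simp add: tensor_eq_refl)
  show "s + t = t + s"
    by transfer (rule tensor_eq_commute)
  show "0 + t = t"
    by transfer (simp add: tensor_eq_refl)
  show "- t + t = 0"
    unfolding uminus_tensor_def by transfer (rule tensor_eq_cancel)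
  show "s - t = s + - t"
    by (rule minus_tensor_def)
  show "c *\<^sub>C (s + t) = c *\<^sub>C s + c *\<^sub>C t"
    by transfer (simp add: tensor_eq_refl)
  show "c *\<^sub>C d *\<^sub>C t = (c * d) *\<^sub>C t"
    by transfer (simp add: tensor_eq_refl scaleC_scaleC case_prod_unfold comp_def)
  show "1 *\<^sub>C t = t"
    by transfer (simp add: tensor_eq_refl scaleC_one)
  show "(c + d) *\<^sub>C t = c *\<^sub>C t + d *\<^sub>C t"
  proof (transfer fixing: c d)
    fix xs :: "('a \<times> 'b) list"
    let ?m = "\<lambda>c. map (\<lambda>(a, b). (c *\<^sub>C a, b))"
    show "tensor_eq (?m (c + d) xs) (?m c xs @ ?m d xs)"
    proof (induction xs)
      case Nil
      then show ?case by (simp add: tensor_eq_refl)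
    next
      case (Cons x xs)
      obtain a b where x: "x = (a, b)" by fastforce
      have "?m (c + d) (x # xs) = [(c *\<^sub>C a + d *\<^sub>C a, b)] @ ?m (c + d) xs"
        by (simp add: x scaleC_add_left)
      also have "tensor_eq ... ([(c *\<^sub>C a, b), (d *\<^sub>C a, b)] @ (?m c xs @ ?m d xs))"
        by (intro tensor_eq_append tensor_eq_add_left Cons.IH)
      also have "... = [(c *\<^sub>C a, b)] @ (([(d *\<^sub>C a, b)] @ ?m c xs) @ ?m d xs)"
        by simp
      also have "tensor_eq ... ([(c *\<^sub>C a, b)] @ ((?m c xs @ [(d *\<^sub>C a, b)]) @ ?m d xs))"
        by (intro tensor_eq_append tensor_eq_refl tensor_eq_commute)
      finally show ?case by (simp add: x)
    qed
  qed
qed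

end

lemma tensor_add_left: "(a + a') \<otimes> b = a \<otimes> b + a' \<otimes> b"
  by transfer (simp add: tensor_eq_add_left)

lemma tensor_add_right: "a \<otimes> (b + b') = a \<otimes> b + a \<otimes> b'"
  by transfer (simp add: tensor_eq_add_right)

lemma tensor_scale_left: "(c *\<^sub>C a) \<otimes> b = c *\<^sub>C (a \<otimes> b)"
  by transfer (simp add: tensor_eq_refl)

lemma tensor_scale_right: "a \<otimes> (c *\<^sub>C b) = c *\<^sub>C (a \<otimes> b)"
  by transfer (simp add: tensor_eq_scale tensor_eq_sym)

lemma tensor_zero_left: "0 \<otimes> b = 0"
  using tensor_scale_left[of 0 0 b] by simp

lemma tensor_zero_right: "a \<otimes> 0 = 0"
  using tensor_scale_right[of a 0 0] by simp

lemma tensor_induct [case_names zero add]: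
  assumes "P 0" and "\<And>a b t. P t \<Longrightarrow> P (a \<otimes> b + t)"
  shows "P t"
proof -
  have "P (abs_tensor xs)" for xs
  proof (induction xs)
    case Nil
    then show ?case using assms(1) by (simp add: zero_tensor_def)
  next
    case (Cons x xs)
    obtain a b where "x = (a, b)" by fastforce
    then have "abs_tensor (x # xs) = a \<otimes> b + abs_tensor xs"
      by (simp add: tensor.abs_eq plus_tensor.abs_eq)
    then show ?case using assms(2) Cons.IH by simp
  qed
  then show ?thesis by (metis tensor.abs_induct)
qed

definition balanced :: "('a::complex_vector \<Rightarrow> 'b::complex_vector \<Rightarrow> 'c::ab_group_add) \<Rightarrow> bool" where
  "balanced f \<longleftrightarrow>
     (\<forall>a a' b. f (a + a') b = f a b + f a' b) \<and> (\<forall>a b b'. f a (b + b') = f a b + f a b') \<and>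
     (\<forall>c a b. f (c *\<^sub>C a) b = f a (c *\<^sub>C b))"

text \<open>
  The universal property: \<open>tensor_lift f\<close> maps \<open>\<Sum>\<^sub>i a\<^sub>i \<otimes> b\<^sub>i\<close> to \<open>\<Sum>\<^sub>i f a\<^sub>i b\<^sub>i\<close>. Balanced maps are
  used instead of bilinear ones so that conjugate-linear maps are covered, too.
  Applied to a coproduct, \<open>tensor_lift (\<lambda>x y. f x y) (\<Delta> a)\<close> is \<open>f a\<^sub>(\<^sub>1\<^sub>) a\<^sub>(\<^sub>2\<^sub>)\<close> in Sweedler notation.
\<close>

lift_definition tensor_lift ::
  "('a::complex_vector \<Rightarrow> 'b::complex_vector \<Rightarrow> 'c::ab_group_add) \<Rightarrow> ('a, 'b) tensor \<Rightarrow> 'c"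
  is "\<lambda>f xs. if balanced f then \<Sum>(a, b)\<leftarrow>xs. f a b else 0"
proof -
  fix f :: "'a \<Rightarrow> 'b \<Rightarrow> 'c" and xs ys :: "('a \<times> 'b) list"
  assume "tensor_eq xs ys"
  have "(\<Sum>(a, b)\<leftarrow>xs. f a b) = (\<Sum>(a, b)\<leftarrow>ys. f a b)" if f: "balanced f"
    using \<open>tensor_eq xs ys\<close>
  proof induction
    case (tensor_eq_zero b)
    have "f 0 b + f 0 b = f 0 b"
      using f unfolding balanced_def by (metis add_0)
    then show ?case by simp
  qed (use f in \<open>auto simp: balanced_def add.commute\<close>)
  then show "(if balanced f then \<Sum>(a, b)\<leftarrow>xs. f a b else 0)
      = (if balanced f then \<Sum>(a, b)\<leftarrow>ys. f a b else 0)"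
    by simp
qed

lemma tensor_lift_zero [simp]: "tensor_lift f 0 = 0"
  by transfer simp

lemma tensor_lift_add: "tensor_lift f (s + t) = tensor_lift f s + tensor_lift f t"
  by transfer simp

lemma tensor_lift_tensor: "balanced f \<Longrightarrow> tensor_lift f (a \<otimes> b) = f a b"
  by transfer simp

lemma tensor_lift_scale:
  assumes "balanced f"
  shows "tensor_lift f (c *\<^sub>C t) = tensor_lift (\<lambda>a b. f (c *\<^sub>C a) b) t"
proof -
  have f': "balanced (\<lambda>a b. f (c *\<^sub>C a) b)"
    using assms unfolding balanced_def
    by (metis scaleC_add_right scaleC_scaleC mult.commute)
  show ?thesis
    by (induction t rule: tensor_induct)
      (simp_all add: scaleC_add_right tensor_lift_add assms f' tensor_lift_tensor
        flip: tensor_scale_left)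
qed

lemma tensor_lift_unique:
  assumes "\<And>s t. g (s + t) = g s + g t" and "\<And>a b. g (a \<otimes> b) = f a b" and "balanced f"
  shows "g t = tensor_lift f t"
proof -
  have "g 0 = 0"
    using assms(1)[of 0 0] by simp
  then show ?thesis
    by (induction t rule: tensor_induct) (simp_all add: assms tensor_lift_add tensor_lift_tensor)
qed

definition tensor_map ::
  "('a::complex_vector \<Rightarrow> 'c::complex_vector) \<Rightarrow> ('b::complex_vector \<Rightarrow> 'd::complex_vector) \<Rightarrow>
    ('a, 'b) tensor \<Rightarrow> ('c, 'd) tensor" where
  "tensor_map f g = tensor_lift (\<lambda>a b. f a \<otimes> g b)"

definition tensor_assoc ::
  "(('a::complex_vector, 'b::complex_vector) tensor, 'c::complex_vector) tensor \<Rightarrow>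
    ('a, ('b, 'c) tensor) tensor" where
  "tensor_assoc = tensor_lift (\<lambda>t c. tensor_lift (\<lambda>a b. a \<otimes> (b \<otimes> c)) t)"


section \<open>Hopf \<open>*\<close>-algebras\<close>

class star =
  fixes star :: "'a \<Rightarrow> 'a"

class star_algebra = complex_vector + ring_1 + star +
  assumes mult_scaleC_left: "(c *\<^sub>C x) * y = c *\<^sub>C (x * y)"
    and mult_scaleC_right: "x * (c *\<^sub>C y) = c *\<^sub>C (x * y)"
    and star_add: "star (x + y) = star x + star y"
    and star_scaleC: "star (c *\<^sub>C x) = cnj c *\<^sub>C star x"
    and star_mult: "star (x * y) = star y * star x"
    and star_star: "star (star x) = x"

instantiation tensor :: (star_algebra, star_algebra) "{one, times, star}"
begin

definition one_tensor :: "('a, 'b) tensor"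
  where "1 = (1::'a) \<otimes> (1::'b)"

definition times_tensor :: "('a, 'b) tensor \<Rightarrow> ('a, 'b) tensor \<Rightarrow> ('a, 'b) tensor"
  where "s * t = tensor_lift (\<lambda>a b. tensor_lift (\<lambda>c d. (a * c) \<otimes> (b * d)) t) s"
    for s t :: "('a, 'b) tensor"

definition star_tensor :: "('a, 'b) tensor \<Rightarrow> ('a, 'b) tensor"
  where "star t = tensor_lift (\<lambda>a b. star a \<otimes> star b) t" for t :: "('a, 'b) tensor"

instance ..

end

text \<open>
  The superclass is given by the sort constraint on the type of \<open>comult\<close> instead of
  \<open>star_algebra +\<close>, since the type parameters of \<open>tensor\<close> are constrained themselves.
\<close>

class hopf_star_algebra =
  fixes comult :: "'a::star_algebra \<Rightarrow> ('a, 'a) tensor"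
    and counit :: "'a \<Rightarrow> complex"
    and antipode :: "'a \<Rightarrow> 'a"
  assumes clinear_comult: "clinear comult"
    and clinear_counit: "clinear counit"
    and clinear_antipode: "clinear antipode"
    and comult_coassoc:
      "tensor_assoc (tensor_map comult id (comult a)) = tensor_map id comult (comult a)"
    and counit_left: "tensor_lift (\<lambda>x y. counit x *\<^sub>C y) (comult a) = a"
    and counit_right: "tensor_lift (\<lambda>x y. counit y *\<^sub>C x) (comult a) = a"
    and comult_mult: "comult (a * b) = comult a * comult b"
    and comult_one: "comult 1 = 1"
    and comult_star: "comult (star a) = star (comult a)"
    and counit_mult: "counit (a * b) = counit a * counit b"
    and counit_one: "counit 1 = 1"
    and antipode_left: "tensor_lift (\<lambda>x y. antipode x * y) (comult a) = counit a *\<^sub>C 1"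
    and antipode_right: "tensor_lift (\<lambda>x y. x * antipode y) (comult a) = counit a *\<^sub>C 1"

subsection \<open>The antipode is bijective\<close>

definition cbilinear :: "('a::complex_vector \<Rightarrow> 'b::complex_vector \<Rightarrow> 'c::complex_vector) \<Rightarrow> bool" where
  "cbilinear f \<longleftrightarrow> (\<forall>b. clinear (\<lambda>a. f a b)) \<and> (\<forall>a. clinear (f a))"

lemma cbilinearI: "(\<And>b. clinear (\<lambda>a. f a b)) \<Longrightarrow> (\<And>a. clinear (\<lambda>b. f a b)) \<Longrightarrow> cbilinear f"
  by (simp add: cbilinear_def)

lemma cbilinear_balanced: "cbilinear f \<Longrightarrow> balanced f"
  by (simp add: cbilinear_def balanced_def clinear_iff)

lemma clinear_add: "clinear f \<Longrightarrow> f (x + y) = f x + f y"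
  and clinear_scale: "clinear f \<Longrightarrow> f (c *\<^sub>C x) = c *\<^sub>C f x"
  by (simp_all add: clinear_iff)

lemma clinear_0: "clinear f \<Longrightarrow> f 0 = 0"
  using clinear_scale[of f 0 0] by simp

lemma clinear_compose': "clinear f \<Longrightarrow> clinear g \<Longrightarrow> clinear (\<lambda>x. f (g x))"
  by (simp add: clinear_iff)

lemma clinear_tensor_lift: "cbilinear f \<Longrightarrow> clinear (tensor_lift f)"
proof -
  assume f: "cbilinear f"
  then have b: "balanced f" by (rule cbilinear_balanced)
  have "f (c *\<^sub>C x) y = c *\<^sub>C f x y" for c x y
    using f by (simp add: cbilinear_def clinear_iff)
  then have "tensor_lift f (c *\<^sub>C t) = c *\<^sub>C tensor_lift f t" for c t
    by (induction t rule: tensor_induct)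
      (simp_all add: scaleC_add_right tensor_lift_add b tensor_lift_tensor
        flip: tensor_scale_left)
  then show ?thesis by (simp add: clinear_iff tensor_lift_add)
qed

lemma tensor_lift_plus:
  "balanced f \<Longrightarrow> balanced g \<Longrightarrow> tensor_lift (\<lambda>a b. f a b + g a b) t = tensor_lift f t + tensor_lift g t"
proof (induction t rule: tensor_induct)
  case (add a b t)
  then have "balanced (\<lambda>a b. f a b + g a b)"
    by (simp add: balanced_def)
  with add show ?case by (simp add: tensor_lift_add tensor_lift_tensor)
qed simp

lemma clinear_tensor_lift_pull:
  "clinear g \<Longrightarrow> cbilinear f \<Longrightarrow> g (tensor_lift f t) = tensor_lift (\<lambda>a b. g (f a b)) t"
proof (induction t rule: tensor_induct)
  case (add a b t)
  then have "cbilinear (\<lambda>a b. g (f a b))"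
    by (simp add: cbilinear_def clinear_iff)
  with add show ?case
    by (simp add: tensor_lift_add tensor_lift_tensor cbilinear_balanced clinear_add)
qed (simp add: clinear_0)

lemma clinear_scaleC: "clinear (\<lambda>x. c *\<^sub>C x)"
  by (simp add: clinear_iff scaleC_add_right scaleC_scaleC mult.commute)

lemma clinear_tensor_lift_param:
  assumes f: "\<And>x. cbilinear (f x)" and x: "\<And>a b. clinear (\<lambda>x. f x a b)"
  shows "clinear (\<lambda>x. tensor_lift (f x) t)"
proof -
  have "tensor_lift (f (x + y)) t = tensor_lift (f x) t + tensor_lift (f y) t" for x y
    using clinear_add[OF x] tensor_lift_plus[OF f[THEN cbilinear_balanced] f[THEN cbilinear_balanced], of x y]
    by (metis (no_types, lifting) ext)
  moreover have "tensor_lift (f (c *\<^sub>C x)) t = c *\<^sub>C tensor_lift (f x) t" for c x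
  proof -
    have "f (c *\<^sub>C x) = (\<lambda>a b. c *\<^sub>C f x a b)"
      using clinear_scale[OF x] by (intro ext) simp
    then show ?thesis
      by (simp add: clinear_tensor_lift_pull[OF clinear_scaleC f])
  qed
  ultimately show ?thesis by (simp add: clinear_iff)
qed

lemma tensor_lift_swap:
  assumes "\<And>a b. cbilinear (f a b)" and "\<And>c d. cbilinear (\<lambda>a b. f a b c d)"
  shows "tensor_lift (\<lambda>a b. tensor_lift (f a b) t) s = tensor_lift (\<lambda>c d. tensor_lift (\<lambda>a b. f a b c d) s) t"
proof (rule tensor_lift_unique)
  fix c d
  show "tensor_lift (\<lambda>a b. tensor_lift (f a b) (c \<otimes> d)) s = tensor_lift (\<lambda>a b. f a b c d) s"
    by (simp add: tensor_lift_tensor cbilinear_balanced assms)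
next
  have *: "balanced (\<lambda>a b. tensor_lift (f a b) t)" for t
    using assms by (intro cbilinear_balanced cbilinearI clinear_tensor_lift_param)
      (auto simp: cbilinear_def)
  show "tensor_lift (\<lambda>a b. tensor_lift (f a b) (s' + t')) s
      = tensor_lift (\<lambda>a b. tensor_lift (f a b) s') s + tensor_lift (\<lambda>a b. tensor_lift (f a b) t') s" for s' t'
    by (simp add: tensor_lift_add tensor_lift_plus *)
next
  show "balanced (\<lambda>c d. tensor_lift (\<lambda>a b. f a b c d) s)"
    using assms by (intro cbilinear_balanced cbilinearI clinear_tensor_lift_param)
      (auto simp: cbilinear_def)
qed

lemma clinear_mult_left: "clinear g \<Longrightarrow> clinear (\<lambda>x. g x * (y::'a::star_algebra))"
  and clinear_mult_right: "clinear g \<Longrightarrow> clinear (\<lambda>x. (y::'a::star_algebra) * g x)"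
  by (simp_all add: clinear_iff distrib_left distrib_right mult_scaleC_left mult_scaleC_right)

lemma clinear_scaleC_left: "clinear g \<Longrightarrow> clinear (\<lambda>x. g x *\<^sub>C (y::'a::complex_vector))"
  and clinear_scaleC_right: "clinear h \<Longrightarrow> clinear (\<lambda>x. c *\<^sub>C (h x ::'a))"
  by (simp_all add: clinear_iff scaleC_add_left scaleC_add_right scaleC_scaleC mult.commute)

lemma clinear_times_left: "clinear g \<Longrightarrow> clinear (\<lambda>x. g x * (y::complex))"
  and clinear_times_right: "clinear g \<Longrightarrow> clinear (\<lambda>x. (y::complex) * g x)"
  by (auto simp: clinear_iff algebra_simps)

lemma clinear_tensor_left: "clinear g \<Longrightarrow> clinear (\<lambda>x. g x \<otimes> y)"
  and clinear_tensor_right: "clinear g \<Longrightarrow> clinear (\<lambda>x. y \<otimes> g x)"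
  by (simp_all add: clinear_iff tensor_add_left tensor_add_right tensor_scale_left tensor_scale_right)

lemma clinear_ident: "clinear (\<lambda>x. x)"
  by (simp add: clinear_iff)

lemmas clinear_intros =
  cbilinearI clinear_tensor_lift_param clinear_ident clinear_mult_left clinear_mult_right
  clinear_scaleC_left clinear_scaleC_right clinear_times_left clinear_times_right
  clinear_tensor_left clinear_tensor_right
  clinear_compose'[OF clinear_comult] clinear_compose'[OF clinear_counit]
  clinear_compose'[OF clinear_antipode] clinear_compose'[OF clinear_tensor_lift]

lemma tensor_mult: "(a \<otimes> b) * (c \<otimes> d) = (a * c) \<otimes> (b * d)"
  unfolding times_tensor_def
  by (subst tensor_lift_tensor, (intro cbilinear_balanced clinear_intros)[1])+ (rule refl)

lemma tensor_star: "star (a \<otimes> b) = star a \<otimes> star b"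
  unfolding star_tensor_def
  by (subst tensor_lift_tensor)
    (simp_all add: balanced_def star_add star_scaleC tensor_add_left tensor_add_right
      tensor_scale_left tensor_scale_right)

abbreviation sweedler :: "'a::hopf_star_algebra \<Rightarrow> ('a \<Rightarrow> 'a \<Rightarrow> 'b::ab_group_add) \<Rightarrow> 'b" where
  "sweedler a f \<equiv> tensor_lift f (comult a)"

lemma sw_coassoc:
  fixes f :: "'a::hopf_star_algebra \<Rightarrow> 'a \<Rightarrow> 'a \<Rightarrow> 'b::complex_vector"
  assumes [intro]: "\<And>x y. clinear (\<lambda>z. f x y z)" "\<And>x z. clinear (\<lambda>y. f x y z)"
    "\<And>y z. clinear (\<lambda>x. f x y z)"
  shows "sweedler a (\<lambda>x z. sweedler x (\<lambda>x1 x2. f x1 x2 z)) = sweedler a (\<lambda>x z. sweedler z (\<lambda>z1 z2. f x z1 z2))"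
proof -
  note I = cbilinear_balanced clinear_intros assms
  define F where "F = tensor_lift (\<lambda>x t. tensor_lift (f x) t)"
  have F: "clinear F"
    unfolding F_def by (intro clinear_tensor_lift clinear_intros assms)
  have "F (tensor_map id comult (comult a)) = sweedler a (\<lambda>x z. F (x \<otimes> comult z))"
    unfolding tensor_map_def id_apply
    by (intro clinear_tensor_lift_pull F clinear_intros)
  also have "... = sweedler a (\<lambda>x z. sweedler z (\<lambda>z1 z2. f x z1 z2))"
    unfolding F_def by (subst tensor_lift_tensor) (intro I refl)+
  finally have 1: "F (tensor_map id comult (comult a)) = sweedler a (\<lambda>x z. sweedler z (\<lambda>z1 z2. f x z1 z2))" .
  have G: "clinear (\<lambda>s. F (tensor_assoc s))"
    unfolding tensor_assoc_def by (intro clinear_compose'[OF F] clinear_intros)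
  have "F (tensor_assoc (tensor_map comult id (comult a)))
      = sweedler a (\<lambda>x z. F (tensor_assoc (comult x \<otimes> z)))"
    unfolding tensor_map_def id_apply
    by (rule clinear_tensor_lift_pull[OF G]) (intro clinear_intros)
  also have "... = sweedler a (\<lambda>x z. F (sweedler x (\<lambda>x1 x2. x1 \<otimes> (x2 \<otimes> z))))"
    unfolding tensor_assoc_def by (subst tensor_lift_tensor) (intro I refl)+
  also have "... = sweedler a (\<lambda>x z. sweedler x (\<lambda>x1 x2. F (x1 \<otimes> (x2 \<otimes> z))))"
    by (subst clinear_tensor_lift_pull[OF F]) (intro I refl)+
  also have "... = sweedler a (\<lambda>x z. sweedler x (\<lambda>x1 x2. f x1 x2 z))"
    unfolding F_def by (subst tensor_lift_tensor, (intro I)[1])+ (rule refl)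
  finally show ?thesis using 1 comult_coassoc by metis
qed

lemma sw_mult:
  fixes f :: "'a::hopf_star_algebra \<Rightarrow> 'a \<Rightarrow> 'b::complex_vector"
  assumes "cbilinear f"
  shows "sweedler (a * b) f = sweedler a (\<lambda>x y. sweedler b (\<lambda>z w. f (x * z) (y * w)))"
proof -
  note L = clinear_tensor_lift[OF assms]
  have "sweedler (a * b) f
      = sweedler a (\<lambda>x y. tensor_lift f (sweedler b (\<lambda>z w. (x * z) \<otimes> (y * w))))"
    unfolding comult_mult times_tensor_def
    by (rule clinear_tensor_lift_pull[OF L]) (intro clinear_intros)
  moreover have "tensor_lift f (sweedler b (\<lambda>z w. (x * z) \<otimes> (y * w))) = sweedler b (\<lambda>z w. f (x * z) (y * w))" for x y
  proof -
    have "tensor_lift f (sweedler b (\<lambda>z w. (x * z) \<otimes> (y * w)))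
        = sweedler b (\<lambda>z w. tensor_lift f ((x * z) \<otimes> (y * w)))"
      by (rule clinear_tensor_lift_pull[OF L]) (intro clinear_intros)
    then show ?thesis
      by (simp only: tensor_lift_tensor[OF cbilinear_balanced[OF assms]])
  qed
  ultimately show ?thesis by simp
qed

lemma sw_counit_left: "clinear g \<Longrightarrow> sweedler a (\<lambda>x y. counit x *\<^sub>C g y) = g a"
  using clinear_tensor_lift_pull[of g "\<lambda>x y. counit x *\<^sub>C y" "comult a"]
  by (simp add: counit_left clinear_scale clinear_intros)

lemma sw_counit_right: "clinear g \<Longrightarrow> sweedler a (\<lambda>x y. counit y *\<^sub>C g x) = g a"
  using clinear_tensor_lift_pull[of g "\<lambda>x y. counit y *\<^sub>C x" "comult a"]
  by (simp add: counit_right clinear_scale clinear_intros)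

lemma antipode_mult:
  fixes a b :: "'a::hopf_star_algebra"
  shows "antipode (a * b) = antipode b * antipode a"
proof -
  note I = clinear_intros clinear_compose'[OF clinear_antipode]
  have eps: "sweedler z (\<lambda>x y. sweedler w (\<lambda>u v. x * (u * (antipode v * antipode y))))
      = (counit z * counit w) *\<^sub>C (1::'a)" for z w
  proof -
    have "sweedler z (\<lambda>x y. sweedler w (\<lambda>u v. x * (u * (antipode v * antipode y))))
        = sweedler z (\<lambda>x y. x * (sweedler w (\<lambda>u v. u * antipode v) * antipode y))"
      by (subst clinear_tensor_lift_pull[where g = "\<lambda>s. x * (s * antipode y)" for x y])
        (intro I, intro I, simp add: mult.assoc)
    also have "... = counit w *\<^sub>C sweedler z (\<lambda>x y. x * antipode y)"
      by (subst clinear_tensor_lift_pull[OF clinear_scaleC])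
        (intro I, simp add: antipode_right mult_scaleC_left mult_scaleC_right)
    finally show ?thesis by (simp add: antipode_right scaleC_scaleC mult.commute)
  qed
  have eps': "sweedler z (\<lambda>x y. sweedler w (\<lambda>u v. antipode (x * u) * (y * v)))
      = (counit z * counit w) *\<^sub>C (1::'a)" for z w
  proof -
    have "sweedler z (\<lambda>x y. sweedler w (\<lambda>u v. antipode (x * u) * (y * v))) = sweedler (z * w) (\<lambda>x y. antipode x * y)"
      by (rule sw_mult[symmetric]) (intro I)
    then show ?thesis by (simp add: antipode_left counit_mult)
  qed
  have "antipode (a * b) = sweedler a (\<lambda>x y. counit y *\<^sub>C antipode (x * b))"
    by (rule sw_counit_right[symmetric]) (intro I)
  also have "... = sweedler a (\<lambda>x y. sweedler b (\<lambda>u v. counit v *\<^sub>C counit y *\<^sub>C antipode (x * u)))"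
    by (subst sw_counit_right) (intro I refl)+
  also have "... = sweedler a (\<lambda>x y. sweedler b (\<lambda>u v. antipode (x * u) * ((counit y * counit v) *\<^sub>C 1)))"
    by (simp add: mult_scaleC_right scaleC_scaleC mult.commute)
  also have "... = sweedler a (\<lambda>x y. sweedler b (\<lambda>u v.
      sweedler y (\<lambda>y1 y2. sweedler v (\<lambda>v1 v2. antipode (x * u) * (y1 * (v1 * (antipode v2 * antipode y2)))))))"
    unfolding eps[symmetric]
    apply (subst clinear_tensor_lift_pull[where g = "\<lambda>s. antipode (x * u) * s" for x u])
      apply (intro I) apply (intro I)
    apply (subst clinear_tensor_lift_pull[where g = "\<lambda>s. antipode (x * u) * s" for x u])
      apply (intro I) apply (intro I) apply (rule refl)
    done
  also have "... = sweedler a (\<lambda>x y. sweedler y (\<lambda>y1 y2. sweedler b (\<lambda>u v.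
      sweedler v (\<lambda>v1 v2. antipode (x * u) * (y1 * (v1 * (antipode v2 * antipode y2)))))))"
    by (subst tensor_lift_swap[where s = "comult b"]) (intro I refl)+
  also have "... = sweedler a (\<lambda>y y2. sweedler y (\<lambda>x y1. sweedler b (\<lambda>u v.
      sweedler v (\<lambda>v1 v2. antipode (x * u) * (y1 * (v1 * (antipode v2 * antipode y2)))))))"
    by (rule sw_coassoc[symmetric]) (intro I)+
  also have "... = sweedler a (\<lambda>y y2. sweedler y (\<lambda>x y1. sweedler b (\<lambda>v v2.
      sweedler v (\<lambda>u v1. antipode (x * u) * (y1 * (v1 * (antipode v2 * antipode y2)))))))"
    by (subst sw_coassoc[where a = b]) (intro I refl)+
  also have "... = sweedler a (\<lambda>y y2. sweedler b (\<lambda>v v2. sweedler y (\<lambda>x y1.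
      sweedler v (\<lambda>u v1. antipode (x * u) * (y1 * (v1 * (antipode v2 * antipode y2)))))))"
    by (subst tensor_lift_swap[where t = "comult b"]) (intro I refl)+
  also have "... = sweedler a (\<lambda>y y2. sweedler b (\<lambda>v v2. ((counit y * counit v) *\<^sub>C 1) * (antipode v2 * antipode y2)))"
    unfolding eps'[symmetric]
    apply (subst clinear_tensor_lift_pull[where g = "\<lambda>s. s * (antipode v2 * antipode y2)" for v2 y2])
      apply (intro I) apply (intro I)
    apply (subst clinear_tensor_lift_pull[where g = "\<lambda>s. s * (antipode v2 * antipode y2)" for v2 y2])
      apply (intro I) apply (intro I) apply (simp add: mult.assoc)
    done
  also have "... = sweedler a (\<lambda>y y2. sweedler b (\<lambda>v v2. counit v *\<^sub>C counit y *\<^sub>C (antipode v2 * antipode y2)))"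
    by (simp add: mult_scaleC_left scaleC_scaleC mult.commute)
  also have "... = sweedler a (\<lambda>y y2. counit y *\<^sub>C (antipode b * antipode y2))"
    by (subst sw_counit_left) (intro I refl)+
  also have "... = antipode b * antipode a"
    by (rule sw_counit_left) (intro I)
  finally show ?thesis .
qed

lemma star_0 [simp]: "star (0::'a::star_algebra) = 0"
  using star_scaleC[of 0 "0::'a"] by simp

lemma star_1 [simp]: "star (1::'a::star_algebra) = 1"
  by (metis mult.left_neutral mult.right_neutral star_mult star_star)

lemma antipode_1 [simp]: "antipode (1::'a::hopf_star_algebra) = 1"
proof -
  have "sweedler (1::'a) (\<lambda>x y. antipode x * y) = antipode 1 * 1"
    unfolding comult_one one_tensor_def
    by (rule tensor_lift_tensor) (intro cbilinear_balanced clinear_intros)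
  then show ?thesis by (simp add: antipode_left counit_one clinear_scale scaleC_one)
qed

lemma sw_star:
  fixes f :: "'a::hopf_star_algebra \<Rightarrow> 'a \<Rightarrow> 'b::complex_vector"
  assumes "cbilinear f"
  shows "sweedler (star a) f = sweedler a (\<lambda>x y. f (star x) (star y))"
proof -
  have f: "balanced f" using assms by (rule cbilinear_balanced)
  then have f': "balanced (\<lambda>x y. f (star x) (star y))"
    by (simp add: balanced_def star_add star_scaleC)
  have s: "balanced (\<lambda>(x::'a) (y::'a). star x \<otimes> star y)"
    by (simp add: balanced_def star_add star_scaleC tensor_add_left tensor_add_right
        tensor_scale_left tensor_scale_right)
  have "tensor_lift f (tensor_lift (\<lambda>x y. star x \<otimes> star y) t) = tensor_lift (\<lambda>x y. f (star x) (star y)) t" for t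
    by (induction t rule: tensor_induct) (simp_all add: tensor_lift_add tensor_lift_tensor f f' s)
  then show ?thesis by (simp add: comult_star star_tensor_def)
qed

lemma counit_star: "counit (star a) = cnj (counit (a::'a::hopf_star_algebra))"
proof -
  define e :: "'a \<Rightarrow> complex" where "e x = cnj (counit (star x))" for x
  have e: "clinear e"
    by (simp add: e_def[abs_def] clinear_iff star_add star_scaleC clinear_add[OF clinear_counit]
        clinear_scale[OF clinear_counit])
  note I = clinear_intros clinear_compose'[OF e]
  have "a = star (sweedler (star a) (\<lambda>x y. counit y *\<^sub>C x))"
    by (simp add: counit_right star_star)
  also have "... = star (sweedler a (\<lambda>x y. counit (star y) *\<^sub>C star x))"
    by (subst sw_star) (intro I refl)+
  also have "... = sweedler a (\<lambda>x y. e y *\<^sub>C x)"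
  proof -
    have b: "balanced (\<lambda>(x::'a) (y::'a). counit (star y) *\<^sub>C star x)"
      by (simp add: balanced_def star_add star_scaleC scaleC_add_left scaleC_add_right
          scaleC_scaleC mult.commute clinear_add[OF clinear_counit] clinear_scale[OF clinear_counit])
    have "star (tensor_lift (\<lambda>x y. counit (star y) *\<^sub>C star x) t) = tensor_lift (\<lambda>x y. e y *\<^sub>C x) t"
      for t :: "('a, 'a) tensor"
    proof (induction t rule: tensor_induct)
      case (add a b t)
      have "balanced (\<lambda>(x::'a) y. e y *\<^sub>C x)" by (intro cbilinear_balanced I)
      with add show ?case
        by (simp add: b tensor_lift_add tensor_lift_tensor star_add star_scaleC star_star e_def)
    qed simp
    then show ?thesis .
  qed
  finally have "counit a = counit (sweedler a (\<lambda>x y. e y *\<^sub>C x))" by simp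
  also have "... = sweedler a (\<lambda>x y. counit (e y *\<^sub>C x))"
    by (rule clinear_tensor_lift_pull) (intro I clinear_counit)+
  also have "... = sweedler a (\<lambda>x y. counit x *\<^sub>C e y)"
    by (simp add: clinear_scale[OF clinear_counit] mult.commute)
  also have "... = e a"
    by (rule sw_counit_left[OF e])
  finally show ?thesis by (simp add: e_def)
qed

lemma antipode_star_antipode_star: "antipode (star (antipode (star a))) = (a::'a::hopf_star_algebra)"
proof -
  define T :: "'a \<Rightarrow> 'a" where "T x = star (antipode (star x))" for x
  have T: "clinear T"
    by (simp add: T_def[abs_def] clinear_iff star_add star_scaleC clinear_add[OF clinear_antipode]
        clinear_scale[OF clinear_antipode])
  note I = clinear_intros clinear_compose'[OF T]
  have T_inv: "sweedler z (\<lambda>x y. T y * x) = counit z *\<^sub>C 1" for z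
  proof -
    have "star (tensor_lift (\<lambda>x y. T y * x) t) = tensor_lift (\<lambda>x y. star x * antipode (star y)) t" for t :: "('a, 'a) tensor"
    proof (induction t rule: tensor_induct)
      case (add a b t)
      have "balanced (\<lambda>x y. T y * x)" by (intro cbilinear_balanced I)
      moreover have "balanced (\<lambda>(x::'a) y. star x * antipode (star y))"
        by (simp add: balanced_def star_add star_scaleC distrib_left distrib_right mult_scaleC_left
            mult_scaleC_right clinear_add[OF clinear_antipode] clinear_scale[OF clinear_antipode])
      ultimately show ?case using add
        by (simp add: tensor_lift_add tensor_lift_tensor star_add star_mult star_star T_def)
    qed simp
    then have "star (sweedler z (\<lambda>x y. T y * x)) = sweedler z (\<lambda>x y. star x * antipode (star y))" .
    also have "... = sweedler (star z) (\<lambda>x y. x * antipode y)"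
      by (rule sw_star[symmetric]) (intro I)
    finally have "star (sweedler z (\<lambda>x y. T y * x)) = counit (star z) *\<^sub>C 1" by (simp add: antipode_right)
    then have "star (star (sweedler z (\<lambda>x y. T y * x))) = counit z *\<^sub>C 1"
      by (simp add: star_scaleC counit_star)
    then show ?thesis by (simp add: star_star)
  qed
  have "antipode (T a) = sweedler a (\<lambda>x y. counit x *\<^sub>C antipode (T y))"
    by (rule sw_counit_left[symmetric]) (intro I)
  also have "... = sweedler a (\<lambda>x y. sweedler x (\<lambda>u v. u * antipode v) * antipode (T y))"
    by (simp add: antipode_right mult_scaleC_left)
  also have "... = sweedler a (\<lambda>x y. sweedler x (\<lambda>u v. u * antipode (T y * v)))"
    by (subst clinear_tensor_lift_pull[where g = "\<lambda>s. s * antipode (T y)" for y])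
      (intro I, intro I, simp add: mult.assoc antipode_mult)
  also have "... = sweedler a (\<lambda>u y. sweedler y (\<lambda>v y. u * antipode (T y * v)))"
    by (rule sw_coassoc) (intro I)+
  also have "... = sweedler a (\<lambda>u y. u * antipode (sweedler y (\<lambda>v y. T y * v)))"
    by (subst clinear_tensor_lift_pull[where g = "\<lambda>s. u * antipode s" for u]) (intro I refl)+
  also have "... = sweedler a (\<lambda>u y. counit y *\<^sub>C u)"
    by (simp add: T_inv clinear_scale[OF clinear_antipode] mult_scaleC_right)
  also have "... = a" by (rule counit_right)
  finally show ?thesis by (simp add: T_def)
qed

lemma bij_antipode: "bij (antipode :: 'a::hopf_star_algebra \<Rightarrow> 'a)"
proof (rule o_bij)
  show "antipode \<circ> (\<lambda>a. star (antipode (star a))) = (id :: 'a \<Rightarrow> 'a)"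
    by (simp add: fun_eq_iff antipode_star_antipode_star)
  show "(\<lambda>a. star (antipode (star a))) \<circ> antipode = (id :: 'a \<Rightarrow> 'a)"
    using antipode_star_antipode_star[of "star a" for a :: 'a] by (simp add: fun_eq_iff star_star)
qed

abbreviation antipode_inv :: "'a::hopf_star_algebra \<Rightarrow> 'a"
  where "antipode_inv \<equiv> inv antipode"

lemma antipode_inv_eq: "antipode_inv a = star (antipode (star a))"
  by (metis antipode_star_antipode_star bij_antipode bij_inv_eq_iff)

lemma clinear_antipode_inv: "clinear antipode_inv"
  by (simp add: antipode_inv_eq[abs_def] clinear_iff star_add star_scaleC
      clinear_add[OF clinear_antipode] clinear_scale[OF clinear_antipode])

section \<open>The full dual\<close>

typedef (overloaded) 'a dual = "{h :: 'a::complex_vector \<Rightarrow> complex. clinear h}"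
  morphisms dual_apply Abs_dual
  by (rule exI[of _ "\<lambda>_. 0"]) (simp add: clinear_iff)

setup_lifting type_definition_dual

instantiation dual :: (complex_vector) complex_vector
begin

lift_definition zero_dual :: "'a dual" is "\<lambda>_. 0"
  by (simp add: clinear_iff)
lift_definition plus_dual :: "'a dual \<Rightarrow> 'a dual \<Rightarrow> 'a dual" is "\<lambda>h k a. h a + k a"
  by (simp add: clinear_iff algebra_simps)
lift_definition minus_dual :: "'a dual \<Rightarrow> 'a dual \<Rightarrow> 'a dual" is "\<lambda>h k a. h a - k a"
  by (simp add: clinear_iff algebra_simps)
lift_definition uminus_dual :: "'a dual \<Rightarrow> 'a dual" is "\<lambda>h a. - h a"
  by (simp add: clinear_iff)
lift_definition scaleC_dual :: "complex \<Rightarrow> 'a dual \<Rightarrow> 'a dual" is "\<lambda>c h a. c * h a"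
  by (auto simp: clinear_iff algebra_simps)

instance
  by standard (transfer; simp add: fun_eq_iff algebra_simps)+

end

instantiation dual :: (hopf_star_algebra) "{one, times, star}"
begin

lift_definition one_dual :: "'a dual" is counit
  by (rule clinear_counit)

lift_definition times_dual :: "'a dual \<Rightarrow> 'a dual \<Rightarrow> 'a dual"
  is "\<lambda>h k a. sweedler a (\<lambda>x y. h x * k y)"
  by (intro clinear_intros clinear_compose'[of "tensor_lift _"] clinear_tensor_lift clinear_comult)

lift_definition star_dual :: "'a dual \<Rightarrow> 'a dual"
  is "\<lambda>h a. cnj (h (star (antipode a)))"
  by (simp add: clinear_iff star_add star_scaleC clinear_add[OF clinear_antipode]
      clinear_scale[OF clinear_antipode])

instance ..

end

lift_definition dual_antipode_inv :: "'a::hopf_star_algebra dual \<Rightarrow> 'a dual"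
  is "\<lambda>h a. h (antipode_inv a)"
  by (erule clinear_compose'[OF _ clinear_antipode_inv])

text \<open>\<open>dual_slice a h b\<close> is the functional \<open>y \<mapsto> h (a y b)\<close>, that is,
  \<open>(a, h\<^sub>(\<^sub>1\<^sub>)) (b, h\<^sub>(\<^sub>3\<^sub>)) h\<^sub>(\<^sub>2\<^sub>)\<close> for the coproduct of the dual.\<close>

lift_definition dual_slice :: "'a::hopf_star_algebra \<Rightarrow> 'a dual \<Rightarrow> 'a \<Rightarrow> 'a dual"
  is "\<lambda>a h b y. h (a * y * b)"
  by (erule clinear_compose') (intro clinear_mult_left clinear_mult_right clinear_ident)

definition right_act :: "'a::hopf_star_algebra \<Rightarrow> 'a dual \<Rightarrow> 'a"  (infixl \<open>\<lhd>\<close> 75) where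
  "a \<lhd> h = sweedler a (\<lambda>x y. dual_apply h x *\<^sub>C y)"


section \<open>The Drinfeld double\<close>

text \<open>
  The double is \<open>A \<otimes> U\<close> as a vector space, \<open>a \<otimes> h\<close> standing for the product \<open>a h\<close>. Its commutation
  relation is \<open>h\<^sub>(\<^sub>1\<^sub>) (a \<lhd> h\<^sub>(\<^sub>2\<^sub>)) = (a\<^sub>(\<^sub>2\<^sub>), h\<^sub>(\<^sub>1\<^sub>)) a\<^sub>(\<^sub>1\<^sub>) h\<^sub>(\<^sub>2\<^sub>)\<close>, equivalently
  \<open>h a = a\<^sub>(\<^sub>2\<^sub>) h(a\<^sub>(\<^sub>3\<^sub>) \<cdot> S\<^sup>-\<^sup>1(a\<^sub>(\<^sub>1\<^sub>)))\<close>; the right-hand side of the latter is \<open>double_cross h a\<close>.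
\<close>

typedef (overloaded) 'a double = "UNIV :: ('a::hopf_star_algebra, 'a dual) tensor set"
  morphisms double_tensor Double ..

setup_lifting type_definition_double

instantiation double :: (hopf_star_algebra) complex_vector
begin

lift_definition zero_double :: "'a double" is 0 .
lift_definition plus_double :: "'a double \<Rightarrow> 'a double \<Rightarrow> 'a double" is "(+)" .
lift_definition minus_double :: "'a double \<Rightarrow> 'a double \<Rightarrow> 'a double" is "(-)" .
lift_definition uminus_double :: "'a double \<Rightarrow> 'a double" is uminus .
lift_definition scaleC_double :: "complex \<Rightarrow> 'a double \<Rightarrow> 'a double" is scaleC .

instance
  by standard
    (transfer; simp add: scaleC_add_left scaleC_add_right scaleC_scaleC scaleC_one)+

end

definition double_cross :: "'a::hopf_star_algebra dual \<Rightarrow> 'a \<Rightarrow> ('a, 'a dual) tensor" where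
  "double_cross h a =
     sweedler a (\<lambda>x a3. sweedler x (\<lambda>a1 a2. a2 \<otimes> dual_slice a3 h (antipode_inv a1)))"

definition double_of_alg :: "'a::hopf_star_algebra \<Rightarrow> 'a double" where
  "double_of_alg a = Double (a \<otimes> 1)"

definition double_of_dual :: "'a::hopf_star_algebra dual \<Rightarrow> 'a double" where
  "double_of_dual h = Double (1 \<otimes> h)"

definition double_counit :: "'a::hopf_star_algebra double \<Rightarrow> complex" where
  "double_counit s = tensor_lift (\<lambda>a h. counit a * dual_apply h 1) (double_tensor s)"

instantiation double :: (hopf_star_algebra) "{one, times, star}"
begin

definition one_double :: "'a double" where
  "1 = Double (1 \<otimes> 1)"

definition times_double :: "'a double \<Rightarrow> 'a double \<Rightarrow> 'a double" where
  "s * t = Double (tensor_lift (\<lambda>a h. tensor_lift (\<lambda>b k.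
       tensor_lift (\<lambda>b' h'. (a * b') \<otimes> (h' * k)) (double_cross h b))
     (double_tensor t)) (double_tensor s))" for s t :: "'a double"

text \<open>\<open>(a h)\<^sup>* = h\<^sup>* a\<^sup>*\<close>\<close>

definition star_double :: "'a double \<Rightarrow> 'a double" where
  "star s = Double (tensor_lift (\<lambda>a h. double_cross (star h) (star a)) (double_tensor s))"
  for s :: "'a double"

instance ..

end

lemma clinear_dual_apply: "clinear (dual_apply h)"
  using dual_apply by auto

lemma dual_apply_add: "dual_apply (h + k) a = dual_apply h a + dual_apply k a"
  and dual_apply_scaleC: "dual_apply (c *\<^sub>C h) a = c * dual_apply h a"
  by (simp_all add: plus_dual.rep_eq scaleC_dual.rep_eq)

lemma dual_eqI:
  assumes "\<And>a. dual_apply h a = dual_apply k a"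
  shows "h = k"
proof -
  have "dual_apply h = dual_apply k"
    using assms by (rule ext)
  then show ?thesis by (rule dual_apply_inject[THEN iffD1])
qed

lemma clinear_dual_eval: "clinear (\<lambda>h. dual_apply h a)"
  by (simp add: clinear_iff dual_apply_add dual_apply_scaleC)

lemma clinear_dualI:
  assumes "\<And>a. clinear (\<lambda>x. dual_apply (g x) a)"
  shows "clinear g"
  unfolding clinear_iff
proof (intro conjI allI; rule dual_eqI)
  show "dual_apply (g (x + y)) a = dual_apply (g x + g y) a" for x y a
    using clinear_add[OF assms] by (simp only: dual_apply_add)
  show "dual_apply (g (c *\<^sub>C x)) a = dual_apply (c *\<^sub>C g x) a" for c x a
    using clinear_scale[OF assms] by (simp only: dual_apply_scaleC scaleC_complex_def)
qed

lemma clinear_dual_slice: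
  "clinear g \<Longrightarrow> clinear (\<lambda>x. dual_slice (g x) h b)"
  "clinear g' \<Longrightarrow> clinear (\<lambda>x. dual_slice a (g' x) b)"
  "clinear g \<Longrightarrow> clinear (\<lambda>x. dual_slice a h (g x))"
  by (rule clinear_dualI, unfold dual_slice.rep_eq,
      intro clinear_compose'[OF clinear_dual_apply] clinear_compose'[OF clinear_dual_eval]
        clinear_mult_left clinear_mult_right, assumption)+

lemmas dual_intros = clinear_intros clinear_dual_slice clinear_compose'[OF clinear_dual_apply]
  clinear_compose'[OF clinear_antipode_inv]

lemma clinear_double_cross:
  "clinear g \<Longrightarrow> clinear (\<lambda>x. double_cross h (g x))"
  "clinear g' \<Longrightarrow> clinear (\<lambda>x. double_cross (g' x) a)"
  unfolding double_cross_def by (intro dual_intros; assumption)+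

lemma clinear_dual_mult:
  "clinear g \<Longrightarrow> clinear (\<lambda>x. g x * (k::'a::hopf_star_algebra dual))"
  "clinear g \<Longrightarrow> clinear (\<lambda>x. (k::'a::hopf_star_algebra dual) * g x)"
  by (rule clinear_dualI, unfold times_dual.rep_eq,
      intro dual_intros clinear_compose'[OF clinear_dual_eval], assumption)+

lemma double_mult:
  "Double (a \<otimes> h) * Double (b \<otimes> k)
    = Double (tensor_lift (\<lambda>b' h'. (a * b') \<otimes> (h' * k)) (double_cross h b))"
proof -
  note I = cbilinear_balanced dual_intros clinear_dual_mult
    clinear_compose'[OF clinear_tensor_lift] clinear_double_cross
  show ?thesis
    unfolding times_double_def Double_inverse[OF UNIV_I]
    by (subst tensor_lift_tensor, (intro I)[1])+ (rule HOL.refl)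
qed

section \<open>Corepresentations\<close>

text \<open>
  A finite-dimensional corepresentation with a chosen orthonormal basis is the matrix of its
  coefficients \<open>coef U i j\<close>, \<open>i, j < cdim U\<close>; its space is \<open>corep_space U\<close>, a copy of \<open>\<complex>\<^sup>n\<close>, and the
  functional \<open>h\<close> acts on it by the matrix \<open>h (coef U i j)\<close>.
\<close>

datatype 'a corep = Corep (cdim: nat) (coef: "nat \<Rightarrow> nat \<Rightarrow> 'a")

definition unitary_corep :: "'a::hopf_star_algebra corep \<Rightarrow> bool" where
  "unitary_corep U \<longleftrightarrow> (\<forall>i<cdim U. \<forall>j<cdim U.
     comult (coef U i j) = (\<Sum>k<cdim U. coef U i k \<otimes> coef U k j) \<and>
     counit (coef U i j) = (if i = j then 1 else 0) \<and>
     (\<Sum>k<cdim U. star (coef U k i) * coef U k j) = (if i = j then 1 else 0) \<and>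
     (\<Sum>k<cdim U. coef U i k * star (coef U j k)) = (if i = j then 1 else 0))"

class cqg_hopf_star_algebra =
  assumes span_matrix_coefficients: "complex_vector.span
    {coef U i j | U i j. unitary_corep U \<and> i < cdim U \<and> j < cdim U} = (UNIV :: 'a::hopf_star_algebra set)"

definition corep_space :: "'a corep \<Rightarrow> (nat \<Rightarrow> complex) set" where
  "corep_space U = {v. \<forall>i\<ge>cdim U. v i = 0}"

definition dual_act :: "'a::hopf_star_algebra corep \<Rightarrow> 'a dual \<Rightarrow> (nat \<Rightarrow> complex) \<Rightarrow> nat \<Rightarrow> complex" where
  "dual_act U h v =
     (\<lambda>i. if i < cdim U then \<Sum>j<cdim U. dual_apply h (coef U i j) * v j else 0)"

text \<open>Subspaces of \<open>corep_space U\<close> as representations of a subalgebra \<open>X\<close> of the dual:\<close>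

definition subrep :: "'a::hopf_star_algebra dual set \<Rightarrow> 'a corep \<Rightarrow> (nat \<Rightarrow> complex) set \<Rightarrow> bool" where
  "subrep X U G \<longleftrightarrow> complex_vector.subspace G \<and> G \<subseteq> corep_space U \<and>
     (\<forall>h\<in>X. \<forall>v\<in>G. dual_act U h v \<in> G)"

definition irreducible_subrep ::
  "'a::hopf_star_algebra dual set \<Rightarrow> 'a corep \<Rightarrow> (nat \<Rightarrow> complex) set \<Rightarrow> bool" where
  "irreducible_subrep X U G \<longleftrightarrow> subrep X U G \<and> G \<noteq> {0} \<and>
     (\<forall>W. subrep X U W \<and> W \<subseteq> G \<longrightarrow> W = {0} \<or> W = G)"

definition equivalent_subrep ::
  "'a::hopf_star_algebra dual set \<Rightarrow> 'a corep \<Rightarrow> (nat \<Rightarrow> complex) set \<Rightarrow>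
    'a corep \<Rightarrow> (nat \<Rightarrow> complex) set \<Rightarrow> bool" where
  "equivalent_subrep X U G U' G' \<longleftrightarrow> (\<exists>T. clinear_on G T \<and> bij_betw T G G' \<and>
     (\<forall>h\<in>X. \<forall>v\<in>G. T (dual_act U h v) = dual_act U' h (T v)))"

definition irreducible_unitary_corep :: "'a::hopf_star_algebra corep \<Rightarrow> bool" where
  "irreducible_unitary_corep U \<longleftrightarrow> unitary_corep U \<and> irreducible_subrep UNIV U (corep_space U)"

definition equivalent_corep :: "'a::hopf_star_algebra corep \<Rightarrow> 'a corep \<Rightarrow> bool" where
  "equivalent_corep U V \<longleftrightarrow> equivalent_subrep UNIV U (corep_space U) V (corep_space V)"

definition maximal_irreducible_coreps :: "('i \<Rightarrow> 'a::hopf_star_algebra corep) \<Rightarrow> bool" where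
  "maximal_irreducible_coreps H \<longleftrightarrow>
     (\<forall>\<alpha>. irreducible_unitary_corep (H \<alpha>)) \<and>
     (\<forall>\<alpha> \<alpha>'. equivalent_corep (H \<alpha>) (H \<alpha>') \<longrightarrow> \<alpha> = \<alpha>') \<and>
     (\<forall>U. irreducible_unitary_corep U \<longrightarrow> (\<exists>\<alpha>. equivalent_corep U (H \<alpha>)))"


section \<open>Coideals and stabilizer duals\<close>

definition star_subalgebra :: "'x::{complex_vector, times, star} set \<Rightarrow> bool" where
  "star_subalgebra X \<longleftrightarrow> complex_vector.subspace X \<and>
     (\<forall>x\<in>X. \<forall>y\<in>X. x * y \<in> X) \<and> (\<forall>x\<in>X. star x \<in> X)"

definition left_coideal_star_subalgebra :: "'a::hopf_star_algebra set \<Rightarrow> bool" where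
  "left_coideal_star_subalgebra B \<longleftrightarrow> star_subalgebra B \<and> 1 \<in> B \<and>
     (\<forall>x\<in>B. comult x \<in> complex_vector.span {a \<otimes> b | a b. b \<in> B})"

definition augmentation_ideal :: "'a::hopf_star_algebra set \<Rightarrow> 'a set" where
  "augmentation_ideal B = complex_vector.span {x * a | x a. x \<in> B \<and> counit x = 0}"

text \<open>\<open>Hom(A / B\<^sub>+A, \<complex>)\<close> inside \<open>Hom(A, \<complex>)\<close>:\<close>

definition stabilizer :: "'a::hopf_star_algebra set \<Rightarrow> 'a dual set" where
  "stabilizer B = {\<omega>. \<forall>a\<in>augmentation_ideal B. dual_apply \<omega> a = 0}"

text \<open>The relation \<open>\<omega> x = (x \<lhd> S\<^sup>-\<^sup>1(\<omega>\<^sub>(\<^sub>2\<^sub>))) \<omega>\<^sub>(\<^sub>1\<^sub>)\<close>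
  for \<open>x\<close> in \<open>B\<close> and \<open>\<omega>\<close> in the stabilizer is a special case of that of the double:\<close>

lemma double_commute:
  assumes B: "left_coideal_star_subalgebra B" and x: "x \<in> B" and \<omega>: "\<omega> \<in> stabilizer B"
  shows "double_of_dual \<omega> * double_of_alg x
    = sweedler x (\<lambda>x1 x2. double_of_alg x2 * double_of_dual (dual_slice 1 \<omega> (antipode_inv x1)))"
proof -
  let ?f = "\<lambda>b y. sweedler y (\<lambda>y1 y2. y2 \<otimes> dual_slice b \<omega> (antipode_inv y1))"
  have slice: "dual_slice b \<omega> c = counit b *\<^sub>C dual_slice 1 \<omega> c" if "b \<in> B" for b c
  proof -
    have "dual_apply \<omega> (b * y * c) = counit b * dual_apply \<omega> (y * c)" for y
    proof -
      have "b - counit b *\<^sub>C 1 \<in> B"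
        using B that unfolding left_coideal_star_subalgebra_def star_subalgebra_def
        by (blast intro: complex_vector.subspace_diff complex_vector.subspace_scale)
      moreover have "counit (b - counit b *\<^sub>C 1) = 0"
        using clinear_add[OF clinear_counit, of "b - counit b *\<^sub>C 1" "counit b *\<^sub>C 1"]
        by (simp add: clinear_scale[OF clinear_counit] counit_one)
      ultimately have "(b - counit b *\<^sub>C 1) * (y * c) \<in> augmentation_ideal B"
        unfolding augmentation_ideal_def by (blast intro: complex_vector.span_base)
      then have "dual_apply \<omega> ((b - counit b *\<^sub>C 1) * (y * c)) = 0"
        using \<omega> by (simp add: stabilizer_def)
      moreover have "b * y * c = (b - counit b *\<^sub>C 1) * (y * c) + counit b *\<^sub>C (y * c)"
        by (simp add: left_diff_distrib mult_scaleC_left mult.assoc)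
      ultimately show ?thesis
        by (simp add: clinear_add[OF clinear_dual_apply] clinear_scale[OF clinear_dual_apply])
    qed
    then show ?thesis
      by (intro dual_eqI) (simp add: dual_slice.rep_eq dual_apply_scaleC)
  qed
  have bil: "cbilinear (\<lambda>y b. ?f b y)" "cbilinear (\<lambda>y b. counit b *\<^sub>C ?f 1 y)"
    by (intro dual_intros)+
  have eq: "tensor_lift (\<lambda>y b. ?f b y) t = tensor_lift (\<lambda>y b. counit b *\<^sub>C ?f 1 y) t"
    if "t \<in> complex_vector.span {a \<otimes> b | a b. b \<in> B}" for t
    using that
  proof (induction rule: complex_vector.span_induct_alt)
    case (step c z t)
    then obtain a b where z: "z = a \<otimes> b" "b \<in> B" by blast
    have "?f b a = counit b *\<^sub>C ?f 1 a"
      unfolding slice[OF z(2)] tensor_scale_right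
      by (rule clinear_tensor_lift_pull[OF clinear_scaleC, symmetric]) (intro dual_intros)
    moreover have "tensor_lift (\<lambda>y b. ?f b y) (a \<otimes> b) = ?f b a"
      "tensor_lift (\<lambda>y b. counit b *\<^sub>C ?f 1 y) (a \<otimes> b) = counit b *\<^sub>C ?f 1 a"
      by (rule tensor_lift_tensor[OF bil(1)[THEN cbilinear_balanced]],
          rule tensor_lift_tensor[OF bil(2)[THEN cbilinear_balanced]])
    ultimately show ?case
      by (simp only: z tensor_lift_add step.IH bil[THEN clinear_tensor_lift, THEN clinear_scale])
  qed simp
  have "double_cross \<omega> x = tensor_lift (\<lambda>y b. ?f b y) (comult x)"
    by (simp add: double_cross_def)
  also have "... = sweedler x (\<lambda>y b. counit b *\<^sub>C ?f 1 y)"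
    using B x by (intro eq) (simp add: left_coideal_star_subalgebra_def)
  also have "... = ?f 1 x"
    by (rule sw_counit_right) (intro dual_intros)
  finally have cross: "double_cross \<omega> x = ?f 1 x" .
  have one: "h * 1 = h" "1 * h = h" for h :: "'a dual"
  proof -
    have "dual_apply (h * 1) a = dual_apply h a" "dual_apply (1 * h) a = dual_apply h a" for a
      using sw_counit_right[OF clinear_dual_apply, where a = a] sw_counit_left[OF clinear_dual_apply, where a = a]
      by (simp_all add: times_dual.rep_eq one_dual.rep_eq mult.commute)
    then show "h * 1 = h" "1 * h = h"
      by (simp_all only: dual_eqI)
  qed
  have lift_id: "tensor_lift (\<lambda>a h. a \<otimes> h) t = t" for t :: "('a, 'a dual) tensor"
    by (rule tensor_lift_unique[symmetric]) (rule HOL.refl | intro cbilinear_balanced dual_intros)+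
  have inv1: "antipode_inv 1 = (1::'a)"
    by (simp add: antipode_inv_eq)
  have cross1: "double_cross (1::'a dual) 1 = 1 \<otimes> 1"
    unfolding double_cross_def comult_one one_tensor_def
    apply (subst tensor_lift_tensor, intro cbilinear_balanced dual_intros)
    apply (unfold comult_one one_tensor_def)
    apply (subst tensor_lift_tensor, intro cbilinear_balanced dual_intros)
    apply (rule arg_cong[where f = "(\<otimes>) 1"])
    apply (rule dual_eqI)
    apply (simp add: inv1 one_dual.rep_eq dual_slice.rep_eq)
    done
  have prod: "double_of_alg a * double_of_dual h = Double (a \<otimes> h)" for a :: 'a and h
    unfolding double_of_alg_def double_of_dual_def double_mult cross1
    by (subst tensor_lift_tensor) (intro cbilinear_balanced dual_intros clinear_dual_mult, simp add: one)
  have Double: "clinear (Double :: _ \<Rightarrow> 'a double)"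
    by (simp add: clinear_iff plus_double.abs_eq scaleC_double.abs_eq)
  have "double_of_dual \<omega> * double_of_alg x = Double (?f 1 x)"
    unfolding double_of_alg_def double_of_dual_def double_mult
    by (simp add: one cross lift_id)
  also have "... = sweedler x (\<lambda>x1 x2. Double (x2 \<otimes> dual_slice 1 \<omega> (antipode_inv x1)))"
    by (rule clinear_tensor_lift_pull[OF Double]) (intro dual_intros)
  finally show ?thesis by (simp add: prod)
qed

text \<open>The representation \<open>G \<beta>\<close> is a subrepresentation of \<open>H (p \<beta>)\<close>.\<close>

definition maximal_stabilizer_irreps ::
  "'a::hopf_star_algebra set \<Rightarrow> ('i \<Rightarrow> 'a corep) \<Rightarrow> ('j \<Rightarrow> 'i) \<Rightarrow> ('j \<Rightarrow> (nat \<Rightarrow> complex) set) \<Rightarrow> bool" where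
  "maximal_stabilizer_irreps B H p G \<longleftrightarrow>
     (\<forall>\<beta>. irreducible_subrep (stabilizer B) (H (p \<beta>)) (G \<beta>)) \<and>
     (\<forall>\<beta> \<beta>'. equivalent_subrep (stabilizer B) (H (p \<beta>)) (G \<beta>) (H (p \<beta>')) (G \<beta>') \<longrightarrow> \<beta> = \<beta>') \<and>
     (\<forall>\<alpha> W. irreducible_subrep (stabilizer B) (H \<alpha>) W \<longrightarrow>
       (\<exists>\<beta>. equivalent_subrep (stabilizer B) (H \<alpha>) W (H (p \<beta>)) (G \<beta>)))"

text \<open>\<open>\<Oplus>\<^sub>\<beta> \<bool>(G \<beta>)\<close> inside \<open>\<Prod>\<^sub>\<beta> \<bool>(G \<beta>)\<close>: all but finitely many components vanish.\<close>

definition stabilizer_dual ::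
  "'a::hopf_star_algebra set \<Rightarrow> ('i \<Rightarrow> 'a corep) \<Rightarrow> ('j \<Rightarrow> 'i) \<Rightarrow> ('j \<Rightarrow> (nat \<Rightarrow> complex) set) \<Rightarrow> 'a dual set" where
  "stabilizer_dual B H p G =
     {\<omega> \<in> stabilizer B. finite {\<beta>. \<exists>v\<in>G \<beta>. dual_act (H (p \<beta>)) \<omega> v \<noteq> 0}}"

definition double_coideal :: "'a::hopf_star_algebra set \<Rightarrow> 'a dual set \<Rightarrow> 'a double set"  (infix \<open>\<bowtie>\<close> 70) where
  "B \<bowtie> Ic = star_subalgebra hull (double_of_alg ` B \<union> double_of_dual ` Ic)"


section \<open>Representations and cocycles\<close>

text \<open>
  Representations of unital algebras are taken to be unital; the double coideal contains the unit
  of the double since \<open>1 \<in> B\<close>. Adjointability of the operators is part of the last condition.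
\<close>

definition star_representation ::
  "'x::{complex_vector, one, times, star} set \<Rightarrow> ('x \<Rightarrow> 'h::complex_inner \<Rightarrow> 'h) \<Rightarrow> bool" where
  "star_representation X \<pi> \<longleftrightarrow>
     (\<forall>x\<in>X. clinear (\<pi> x)) \<and> clinear_on X \<pi> \<and> \<pi> 1 = id \<and>
     (\<forall>x\<in>X. \<forall>y\<in>X. \<pi> (x * y) = \<pi> x \<circ> \<pi> y) \<and>
     (\<forall>x\<in>X. \<forall>\<xi> \<eta>. cinner (\<pi> x \<xi>) \<eta> = cinner \<xi> (\<pi> (star x) \<eta>))"

definition cocycle ::
  "'x::{complex_vector, times} set \<Rightarrow> ('x \<Rightarrow> 'h::complex_vector \<Rightarrow> 'h) \<Rightarrow> ('x \<Rightarrow> complex) \<Rightarrow> ('x \<Rightarrow> 'h) \<Rightarrow> bool" where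
  "cocycle X \<pi> \<epsilon> C \<longleftrightarrow> clinear_on X C \<and>
     (\<forall>x\<in>X. \<forall>y\<in>X. C (x * y) = \<pi> x (C y) + \<epsilon> y *\<^sub>C C x)"

end

theory Submission
  imports Defs
begin

text \<open>
  Extend \<open>C\<close> linearly to \<open>L\<close> on all of \<open>A\<close>; the only candidate for the extended cocycle is the restriction
  of \<open>a h \<mapsto> h(1) L a\<close>, defined on the whole double. Since \<open>\<omega> x = x\<^sub>(\<^sub>2\<^sub>) \<omega>(\<cdot> S\<^sup>-\<^sup>1(x\<^sub>(\<^sub>1\<^sub>)))\<close> and \<open>\<omega>\<close> in the
  stabilizer satisfies \<open>\<omega>(S\<^sup>-\<^sup>1(x)) = \<epsilon>(x) \<omega>(1)\<close>, its value at \<open>\<omega> x\<close> is \<open>C (x \<lhd> S\<^sup>-\<^sup>1(\<omega>))\<close>, while the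
  cocycle identity predicts \<open>\<pi>(\<omega>) C x\<close>: this comparison is the Yetter--Drinfeld condition.

  What makes it legitimate is that the double coideal is spanned by the products \<open>x h\<close> with \<open>x\<close> in \<open>B\<close> and
  \<open>h\<close> in \<open>\<complex>1 + I\<^sub>c\<close>, hence that \<open>\<omega>(\<cdot> c)\<close> lies in \<open>I\<^sub>c\<close> whenever \<open>\<omega>\<close> does. To see this, \<open>I\<^sub>c\<close> is characterised
  as the set of all \<open>\<omega>\<close> in \<open>I\<close> for which \<open>I \<omega>\<close> is finite-dimensional. One inclusion holds since \<open>I\<close> acts
  faithfully on the sum of the \<open>G \<beta>\<close>, by complete reducibility of unitary representations; the other
  since the \<open>G \<beta>\<close> are simple and pairwise inequivalent.
\<close>

section \<open>Coideals and stabilizers\<close>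

lemma star_subalgebraD:
  assumes "star_subalgebra X"
  shows "complex_vector.subspace X"
    and "x \<in> X \<Longrightarrow> y \<in> X \<Longrightarrow> x * y \<in> X"
    and "x \<in> X \<Longrightarrow> star x \<in> X"
  using assms by (auto simp: star_subalgebra_def)

lemma left_coidealD:
  assumes "left_coideal_star_subalgebra B"
  shows "star_subalgebra B" and "1 \<in> B"
    and "x \<in> B \<Longrightarrow> comult x \<in> complex_vector.span {a \<otimes> b | a b. b \<in> B}"
  using assms by (auto simp: left_coideal_star_subalgebra_def)

text \<open>The coideal property only places \<open>comult x\<close> in the span of the
  \<open>a \<otimes> b\<close> with \<open>b\<close> in \<open>B\<close>. By linearity this is
  enough to use facts about elements of \<open>B\<close> for the second leg under a Sweedler
  sum.\<close>

lemma tensor_lift_cong_span: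
  assumes t: "t \<in> complex_vector.span {a \<otimes> b | a b. b \<in> B}"
    and f: "cbilinear f" and g: "cbilinear g"
    and eq: "\<And>a b. b \<in> B \<Longrightarrow> f a b = g a b"
  shows "tensor_lift f t = tensor_lift g t"
  using t
proof (induction rule: complex_vector.span_induct_alt)
  case (step c z t)
  then obtain a b where z: "z = a \<otimes> b" "b \<in> B" by blast
  have "tensor_lift f (a \<otimes> b) = tensor_lift g (a \<otimes> b)"
    using eq[OF z(2)] by (simp add: tensor_lift_tensor f g cbilinear_balanced)
  then show ?case
    by (simp only: z tensor_lift_add step.IH f g clinear_tensor_lift[THEN clinear_scale])
qed simp

lemma tensor_lift_in_span:
  assumes t: "t \<in> complex_vector.span {a \<otimes> b | a b. b \<in> B}"
    and f: "cbilinear f" and Y: "complex_vector.subspace Y"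
    and mem: "\<And>a b. b \<in> B \<Longrightarrow> f a b \<in> Y"
  shows "tensor_lift f t \<in> Y"
  using t
proof (induction rule: complex_vector.span_induct_alt)
  case base
  then show ?case using Y by (simp add: complex_vector.subspace_0)
next
  case (step c z t)
  then obtain a b where z: "z = a \<otimes> b" "b \<in> B" by blast
  have "tensor_lift f (a \<otimes> b) \<in> Y"
    using mem[OF z(2)] by (simp add: tensor_lift_tensor f cbilinear_balanced)
  then show ?case
    using step.IH Y
    by (simp only: z tensor_lift_add f clinear_tensor_lift[THEN clinear_scale]
        complex_vector.subspace_add complex_vector.subspace_scale)
qed

lemma clinear_sum: "clinear f \<Longrightarrow> f (\<Sum>i\<in>A. g i) = (\<Sum>i\<in>A. f (g i))"
  by (induction A rule: infinite_finite_induct) (simp_all add: clinear_0 clinear_add)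

lemma clinear_onD:
  assumes "clinear_on Y F"
  shows "x \<in> Y \<Longrightarrow> y \<in> Y \<Longrightarrow> F (x + y) = F x + F y" and "x \<in> Y \<Longrightarrow> F (c *\<^sub>C x) = c *\<^sub>C F x"
    and "0 \<in> Y \<Longrightarrow> F 0 = 0"
proof -
  show "0 \<in> Y \<Longrightarrow> F 0 = 0"
    using assms unfolding clinear_on_def by (metis complex_vector.scale_zero_left)
qed (use assms in \<open>auto simp: clinear_on_def\<close>)

text \<open>A basis of \<open>S\<close> extends to a basis of the whole space. Cocycles and
  representations are constrained on a subspace only; passing to an extension makes the calculus of
  globally linear maps available for them.\<close>

lemma clinear_on_extend:
  fixes f :: "'a::complex_vector \<Rightarrow> 'b::complex_vector"
  assumes S: "complex_vector.subspace S" and f: "clinear_on S f"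
  obtains g where "clinear g" and "\<And>x. x \<in> S \<Longrightarrow> g x = f x"
proof -
  interpret vp: vector_space_pair "scaleC :: complex \<Rightarrow> 'a \<Rightarrow> 'a" "scaleC :: complex \<Rightarrow> 'b \<Rightarrow> 'b" ..
  obtain Bs where Bs: "Bs \<subseteq> S" "complex_vector.independent Bs" "S \<subseteq> complex_vector.span Bs"
    using complex_vector.maximal_independent_subset by blast
  obtain g where g: "clinear g" "\<forall>x\<in>Bs. g x = f x"
    using vp.linear_independent_extend[OF Bs(2)] by blast
  have "x \<in> S \<and> g x = f x" if "x \<in> complex_vector.span Bs" for x
    using that
  proof (induction rule: complex_vector.span_induct_alt)
    case base
    then show ?case
      using S f by (simp add: complex_vector.subspace_0 clinear_0[OF g(1)] clinear_onD)
  next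
    case (step c b y)
    then have "b \<in> S" "c *\<^sub>C b \<in> S" using Bs S by (auto simp: complex_vector.subspace_scale)
    then show ?case
      using step S f g by (simp add: complex_vector.subspace_add clinear_add clinear_scale clinear_onD)
  qed
  with Bs(3) g(1) that show thesis by blast
qed

text \<open>Pulling a map into a Sweedler sum calls for global linearity. When \<open>F\<close> is
  linear on \<open>Y\<close> only, a linear extension takes its place, which changes nothing since
  all terms lie in \<open>Y\<close>.\<close>

lemma tensor_lift_linear_on:
  assumes t: "t \<in> complex_vector.span {a \<otimes> b | a b. b \<in> B}"
    and f: "cbilinear f" and Y: "complex_vector.subspace Y" and mem: "\<And>a b. b \<in> B \<Longrightarrow> f a b \<in> Y"
    and F: "clinear_on Y F" and g: "cbilinear g"
    and eq: "\<And>a b. b \<in> B \<Longrightarrow> F (f a b) = g a b"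
  shows "F (tensor_lift f t) = tensor_lift g t"
proof -
  obtain F' where F': "clinear F'" "\<And>y. y \<in> Y \<Longrightarrow> F' y = F y"
    using clinear_on_extend[OF Y F] by blast
  have "F (tensor_lift f t) = F' (tensor_lift f t)"
    using tensor_lift_in_span[OF t f Y mem] F'(2) by simp
  also have "\<dots> = tensor_lift (\<lambda>a b. F' (f a b)) t"
    by (rule clinear_tensor_lift_pull[OF F'(1) f])
  also have "\<dots> = tensor_lift g t"
  proof (rule tensor_lift_cong_span[OF t _ g])
    show "cbilinear (\<lambda>a b. F' (f a b))"
      using f F'(1) by (simp add: cbilinear_def clinear_iff)
  qed (use mem F'(2) eq in auto)
  finally show ?thesis .
qed

text \<open>A nonzero difference is independent by itself, so some functional takes the value 1 on
  it. Identities in the algebra can thus be tested on functionals.\<close>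

lemma dual_separates:
  assumes "\<And>h. dual_apply h a = dual_apply h b"
  shows "a = b"
proof (rule ccontr)
  assume "a \<noteq> b"
  define d where "d = a - b"
  interpret vp: vector_space_pair "scaleC :: complex \<Rightarrow> 'a \<Rightarrow> 'a" "scaleC :: complex \<Rightarrow> complex \<Rightarrow> complex" ..
  have "d \<noteq> 0" using \<open>a \<noteq> b\<close> by (simp add: d_def)
  then have "complex_vector.independent {d}" by (simp add: complex_vector.dependent_single)
  then obtain g where g: "clinear g" "g d = (1::complex)"
    using vp.linear_independent_extend[of "{d}" "\<lambda>_. 1"] by auto
  have "g a = g b"
    using assms[of "Abs_dual g"] g(1) by (simp add: Abs_dual_inverse)
  moreover have "g a = g d + g b"
    using clinear_add[OF g(1), of d b] by (simp add: d_def)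
  ultimately show False using g(2) by simp
qed

section \<open>The inverse antipode, and the algebra structure of the stabilizer\<close>

lemma antipode_antipode_inv [simp]: "antipode (antipode_inv a) = a"
  and antipode_inv_antipode [simp]: "antipode_inv (antipode a) = a"
  by (simp_all add: bij_is_surj[OF bij_antipode] surj_f_inv_f bij_is_inj[OF bij_antipode])

lemma antipode_inv_mult: "antipode_inv (a * b) = antipode_inv b * antipode_inv a"
  for a b :: "'a::hopf_star_algebra"
  by (simp add: antipode_inv_eq star_mult antipode_mult)

lemma antipode_inv_1 [simp]: "antipode_inv 1 = (1 :: 'a::hopf_star_algebra)"
  by (simp add: antipode_inv_eq)

text \<open>This is the image of \<open>antipode_right\<close> under the inverse antipode, which
  reverses products.\<close>

lemma sw_antipode_inv: "sweedler a (\<lambda>x y. y * antipode_inv x) = counit a *\<^sub>C (1 :: 'a::hopf_star_algebra)"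
proof -
  have "counit a *\<^sub>C (1 :: 'a) = antipode_inv (sweedler a (\<lambda>x y. x * antipode y))"
    by (simp add: antipode_right clinear_scale[OF clinear_antipode_inv])
  also have "\<dots> = sweedler a (\<lambda>x y. antipode_inv (x * antipode y))"
    by (rule clinear_tensor_lift_pull[OF clinear_antipode_inv]) (intro dual_intros)
  finally show ?thesis by (simp add: antipode_inv_mult)
qed

context
  fixes B :: "'a::hopf_star_algebra set"
  assumes B: "left_coideal_star_subalgebra B"
begin

text \<open>Subtracting \<open>counit b *\<^sub>C 1\<close> moves \<open>b\<close> into the kernel
  of the counit without leaving \<open>B\<close>. Vanishing on the augmentation ideal therefore
  means that factors from \<open>B\<close> on the left are seen only through their counit, which is
  the form used from here on.\<close>

lemma stabilizer_iff:
  "\<omega> \<in> stabilizer B \<longleftrightarrow> (\<forall>b\<in>B. \<forall>a. dual_apply \<omega> (b * a) = counit b * dual_apply \<omega> a)"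
proof
  assume \<omega>: "\<omega> \<in> stabilizer B"
  show "\<forall>b\<in>B. \<forall>a. dual_apply \<omega> (b * a) = counit b * dual_apply \<omega> a"
  proof (intro ballI allI)
    fix b a assume b: "b \<in> B"
    have "b - counit b *\<^sub>C 1 \<in> B"
      using left_coidealD(2)[OF B] star_subalgebraD(1)[OF left_coidealD(1)[OF B]] b
      by (simp add: complex_vector.subspace_diff complex_vector.subspace_scale)
    moreover have "counit (b - counit b *\<^sub>C 1) = 0"
      using clinear_add[OF clinear_counit, of "b - counit b *\<^sub>C 1" "counit b *\<^sub>C 1"]
      by (simp add: clinear_scale[OF clinear_counit] counit_one)
    ultimately have "(b - counit b *\<^sub>C 1) * a \<in> augmentation_ideal B"
      unfolding augmentation_ideal_def by (blast intro: complex_vector.span_base)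
    then have "dual_apply \<omega> ((b - counit b *\<^sub>C 1) * a) = 0"
      using \<omega> by (simp add: stabilizer_def)
    moreover have "b * a = (b - counit b *\<^sub>C 1) * a + counit b *\<^sub>C a"
      by (simp add: left_diff_distrib mult_scaleC_left)
    ultimately show "dual_apply \<omega> (b * a) = counit b * dual_apply \<omega> a"
      by (simp add: clinear_add[OF clinear_dual_apply] clinear_scale[OF clinear_dual_apply])
  qed
next
  assume *: "\<forall>b\<in>B. \<forall>a. dual_apply \<omega> (b * a) = counit b * dual_apply \<omega> a"
  have "dual_apply \<omega> a = 0" if "a \<in> augmentation_ideal B" for a
    using that unfolding augmentation_ideal_def
    by (induction rule: complex_vector.span_induct_alt)
      (use * in \<open>auto simp: clinear_0[OF clinear_dual_apply] clinear_add[OF clinear_dual_apply]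
        clinear_scale[OF clinear_dual_apply]\<close>)
  then show "\<omega> \<in> stabilizer B" by (simp add: stabilizer_def)
qed

lemma stabilizerD: "\<omega> \<in> stabilizer B \<Longrightarrow> b \<in> B \<Longrightarrow> dual_apply \<omega> (b * a) = counit b * dual_apply \<omega> a"
  by (simp add: stabilizer_iff)

lemma stabilizer_one: "1 \<in> stabilizer B"
  by (simp add: stabilizer_iff one_dual.rep_eq counit_mult)

lemma subspace_stabilizer: "complex_vector.subspace (stabilizer B)"
  by (rule complex_vector.subspaceI)
    (simp_all add: stabilizer_iff zero_dual.rep_eq dual_apply_add dual_apply_scaleC algebra_simps)

lemma stabilizer_slice: "\<omega> \<in> stabilizer B \<Longrightarrow> dual_slice 1 \<omega> c \<in> stabilizer B"
  by (simp add: stabilizer_iff dual_slice.rep_eq mult.assoc)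

text \<open>In the coproduct of \<open>b * a\<close> the second leg of \<open>b\<close> lies in
  \<open>B\<close>, so \<open>k\<close> replaces it by its counit. This collapses the first leg to
  \<open>b\<close> itself, which \<open>h\<close> absorbs in turn.\<close>

lemma stabilizer_mult:
  assumes h: "h \<in> stabilizer B" and k: "k \<in> stabilizer B"
  shows "h * k \<in> stabilizer B"
  unfolding stabilizer_iff
proof (intro ballI allI)
  fix b a assume b: "b \<in> B"
  have "dual_apply (h * k) (b * a)
      = sweedler b (\<lambda>x y. sweedler a (\<lambda>z w. dual_apply h (x * z) * dual_apply k (y * w)))"
    unfolding times_dual.rep_eq by (rule sw_mult) (intro dual_intros)
  also have "\<dots> = sweedler b (\<lambda>x y. counit y *\<^sub>C sweedler a (\<lambda>z w. dual_apply h (x * z) * dual_apply k w))"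
  proof (rule tensor_lift_cong_span[OF left_coidealD(3)[OF B b]])
    fix x y assume y: "y \<in> B"
    have "sweedler a (\<lambda>z w. dual_apply h (x * z) * dual_apply k (y * w))
        = sweedler a (\<lambda>z w. counit y *\<^sub>C (dual_apply h (x * z) * dual_apply k w))"
      by (simp add: stabilizerD[OF k y] algebra_simps)
    also have "\<dots> = counit y *\<^sub>C sweedler a (\<lambda>z w. dual_apply h (x * z) * dual_apply k w)"
      by (rule clinear_tensor_lift_pull[OF clinear_scaleC, symmetric]) (intro dual_intros)
    finally show "sweedler a (\<lambda>z w. dual_apply h (x * z) * dual_apply k (y * w)) = \<dots>" .
  qed (intro dual_intros)+
  also have "\<dots> = sweedler a (\<lambda>z w. dual_apply h (b * z) * dual_apply k w)"
    by (rule sw_counit_right) (intro dual_intros)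
  also have "\<dots> = sweedler a (\<lambda>z w. counit b *\<^sub>C (dual_apply h z * dual_apply k w))"
    by (simp add: stabilizerD[OF h b] algebra_simps)
  also have "\<dots> = counit b * dual_apply (h * k) a"
    unfolding times_dual.rep_eq
    by (subst clinear_tensor_lift_pull[OF clinear_scaleC, symmetric]) (intro dual_intros, simp)
  finally show "dual_apply (h * k) (b * a) = counit b * dual_apply (h * k) a" .
qed

text \<open>With \<open>x\<close>, \<open>y\<close> the legs of \<open>b\<close>, a factor
  \<open>counit y\<close> may be inserted and, as \<open>y\<close> lies in \<open>B\<close>, turned
  into \<open>y\<close> on the left of \<open>antipode_inv x\<close>. The two then cancel by
  \<open>sw_antipode_inv\<close>.\<close>

lemma stabilizer_antipode_inv:
  assumes \<omega>: "\<omega> \<in> stabilizer B" and b: "b \<in> B"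
  shows "dual_apply \<omega> (antipode_inv b * a) = counit b * dual_apply \<omega> a"
proof -
  have "dual_apply \<omega> (antipode_inv b * a) = sweedler b (\<lambda>x y. counit y *\<^sub>C dual_apply \<omega> (antipode_inv x * a))"
    by (rule sw_counit_right[symmetric]) (intro dual_intros)
  also have "\<dots> = sweedler b (\<lambda>x y. dual_apply \<omega> ((y * antipode_inv x) * a))"
    by (rule tensor_lift_cong_span[OF left_coidealD(3)[OF B b]])
      (intro dual_intros | simp add: mult.assoc stabilizerD[OF \<omega>])+
  also have "\<dots> = dual_apply \<omega> (sweedler b (\<lambda>x y. y * antipode_inv x) * a)"
    by (rule clinear_tensor_lift_pull[symmetric]) (intro dual_intros)+
  finally show ?thesis
    by (simp add: sw_antipode_inv mult_scaleC_left clinear_scale[OF clinear_dual_apply])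
qed

text \<open>The involution of the dual evaluates at \<open>star (antipode (b * a))\<close>, which is
  \<open>antipode_inv (star b) * star (antipode a)\<close>; the previous lemma applies since
  \<open>star b\<close> is in \<open>B\<close>.\<close>

lemma stabilizer_star:
  assumes \<omega>: "\<omega> \<in> stabilizer B"
  shows "star \<omega> \<in> stabilizer B"
  unfolding stabilizer_iff
proof (intro ballI allI)
  fix b a assume b: "b \<in> B"
  then have "star b \<in> B" using left_coidealD(1)[OF B] star_subalgebraD(3) by blast
  then have "dual_apply \<omega> (antipode_inv (star b) * star (antipode a)) = counit (star b) * dual_apply \<omega> (star (antipode a))"
    by (rule stabilizer_antipode_inv[OF \<omega>])
  then show "dual_apply (star \<omega>) (b * a) = counit b * dual_apply (star \<omega>) a"
    by (simp add: star_dual.rep_eq antipode_mult star_mult antipode_inv_eq star_star counit_star)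
qed

end

text \<open>Left multiplication moves inside a slice, so slices of a finite-dimensional left ideal
  span finite-dimensional left ideals.\<close>

lemma mult_slice:
  fixes h \<omega> :: "'a::hopf_star_algebra dual"
  shows "h * dual_slice 1 \<omega> c = sweedler c (\<lambda>x y. dual_slice 1 (dual_slice 1 h (antipode_inv x) * \<omega>) y)"
proof (rule dual_eqI)
  fix a
  note I = dual_intros clinear_compose'[OF clinear_dual_eval] clinear_dual_mult
  have "dual_apply (sweedler c (\<lambda>x y. dual_slice 1 (dual_slice 1 h (antipode_inv x) * \<omega>) y)) a
      = sweedler c (\<lambda>x y. dual_apply (dual_slice 1 (dual_slice 1 h (antipode_inv x) * \<omega>) y) a)"
    by (rule clinear_tensor_lift_pull[OF clinear_dual_eval]) (intro I)
  also have "\<dots> = sweedler c (\<lambda>x y. sweedler (a * y) (\<lambda>u v. dual_apply h (u * antipode_inv x) * dual_apply \<omega> v))"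
    by (simp add: dual_slice.rep_eq times_dual.rep_eq)
  also have "\<dots> = sweedler c (\<lambda>x y. sweedler a (\<lambda>u v. sweedler y (\<lambda>y1 y2.
      dual_apply h (u * y1 * antipode_inv x) * dual_apply \<omega> (v * y2))))"
    by (subst sw_mult) (intro I refl)+
  also have "\<dots> = sweedler a (\<lambda>u v. sweedler c (\<lambda>x y. sweedler y (\<lambda>y1 y2.
      dual_apply h (u * y1 * antipode_inv x) * dual_apply \<omega> (v * y2))))"
    by (rule tensor_lift_swap) (intro I)+
  \<comment> \<open>Coassociativity regroups the three legs of \<open>c\<close> so that the first
    two, which are about to cancel, come from the same coproduct.\<close>
  also have "\<dots> = sweedler a (\<lambda>u v. sweedler c (\<lambda>x y. sweedler x (\<lambda>x1 x2.
      dual_apply h (u * x2 * antipode_inv x1) * dual_apply \<omega> (v * y))))"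
    by (subst sw_coassoc) (intro I refl)+
  also have "\<dots> = sweedler a (\<lambda>u v. sweedler c (\<lambda>x y.
      dual_apply h (u * sweedler x (\<lambda>x1 x2. x2 * antipode_inv x1)) * dual_apply \<omega> (v * y)))"
    by (subst clinear_tensor_lift_pull[where g = "\<lambda>s. dual_apply h (u * s) * dual_apply \<omega> (v * y)" for u v y])
      (intro I, intro I, simp add: mult.assoc)
  also have "\<dots> = sweedler a (\<lambda>u v. sweedler c (\<lambda>x y. counit x *\<^sub>C (dual_apply h u * dual_apply \<omega> (v * y))))"
    by (simp add: sw_antipode_inv mult_scaleC_right clinear_scale[OF clinear_dual_apply] mult.assoc)
  also have "\<dots> = sweedler a (\<lambda>u v. dual_apply h u * dual_apply \<omega> (v * c))"
    by (subst sw_counit_left) (intro I refl)+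
  finally show "dual_apply (h * dual_slice 1 \<omega> c) a = dual_apply (sweedler c (\<lambda>x y. dual_slice 1 (dual_slice 1 h (antipode_inv x) * \<omega>) y)) a"
    by (simp add: dual_slice.rep_eq times_dual.rep_eq)
qed

section \<open>Orthonormal bases\<close>

lemma scaleC_fun_apply [simp]: "(c *\<^sub>C f) i = c *\<^sub>C f i"
  by (simp add: scaleC_fun_def)

lemma sum_fun_apply [simp]: "(\<Sum>k\<in>A. f k) i = (\<Sum>k\<in>A. f k i)"
  for f :: "'k \<Rightarrow> 'i \<Rightarrow> 'b::comm_monoid_add"
  by (induction A rule: infinite_finite_induct) simp_all

text \<open>The standard inner product of \<open>\<complex>^n\<close>, conjugate-linear on the left.
  Vectors are functions on all natural numbers here, so definiteness holds only for those vanishing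
  from \<open>n\<close> on.\<close>

definition ip :: "nat \<Rightarrow> (nat \<Rightarrow> complex) \<Rightarrow> (nat \<Rightarrow> complex) \<Rightarrow> complex" where
  "ip n v w = (\<Sum>i<n. cnj (v i) * w i)"

lemma clinear_ip: "clinear (ip n v)"
  by (simp add: clinear_iff ip_def algebra_simps sum.distrib sum_distrib_left)

lemmas ip_add = clinear_add[OF clinear_ip] and ip_scale = clinear_scale[OF clinear_ip]
  and ip_0 = clinear_0[OF clinear_ip] and ip_sum = clinear_sum[OF clinear_ip]

lemma ip_commute: "ip n w v = cnj (ip n v w)"
  by (simp add: ip_def mult.commute)

lemma ip_self: "ip n v v = of_real (\<Sum>i<n. (cmod (v i))\<^sup>2)"
  by (simp add: ip_def complex_norm_square mult.commute del: of_real_power)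

lemma ip_self_eq_0:
  assumes "ip n v v = 0" and "\<And>i. i \<ge> n \<Longrightarrow> v i = 0"
  shows "v = 0"
proof
  fix i
  have "(\<Sum>i<n. (cmod (v i))\<^sup>2) = 0" using assms(1) unfolding ip_self of_real_eq_0_iff .
  then have "\<forall>i\<in>{..<n}. (cmod (v i))\<^sup>2 = 0" by (subst (asm) sum_nonneg_eq_0_iff) auto
  then show "v i = 0 i" using assms(2)[of i] by (cases "i < n") auto
qed

text \<open>Functions supported in \<open>Z\<close> are combinations of the unit vectors at points
  of \<open>Z\<close>. The index type is left general because the lemma serves coordinates of
  vectors as well as values of functionals on a finite set.\<close>

lemma finite_independent_supported:
  assumes X: "complex_vector.independent X" and s: "\<And>f z. f \<in> X \<Longrightarrow> z \<notin> Z \<Longrightarrow> f z = 0"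
    and Z: "finite Z"
  shows "finite (X :: ('z \<Rightarrow> complex) set) \<and> card X \<le> card Z"
proof -
  define u :: "'z \<Rightarrow> 'z \<Rightarrow> complex" where "u z = (\<lambda>y. if y = z then 1 else 0)" for z
  have "f \<in> complex_vector.span (u ` Z)" if "f \<in> X" for f
  proof -
    have "f = (\<Sum>z\<in>Z. f z *\<^sub>C u z)"
    proof
      fix y
      show "f y = (\<Sum>z\<in>Z. f z *\<^sub>C u z) y"
        using s[OF that, of y] Z by (simp add: u_def if_distrib[of "(*) _"] sum.delta' cong: if_cong)
    qed
    moreover have "(\<Sum>z\<in>Z. f z *\<^sub>C u z) \<in> complex_vector.span (u ` Z)"
      by (intro complex_vector.span_sum complex_vector.span_scale complex_vector.span_base) auto
    ultimately show ?thesis by simp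
  qed
  then have "finite X \<and> card X \<le> card (u ` Z)"
    using Z X by (intro complex_vector.independent_span_bound) auto
  then show ?thesis using card_image_le[OF Z, of u] by linarith
qed

text \<open>The common support bound makes bases finite, so a vector of \<open>W\<close> outside
  \<open>W'\<close> enlarges a basis of \<open>W'\<close> to a bigger independent set in
  \<open>W\<close>. The strict drop of \<open>dim\<close> drives the inductions below.\<close>

lemma dim_psubset_supported:
  fixes W W' :: "(nat \<Rightarrow> complex) set"
  assumes W: "complex_vector.subspace W" and W': "complex_vector.subspace W'" and sub: "W' \<subset> W"
    and s: "\<And>v i. v \<in> W \<Longrightarrow> i \<ge> n \<Longrightarrow> v i = 0"
  shows "complex_vector.dim W' < complex_vector.dim W"
proof -
  obtain X where X: "X \<subseteq> W" "complex_vector.independent X" "W \<subseteq> complex_vector.span X" "card X = complex_vector.dim W"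
    using complex_vector.basis_exists by blast
  obtain X' where X': "X' \<subseteq> W'" "complex_vector.independent X'" "W' \<subseteq> complex_vector.span X'" "card X' = complex_vector.dim W'"
    using complex_vector.basis_exists by blast
  obtain v where v: "v \<in> W" "v \<notin> W'" using sub by blast
  have "complex_vector.span X' \<subseteq> W'" using X'(1) W' by (rule complex_vector.span_minimal)
  then have v': "v \<notin> complex_vector.span X'" using v by blast
  have fin: "finite X" "finite X'"
    using finite_independent_supported[of _ "{..<n}"] X(1,2) X'(1,2) sub s
    by (meson finite_lessThan lessThan_iff not_le psubsetD subset_eq)+
  have "complex_vector.independent (insert v X')"
    using X'(2) v' by (simp add: complex_vector.independent_insert)
  moreover have "insert v X' \<subseteq> complex_vector.span X"
    using v(1) X(3) X'(1) sub by blast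
  ultimately have "card (insert v X') \<le> card X"
    using complex_vector.independent_span_bound[OF fin(1)] by blast
  moreover have "v \<notin> X'" using v' complex_vector.span_base by blast
  ultimately show ?thesis using fin X(4) X'(4) by simp
qed

text \<open>Gram-Schmidt as an induction on \<open>dim W\<close>: a unit vector \<open>u\<close> is
  split off, and the induction hypothesis applies to its orthogonal complement in
  \<open>W\<close>.\<close>

lemma orthonormal_basis:
  assumes "complex_vector.subspace W" and "\<And>v i. v \<in> W \<Longrightarrow> i \<ge> n \<Longrightarrow> v i = 0"
  obtains m and e :: "nat \<Rightarrow> nat \<Rightarrow> complex"
  where "\<And>k. k < m \<Longrightarrow> e k \<in> W" and "\<And>k l. k < m \<Longrightarrow> l < m \<Longrightarrow> ip n (e k) (e l) = (if k = l then 1 else 0)"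
    and "\<And>v. v \<in> W \<Longrightarrow> v = (\<Sum>k<m. ip n (e k) v *\<^sub>C e k)"
proof -
  have "\<exists>m (e :: nat \<Rightarrow> nat \<Rightarrow> complex). (\<forall>k<m. e k \<in> W) \<and> (\<forall>k<m. \<forall>l<m. ip n (e k) (e l) = (if k = l then 1 else 0)) \<and>
      (\<forall>v\<in>W. v = (\<Sum>k<m. ip n (e k) v *\<^sub>C e k))"
    using assms
  proof (induction "complex_vector.dim W" arbitrary: W rule: less_induct)
    case less
    note W = less.prems(1) and s = less.prems(2)
    show ?case
    proof (cases "W \<subseteq> {0}")
      case True
      then show ?thesis by (intro exI[of _ "0::nat"] exI[of _ "\<lambda>_. 0"]) auto
    next
      case False
      then obtain w where w: "w \<in> W" "w \<noteq> 0" by blast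
      define r where "r = (\<Sum>i<n. (cmod (w i))\<^sup>2)"
      have ww: "ip n w w = of_real r" by (simp only: ip_self r_def)
      then have "r \<noteq> 0" using ip_self_eq_0[of n w] w s by auto
      then have "r > 0" unfolding r_def by (smt (verit) sum_nonneg zero_le_power2)
      define u where "u = complex_of_real (1 / sqrt r) *\<^sub>C w"
      have u: "u \<in> W" using w W by (simp add: u_def complex_vector.subspace_scale)
      have "ip n u u = cnj (complex_of_real (1 / sqrt r)) * (complex_of_real (1 / sqrt r) * complex_of_real r)"
        unfolding u_def ip_scale
        by (subst ip_commute, simp only: ip_scale) (simp add: ww)
      also have "\<dots> = complex_of_real (1 / sqrt r * (1 / sqrt r * r))"
        by (simp only: of_real_mult complex_cnj_complex_of_real)
      also have "1 / sqrt r * (1 / sqrt r * r) = 1"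
        using \<open>r > 0\<close> by (simp add: field_simps)
      finally have uu: "ip n u u = 1" by simp
      define W' where "W' = {v \<in> W. ip n u v = 0}"
      have W': "complex_vector.subspace W'"
        using W unfolding W'_def by (auto simp: complex_vector.subspace_def ip_0 ip_add ip_scale)
      have "u \<notin> W'" "W' \<subseteq> W" using uu by (auto simp: W'_def)
      then have "W' \<subset> W" using u by blast
      then have "complex_vector.dim W' < complex_vector.dim W"
        by (rule dim_psubset_supported[where n = n, OF W W']) (rule s)
      then obtain m and e :: "nat \<Rightarrow> nat \<Rightarrow> complex" where e: "\<forall>k<m. e k \<in> W'"
        "\<forall>k<m. \<forall>l<m. ip n (e k) (e l) = (if k = l then 1 else 0)"
        "\<forall>v\<in>W'. v = (\<Sum>k<m. ip n (e k) v *\<^sub>C e k)"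
        using less.hyps[OF _ W'] s \<open>W' \<subseteq> W\<close> by blast
      \<comment> \<open>The basis of the complement occupies the indices below \<open>m\<close>, and
        \<open>u\<close> is appended at index \<open>m\<close>.\<close>
      define e' where "e' k = (if k < m then e k else u)" for k
      have ue: "ip n u (e k) = 0" "ip n (e k) u = 0" if "k < m" for k
        using e(1) that by (auto simp: W'_def ip_commute[of n "e k" u])
      have "v = (\<Sum>k<Suc m. ip n (e' k) v *\<^sub>C e' k)" if v: "v \<in> W" for v
      proof -
        define v' where "v' = v - ip n u v *\<^sub>C u"
        have v'v: "v = v' + ip n u v *\<^sub>C u" by (simp add: v'_def)
        have "ip n u v = ip n u v' + ip n u v * ip n u u"
          using ip_add[of n u v' "ip n u v *\<^sub>C u"] by (simp add: v'v[symmetric] ip_scale)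
        then have "v' \<in> W'"
          using v u W uu by (simp add: W'_def v'_def complex_vector.subspace_diff complex_vector.subspace_scale)
        then have "v' = (\<Sum>k<m. ip n (e k) v' *\<^sub>C e k)" using e(3) by blast
        also have "\<dots> = (\<Sum>k<m. ip n (e k) v *\<^sub>C e k)"
        proof (rule sum.cong[OF refl])
          fix k assume "k \<in> {..<m}"
          then have "ip n (e k) v = ip n (e k) v'"
            using ip_add[of n "e k" v' "ip n u v *\<^sub>C u"] ue by (simp add: v'v[symmetric] ip_scale)
          then show "ip n (e k) v' *\<^sub>C e k = ip n (e k) v *\<^sub>C e k" by simp
        qed
        finally show ?thesis using v'v by (simp add: e'_def)
      qed
      moreover have "e' k \<in> W" if "k < Suc m" for k
        using e(1) u that \<open>W' \<subseteq> W\<close> by (auto simp: e'_def)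
      moreover have "ip n (e' k) (e' l) = (if k = l then 1 else 0)" if "k < Suc m" "l < Suc m" for k l
        using e(2) ue uu that by (auto simp: e'_def less_Suc_eq)
      ultimately show ?thesis by blast
    qed
  qed
  then show thesis using that by blast
qed

section \<open>Corepresentations\<close>

lemma dual_act_apply: "dual_act U h v i = (if i < cdim U then \<Sum>j<cdim U. dual_apply h (coef U i j) * v j else 0)"
  by (simp add: dual_act_def)

lemma clinear_dual_act: "clinear (dual_act U h)"
  unfolding clinear_iff
  by (auto simp: fun_eq_iff dual_act_apply algebra_simps sum.distrib sum_distrib_left)

lemma clinear_dual_act_left: "clinear (\<lambda>h. dual_act U h v)"
  unfolding clinear_iff
  by (auto simp: fun_eq_iff dual_act_apply dual_apply_add dual_apply_scaleC algebra_simps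
      sum.distrib sum_distrib_left)

lemma corep_spaceD: "v \<in> corep_space U \<Longrightarrow> i \<ge> cdim U \<Longrightarrow> v i = 0"
  by (simp add: corep_space_def)

lemma subspace_corep_space: "complex_vector.subspace (corep_space U)"
  by (simp add: complex_vector.subspace_def corep_space_def)

lemma dual_act_in_corep_space: "dual_act U h v \<in> corep_space U"
  by (simp add: corep_space_def dual_act_apply)

lemma unitary_corepD:
  assumes "unitary_corep U" "i < cdim U" "j < cdim U"
  shows "comult (coef U i j) = (\<Sum>k<cdim U. coef U i k \<otimes> coef U k j)"
    and "counit (coef U i j) = (if i = j then 1 else 0)"
    and "(\<Sum>k<cdim U. star (coef U k i) * coef U k j) = (if i = j then 1 else 0)"
    and "(\<Sum>k<cdim U. coef U i k * star (coef U j k)) = (if i = j then 1 else 0)"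
  using assms by (auto simp: unitary_corep_def)

lemma sweedler_coef:
  assumes "comult a = (\<Sum>k<m. x k \<otimes> y k)" and "cbilinear f"
  shows "sweedler a f = (\<Sum>k<m. f (x k) (y k))"
  by (simp add: assms clinear_sum[OF clinear_tensor_lift] tensor_lift_tensor cbilinear_balanced)

text \<open>Both matrices are inverse to \<open>V\<close>, the antipode always being a right inverse.\<close>

lemma star_coef_eq_antipode:
  fixes V :: "nat \<Rightarrow> nat \<Rightarrow> 'a::hopf_star_algebra"
  assumes comult: "\<And>i j. i < m \<Longrightarrow> j < m \<Longrightarrow> comult (V i j) = (\<Sum>k<m. V i k \<otimes> V k j)"
    and counit: "\<And>i j. i < m \<Longrightarrow> j < m \<Longrightarrow> counit (V i j) = (if i = j then 1 else 0)"
    and left: "\<And>i j. i < m \<Longrightarrow> j < m \<Longrightarrow> (\<Sum>k<m. star (V k i) * V k j) = (if i = j then 1 else 0)"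
    and ij: "i < m" "j < m"
  shows "star (V j i) = antipode (V i j)"
proof -
  have S: "(\<Sum>l<m. V k l * antipode (V l j)) = (if k = j then 1 else 0)" if "k < m" for k
  proof -
    have "(\<Sum>l<m. V k l * antipode (V l j)) = sweedler (V k j) (\<lambda>x y. x * antipode y)"
      by (rule sweedler_coef[symmetric]) (use comult that ij in simp, intro clinear_intros)
    then show ?thesis using counit that ij by (simp add: antipode_right)
  qed
  have "antipode (V i j) = (\<Sum>l<m. (\<Sum>k<m. star (V k i) * V k l) * antipode (V l j))"
    using left ij by (simp add: if_distrib[of "\<lambda>x. x * _"] cong: if_cong)
  also have "\<dots> = (\<Sum>k<m. star (V k i) * (\<Sum>l<m. V k l * antipode (V l j)))"
    unfolding sum_distrib_left sum_distrib_right mult.assoc by (rule sum.swap)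
  also have "\<dots> = star (V j i)"
    using S ij by (simp add: if_distrib[of "(*) _"] cong: if_cong)
  finally show ?thesis by simp
qed

lemma antipode_coef:
  assumes "unitary_corep U" "i < cdim U" "j < cdim U"
  shows "antipode (coef U i j) = star (coef U j i)"
  by (rule star_coef_eq_antipode[where V = "coef U" and m = "cdim U", symmetric])
    (simp_all add: unitary_corepD assms)

lemma dual_act_mult:
  assumes "unitary_corep U"
  shows "dual_act U (h * k) v = dual_act U h (dual_act U k v)"
proof
  fix i
  have "dual_apply (h * k) (coef U i j) = (\<Sum>l<cdim U. dual_apply h (coef U i l) * dual_apply k (coef U l j))"
    if "i < cdim U" "j < cdim U" for j
    unfolding times_dual.rep_eq
    by (rule sweedler_coef) (rule unitary_corepD(1)[OF assms that], intro dual_intros)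
  then show "dual_act U (h * k) v i = dual_act U h (dual_act U k v) i"
    by (simp add: dual_act_apply sum_distrib_left sum_distrib_right mult.assoc)
      (auto intro: sum.swap)
qed

lemma dual_act_one:
  assumes "unitary_corep U" "v \<in> corep_space U"
  shows "dual_act U 1 v = v"
proof
  fix i
  show "dual_act U 1 v i = v i"
    using corep_spaceD[OF assms(2), of i]
    by (simp add: dual_act_apply one_dual.rep_eq unitary_corepD(2)[OF assms(1)]
        if_distrib[of "\<lambda>x. x * _"] cong: if_cong)
qed

text \<open>On the coefficients of a unitary corepresentation the antipode is the conjugate
  transpose, so \<open>star h\<close> acts by the adjoint matrix of \<open>h\<close>. Orthogonal
  complements of invariant subspaces are thus invariant under sets closed under
  \<open>star\<close>.\<close>

lemma ip_dual_act:
  assumes "unitary_corep U"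
  shows "ip (cdim U) (dual_act U h v) w = ip (cdim U) v (dual_act U (star h) w)"
proof -
  have "dual_apply (star h) (coef U i j) = cnj (dual_apply h (coef U j i))"
    if "i < cdim U" "j < cdim U" for i j
    using that by (simp add: star_dual.rep_eq antipode_coef[OF assms] star_star)
  then have "ip (cdim U) v (dual_act U (star h) w)
      = (\<Sum>i<cdim U. \<Sum>j<cdim U. cnj (v i) * cnj (dual_apply h (coef U j i)) * w j)"
    by (simp add: ip_def dual_act_apply sum_distrib_left mult.assoc)
  also have "\<dots> = (\<Sum>j<cdim U. \<Sum>i<cdim U. cnj (v i) * cnj (dual_apply h (coef U j i)) * w j)"
    by (rule sum.swap)
  finally show ?thesis
    by (simp add: ip_def dual_act_apply sum_distrib_right sum_distrib_left mult.commute)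
qed

section \<open>Complete reducibility\<close>

lemma subrepD:
  assumes "subrep X U W"
  shows "complex_vector.subspace W" and "W \<subseteq> corep_space U"
    and "h \<in> X \<Longrightarrow> v \<in> W \<Longrightarrow> dual_act U h v \<in> W"
  using assms by (auto simp: subrep_def)

lemma irreducible_subrepD:
  assumes "irreducible_subrep X U W"
  shows "subrep X U W" and "subrep X U W' \<Longrightarrow> W' \<subseteq> W \<Longrightarrow> v \<in> W' \<Longrightarrow> v \<noteq> 0 \<Longrightarrow> W' = W"
    and "W \<noteq> {0}"
  using assms unfolding irreducible_subrep_def by blast+

text \<open>A reducible \<open>W\<close> is the sum of a proper invariant subspace and its
  orthogonal complement, both of smaller dimension, so vanishing propagates by induction. Stated for
  vanishing, complete reducibility needs no explicit decomposition into irreducible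
  summands.\<close>

lemma dual_act_zero_if_zero_on_irreducibles:
  assumes U: "unitary_corep U" and X: "\<And>h. h \<in> X \<Longrightarrow> star h \<in> X"
    and irr: "\<And>W v. irreducible_subrep X U W \<Longrightarrow> v \<in> W \<Longrightarrow> dual_act U h v = 0"
    and W: "subrep X U W" and v: "v \<in> W"
  shows "dual_act U h v = 0"
  using W v
proof (induction "complex_vector.dim W" arbitrary: W v rule: less_induct)
  case less
  let ?n = "cdim U"
  note W = subrepD[OF less.prems(1)]
  have s: "\<And>v i. v \<in> W \<Longrightarrow> i \<ge> ?n \<Longrightarrow> v i = 0" using W(2) corep_spaceD by blast
  show ?case
  proof (cases "irreducible_subrep X U W \<or> W = {0}")
    case True
    then show ?thesis using irr less.prems(2) by (auto simp: clinear_0[OF clinear_dual_act])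
  next
    case False
    then obtain W' where W': "subrep X U W'" "W' \<subseteq> W" "W' \<noteq> {0}" "W' \<noteq> W"
      using less.prems(1) by (auto simp: irreducible_subrep_def)
    note W'' = subrepD[OF W'(1)]
    \<comment> \<open>The orthogonal complement of \<open>W'\<close> inside
      \<open>W\<close>.\<close>
    define P where "P = {v \<in> W. \<forall>w\<in>W'. ip ?n w v = 0}"
    have "complex_vector.subspace P"
      using W(1) unfolding P_def by (auto simp: complex_vector.subspace_def ip_0 ip_add ip_scale)
    moreover have "dual_act U k v \<in> P" if "k \<in> X" "v \<in> P" for k v
    proof -
      have "ip ?n w (dual_act U k v) = 0" if w: "w \<in> W'" for w
      proof -
        have "ip ?n (dual_act U k v) w = ip ?n v (dual_act U (star k) w)"
          by (rule ip_dual_act[OF U])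
        also have "\<dots> = 0"
          using W''(3)[OF X[OF \<open>k \<in> X\<close>] w] \<open>v \<in> P\<close> by (subst ip_commute) (simp add: P_def)
        finally show ?thesis by (subst ip_commute) simp
      qed
      then show ?thesis using that W(3) by (simp add: P_def)
    qed
    ultimately have P: "subrep X U P" using W(2) by (auto simp: subrep_def P_def)
    obtain w where w: "w \<in> W'" "w \<noteq> 0" using W'(3) W''(1) complex_vector.subspace_0 by fastforce
    then have "w \<notin> P" using ip_self_eq_0[of ?n w] s W'(2) by (auto simp: P_def)
    then have "P \<subset> W" using w W'(2) by (auto simp: P_def)
    then have dP: "complex_vector.dim P < complex_vector.dim W"
      by (rule dim_psubset_supported[where n = ?n, OF W(1) subrepD(1)[OF P]]) (rule s)
    have dW': "complex_vector.dim W' < complex_vector.dim W"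
      using W'(2,4) by (intro dim_psubset_supported[where n = ?n, OF W(1) W''(1)] s) auto
    obtain m and e :: "nat \<Rightarrow> nat \<Rightarrow> complex" where e: "\<And>k. k < m \<Longrightarrow> e k \<in> W'"
      "\<And>k l. k < m \<Longrightarrow> l < m \<Longrightarrow> ip ?n (e k) (e l) = (if k = l then 1 else 0)"
      "\<And>v. v \<in> W' \<Longrightarrow> v = (\<Sum>k<m. ip ?n (e k) v *\<^sub>C e k)"
      using orthonormal_basis[OF W''(1), of ?n] s W'(2) by blast
    \<comment> \<open>The orthogonal projection of \<open>v\<close> onto \<open>W'\<close>; the
      remainder \<open>v - v'\<close> will lie in \<open>P\<close>.\<close>
    define v' where "v' = (\<Sum>k<m. ip ?n (e k) v *\<^sub>C e k)"
    have v': "v' \<in> W'"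
      unfolding v'_def by (intro complex_vector.subspace_sum complex_vector.subspace_scale W''(1) e) auto
    have eq: "ip ?n (e k) (v - v') = 0" if "k < m" for k
    proof -
      have "ip ?n (e k) v' = ip ?n (e k) v"
        using that e(2) by (simp add: v'_def ip_sum ip_scale if_distrib[of "(*) _"] cong: if_cong)
      moreover have "ip ?n (e k) v = ip ?n (e k) (v - v') + ip ?n (e k) v'"
        using ip_add[of ?n "e k" "v - v'" v'] by simp
      ultimately show ?thesis by simp
    qed
    have "ip ?n w (v - v') = 0" if w: "w \<in> W'" for w
    proof -
      have "ip ?n (v - v') w = (\<Sum>k<m. ip ?n (e k) w *\<^sub>C ip ?n (v - v') (e k))"
        by (subst e(3)[OF w]) (simp add: ip_sum ip_scale)
      also have "\<dots> = 0" using eq by (intro sum.neutral) (auto simp: ip_commute[of _ "v - v'" "e _"])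
      finally show ?thesis by (subst ip_commute) simp
    qed
    then have "v - v' \<in> P"
      using less.prems(2) v' W'(2) W(1) by (auto simp: P_def complex_vector.subspace_diff)
    then have "dual_act U h (v - v') = 0" by (rule less.hyps[OF dP P])
    moreover have "dual_act U h v' = 0" by (rule less.hyps[OF dW' W'(1) v'])
    moreover have "dual_act U h v = dual_act U h (v - v') + dual_act U h v'"
      using clinear_add[OF clinear_dual_act, of U h "v - v'" v'] by simp
    ultimately show ?thesis by simp
  qed
qed

section \<open>Irreducible subrepresentations as irreducible unitary corepresentations\<close>

lemma unitary_corepI:
  fixes V :: "nat \<Rightarrow> nat \<Rightarrow> 'a::hopf_star_algebra"
  assumes comult: "\<And>i j. i < m \<Longrightarrow> j < m \<Longrightarrow> comult (V i j) = (\<Sum>k<m. V i k \<otimes> V k j)"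
    and counit: "\<And>i j. i < m \<Longrightarrow> j < m \<Longrightarrow> counit (V i j) = (if i = j then 1 else 0)"
    and left: "\<And>i j. i < m \<Longrightarrow> j < m \<Longrightarrow> (\<Sum>k<m. star (V k i) * V k j) = (if i = j then 1 else 0)"
  shows "unitary_corep (Corep m V)"
proof -
  have "(\<Sum>k<m. V i k * star (V j k)) = (if i = j then 1 else 0)" if "i < m" "j < m" for i j
  proof -
    \<comment> \<open>One unitarity relation identifies the adjoint entries with antipodes, and the
      antipode matrix is always a right inverse; this yields the other relation.\<close>
    have "(\<Sum>k<m. V i k * star (V j k)) = (\<Sum>k<m. V i k * antipode (V k j))"
      using star_coef_eq_antipode[of m V, OF comult counit left] that by simp
    also have "\<dots> = sweedler (V i j) (\<lambda>x y. x * antipode y)"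
      by (rule sweedler_coef[symmetric]) (use comult that in simp, intro clinear_intros)
    finally show ?thesis using counit that by (simp add: antipode_right)
  qed
  then show ?thesis using assms by (simp add: unitary_corep_def)
qed

text \<open>The intertwiner \<open>T\<close> maps invariant subspaces to invariant subspaces of
  \<open>W\<close>, and by injectivity a subspace is recovered from its image.\<close>

lemma irreducible_subrep_bij:
  assumes T: "clinear T" "bij_betw T (corep_space V) W"
    and act: "\<And>h v. v \<in> corep_space V \<Longrightarrow> T (dual_act V h v) = dual_act U h (T v)"
    and W: "irreducible_subrep X U W"
  shows "irreducible_subrep X V (corep_space V)"
  unfolding irreducible_subrep_def
proof (intro conjI allI impI)
  show "subrep X V (corep_space V)"
    by (simp add: subrep_def subspace_corep_space dual_act_in_corep_space)
  show "corep_space V \<noteq> {0}"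
  proof
    assume "corep_space V = {0}"
    then have "W = {T 0}" using T(2) by (simp add: bij_betw_def)
    then show False using irreducible_subrepD(3)[OF W] clinear_0[OF T(1)] by simp
  qed
  fix Y assume Y: "subrep X V Y \<and> Y \<subseteq> corep_space V"
  have Y0: "0 \<in> Y" using Y by (simp add: subrep_def complex_vector.subspace_0)
  have inj: "inj_on T (corep_space V)" using T(2) by (simp add: bij_betw_def)
  have "complex_vector.subspace (T ` Y)"
    using Y subrepD(1) module_hom.subspace_image[OF T(1)[unfolded module_hom_iff_linear[symmetric]]]
    by blast
  moreover have "T ` Y \<subseteq> W" using Y T(2) by (auto simp: bij_betw_def)
  moreover have "dual_act U h w \<in> T ` Y" if h: "h \<in> X" and w: "w \<in> T ` Y" for h w
  proof -
    obtain v where v: "v \<in> Y" "w = T v" using w by blast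
    then have "dual_act U h w = T (dual_act V h v)" using Y act by auto
    then show ?thesis using Y h v(1) subrepD(3) by blast
  qed
  ultimately have "subrep X U (T ` Y)" "T ` Y \<subseteq> W"
    using subrepD(2)[OF irreducible_subrepD(1)[OF W]] unfolding subrep_def by blast+
  then have "T ` Y = {0} \<or> T ` Y = W" using W unfolding irreducible_subrep_def by blast
  then show "Y = {0} \<or> Y = corep_space V"
  proof
    assume "T ` Y = {0}"
    then have "T ` Y = T ` {0}" using clinear_0[OF T(1)] by simp
    then show ?thesis using inj_on_image_eq_iff[OF inj, of Y "{0}"] Y Y0 by auto
  next
    assume "T ` Y = W"
    then have "T ` Y = T ` corep_space V" using T(2) by (simp add: bij_betw_def)
    then show ?thesis using inj_on_image_eq_iff[OF inj, of Y "corep_space V"] Y by auto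
  qed
qed

text \<open>\<open>V\<close> is the matrix of coefficients of \<open>W\<close> in an orthonormal basis.\<close>

lemma irreducible_subrep_corep:
  fixes U :: "'a::hopf_star_algebra corep"
  assumes U: "unitary_corep U" and W: "irreducible_subrep UNIV U W"
  obtains V and T :: "(nat \<Rightarrow> complex) \<Rightarrow> nat \<Rightarrow> complex"
  where "irreducible_unitary_corep V" and "clinear T" and "bij_betw T (corep_space V) W"
    and "\<And>h v. v \<in> corep_space V \<Longrightarrow> T (dual_act V h v) = dual_act U h (T v)"
proof -
  define n where "n = cdim U"
  note sub = subrepD[OF irreducible_subrepD(1)[OF W]]
  obtain m and e :: "nat \<Rightarrow> nat \<Rightarrow> complex" where e: "\<And>k. k < m \<Longrightarrow> e k \<in> W"
    "\<And>k l. k < m \<Longrightarrow> l < m \<Longrightarrow> ip n (e k) (e l) = (if k = l then 1 else 0)"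
    "\<And>v. v \<in> W \<Longrightarrow> v = (\<Sum>k<m. ip n (e k) v *\<^sub>C e k)"
    using orthonormal_basis[OF sub(1), of n] sub(2) corep_spaceD unfolding n_def by blast
  \<comment> \<open>\<open>Y l i\<close> is the \<open>i\<close>-th coordinate of the matrix
    \<open>U\<close> applied to \<open>e l\<close>, an element of the algebra; \<open>X k l\<close>
    is the coefficient of \<open>U\<close> between \<open>e k\<close> and
    \<open>e l\<close>.\<close>
  define Y where "Y l i = (\<Sum>j<n. e l j *\<^sub>C coef U i j)" for l i
  define X where "X k l = (\<Sum>i<n. cnj (e k i) *\<^sub>C Y l i)" for k l
  have hY: "dual_apply h (Y l i) = dual_act U h (e l) i" if "i < n" for h l i
    using that by (simp add: Y_def dual_act_apply n_def clinear_sum[OF clinear_dual_apply]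
        clinear_scale[OF clinear_dual_apply] mult.commute)
  have hX: "dual_apply h (X k l) = ip n (e k) (dual_act U h (e l))" for h k l
    by (simp add: X_def ip_def clinear_sum[OF clinear_dual_apply] clinear_scale[OF clinear_dual_apply] hY)
  have act_e: "dual_act U h (e l) = (\<Sum>k<m. dual_apply h (X k l) *\<^sub>C e k)" if "l < m" for h l
    using e(3)[of "dual_act U h (e l)"] sub(3)[OF UNIV_I e(1)[OF that], of h] by (simp add: hX)
  \<comment> \<open>Invariance of \<open>W\<close> under every functional gives this expansion after
    applying any \<open>h\<close>; since functionals separate points, it holds in the
    algebra.\<close>
  have YX: "Y l i = (\<Sum>k<m. e k i *\<^sub>C X k l)" if "l < m" "i < n" for l i
  proof (rule dual_separates)
    fix h
    have "dual_apply h (Y l i) = (\<Sum>k<m. dual_apply h (X k l) *\<^sub>C e k) i"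
      using that by (simp only: hY act_e)
    then show "dual_apply h (Y l i) = dual_apply h (\<Sum>k<m. e k i *\<^sub>C X k l)"
      by (simp add: clinear_sum[OF clinear_dual_apply] clinear_scale[OF clinear_dual_apply] mult.commute)
  qed
  have tsum: "(\<Sum>i\<in>A. f i) \<otimes> b = (\<Sum>i\<in>A. f i \<otimes> b)" "b \<otimes> (\<Sum>i\<in>A. f i) = (\<Sum>i\<in>A. b \<otimes> f i)"
    for A :: "nat set" and f :: "nat \<Rightarrow> 'a" and b :: 'a
    by (rule clinear_sum, intro clinear_intros)+
  have comultY: "comult (Y l i) = (\<Sum>q<m. (\<Sum>p<n. e q p *\<^sub>C coef U i p) \<otimes> X q l)" if "l < m" "i < n" for l i
  proof -
    have "comult (Y l i) = (\<Sum>j<n. e l j *\<^sub>C (\<Sum>p<n. coef U i p \<otimes> coef U p j))"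
      using that(2) by (simp add: Y_def clinear_sum[OF clinear_comult] clinear_scale[OF clinear_comult]
          unitary_corepD(1)[OF U] n_def)
    also have "\<dots> = (\<Sum>p<n. \<Sum>j<n. e l j *\<^sub>C (coef U i p \<otimes> coef U p j))"
      unfolding complex_vector.scale_sum_right by (rule sum.swap)
    also have "\<dots> = (\<Sum>p<n. coef U i p \<otimes> Y l p)"
      by (simp add: Y_def tsum tensor_scale_right)
    also have "\<dots> = (\<Sum>p<n. \<Sum>q<m. e q p *\<^sub>C (coef U i p \<otimes> X q l))"
      using that(1) by (simp add: YX tsum tensor_scale_right)
    also have "\<dots> = (\<Sum>q<m. \<Sum>p<n. e q p *\<^sub>C (coef U i p \<otimes> X q l))"
      by (rule sum.swap)
    finally show ?thesis by (simp add: tsum tensor_scale_left)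
  qed
  define V where "V = Corep m X"
  have V: "unitary_corep V"
    unfolding V_def
  proof (rule unitary_corepI)
    fix i j assume ij: "i < m" "j < m"
    have "comult (X i j) = (\<Sum>a<n. cnj (e i a) *\<^sub>C (\<Sum>q<m. Y q a \<otimes> X q j))"
      using ij(2) by (simp add: X_def clinear_sum[OF clinear_comult] clinear_scale[OF clinear_comult] comultY)
        (simp add: X_def Y_def)
    also have "\<dots> = (\<Sum>q<m. \<Sum>a<n. cnj (e i a) *\<^sub>C (Y q a \<otimes> X q j))"
      unfolding complex_vector.scale_sum_right by (rule sum.swap)
    also have "\<dots> = (\<Sum>q<m. (\<Sum>a<n. cnj (e i a) *\<^sub>C Y q a) \<otimes> X q j)"
      by (simp add: tsum tensor_scale_left)
    finally show "comult (X i j) = (\<Sum>k<m. X i k \<otimes> X k j)" by (simp add: X_def)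
    have "dual_act U 1 (e j) = e j"
      by (rule dual_act_one[OF U]) (use e(1)[OF ij(2)] sub(2) in blast)
    then show "counit (X i j) = (if i = j then 1 else 0)"
      using hX[of 1 i j] e(2)[OF ij] by (simp add: one_dual.rep_eq)
    have star_sum: "star (\<Sum>a\<in>A. f a) = (\<Sum>a\<in>A. star (f a))" for A :: "nat set" and f :: "nat \<Rightarrow> 'a"
      by (induction A rule: infinite_finite_induct) (simp_all add: star_add)
    \<comment> \<open>Expanding only the left factor lets the sum over \<open>k\<close> reassemble
      \<open>Y j a\<close> by \<open>YX\<close>. What is left follows from the unitarity of
      \<open>U\<close> and the orthonormality of \<open>e\<close>.\<close>
    have "(\<Sum>k<m. star (X k i) * X k j) = (\<Sum>k<m. \<Sum>a<n. star (Y i a) * (e k a *\<^sub>C X k j))"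
      unfolding X_def[of _ i]
      by (simp add: star_sum star_scaleC sum_distrib_right mult_scaleC_left mult_scaleC_right)
    also have "\<dots> = (\<Sum>a<n. \<Sum>k<m. star (Y i a) * (e k a *\<^sub>C X k j))"
      by (rule sum.swap)
    also have "\<dots> = (\<Sum>a<n. star (Y i a) * Y j a)"
      using ij by (simp add: YX[of j] sum_distrib_left)
    also have "\<dots> = (\<Sum>a<n. \<Sum>p<n. \<Sum>q<n. (cnj (e i p) * e j q) *\<^sub>C (star (coef U a p) * coef U a q))"
      by (simp add: Y_def star_sum star_scaleC sum_product mult_scaleC_left mult_scaleC_right scaleC_scaleC
          mult.commute)
    also have "\<dots> = (\<Sum>p<n. \<Sum>a<n. \<Sum>q<n. (cnj (e i p) * e j q) *\<^sub>C (star (coef U a p) * coef U a q))"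
      by (rule sum.swap)
    also have "\<dots> = (\<Sum>p<n. \<Sum>q<n. \<Sum>a<n. (cnj (e i p) * e j q) *\<^sub>C (star (coef U a p) * coef U a q))"
      by (rule sum.cong[OF refl]) (rule sum.swap)
    also have "\<dots> = (\<Sum>p<n. \<Sum>q<n. (cnj (e i p) * e j q) *\<^sub>C (if p = q then 1 else 0))"
      by (simp add: n_def unitary_corepD(3)[OF U] flip: complex_vector.scale_sum_right)
    also have "\<dots> = (\<Sum>p<n. (cnj (e i p) * e j p) *\<^sub>C 1)"
      by (simp add: if_distrib[of "\<lambda>x. _ *\<^sub>C x"] cong: if_cong)
    also have "\<dots> = ip n (e i) (e j) *\<^sub>C 1"
      by (simp add: ip_def complex_vector.scale_sum_left)
    finally show "(\<Sum>k<m. star (X k i) * X k j) = (if i = j then 1 else 0)"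
      using e(2)[OF ij] by simp
  qed
  define T :: "(nat \<Rightarrow> complex) \<Rightarrow> nat \<Rightarrow> complex" where "T x = (\<Sum>k<m. x k *\<^sub>C e k)" for x
  have T: "clinear T"
    by (simp add: T_def clinear_iff scaleC_add_left sum.distrib complex_vector.scale_sum_right scaleC_scaleC
        del: scaleC_complex_def) (simp add: scaleC_scaleC)
  have ipT: "ip n (e l) (T x) = x l" if "l < m" for l x
    using that e(2) by (simp add: T_def ip_sum ip_scale if_distrib[of "(*) _"] cong: if_cong)
  have bij: "bij_betw T (corep_space V) W"
    unfolding bij_betw_def
  proof
    show "inj_on T (corep_space V)"
    proof (rule inj_onI)
      fix x y assume xy: "x \<in> corep_space V" "y \<in> corep_space V" "T x = T y"
      show "x = y"
      proof
        fix l show "x l = y l"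
          using ipT[of l x] ipT[of l y] xy by (cases "l < m") (simp_all add: corep_space_def V_def)
      qed
    qed
    show "T ` corep_space V = W"
    proof
      show "T ` corep_space V \<subseteq> W"
        unfolding T_def using e(1) sub(1)
        by (auto intro!: complex_vector.subspace_sum complex_vector.subspace_scale)
      show "W \<subseteq> T ` corep_space V"
      proof
        fix v assume "v \<in> W"
        then have "v = T (\<lambda>k. if k < m then ip n (e k) v else 0)" using e(3)[of v] by (simp add: T_def)
        moreover have "(\<lambda>k. if k < m then ip n (e k) v else 0) \<in> corep_space V"
          by (simp add: corep_space_def V_def)
        ultimately show "v \<in> T ` corep_space V" by blast
      qed
    qed
  qed
  have act: "T (dual_act V h x) = dual_act U h (T x)" for h x
  proof -
    have "dual_act U h (T x) = (\<Sum>l<m. \<Sum>k<m. (x l * dual_apply h (X k l)) *\<^sub>C e k)"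
      by (simp add: T_def clinear_sum[OF clinear_dual_act] clinear_scale[OF clinear_dual_act] act_e
          complex_vector.scale_sum_right scaleC_scaleC)
    also have "\<dots> = (\<Sum>k<m. \<Sum>l<m. (x l * dual_apply h (X k l)) *\<^sub>C e k)"
      by (rule sum.swap)
    also have "\<dots> = T (dual_act V h x)"
      by (simp add: T_def dual_act_apply V_def complex_vector.scale_sum_left mult.commute)
    finally show ?thesis by simp
  qed
  show thesis
  proof (rule that)
    show "irreducible_unitary_corep V"
      using irreducible_subrep_bij[OF T bij act W] V by (simp add: irreducible_unitary_corep_def)
  qed (rule T bij act)+
qed

section \<open>Faithfulness of the stabilizer on the spaces \<open>G \<beta>\<close>\<close>

lemma equivalent_subrep_zero:
  assumes eq: "equivalent_subrep X U W U' W'" and W: "subrep X U W"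
    and h: "h \<in> X" "\<And>v. v \<in> W' \<Longrightarrow> dual_act U' h v = 0" and v: "v \<in> W"
  shows "dual_act U h v = 0"
proof -
  obtain T where T: "clinear_on W T" "bij_betw T W W'" "T (dual_act U h v) = dual_act U' h (T v)"
    using eq h(1) v unfolding equivalent_subrep_def by blast
  have 0: "0 \<in> W" using subrepD(1)[OF W] by (rule complex_vector.subspace_0)
  have "T v \<in> W'" using T(2) v by (auto simp: bij_betw_def)
  then have "T (dual_act U h v) = T 0" using T h(2) clinear_onD(3)[OF T(1) 0] by simp
  then show ?thesis
    using T(2) subrepD(3)[OF W h(1) v] 0 by (auto simp: bij_betw_def dest: inj_onD)
qed

text \<open>Complete reducibility is used twice: over the stabilizer it carries vanishing from the
  \<open>G \<beta>\<close> to each \<open>H \<alpha>\<close>, and over the full dual from the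
  \<open>H \<alpha>\<close> to every unitary corepresentation. The coefficients of the latter span
  the algebra.\<close>

lemma stabilizer_faithful:
  fixes B :: "'a::cqg_hopf_star_algebra set"
  assumes B: "left_coideal_star_subalgebra B" and H: "maximal_irreducible_coreps H"
    and G: "maximal_stabilizer_irreps B H p G"
    and h: "h \<in> stabilizer B" and zero: "\<And>\<beta> v. v \<in> G \<beta> \<Longrightarrow> dual_act (H (p \<beta>)) h v = 0"
  shows "h = 0"
proof -
  have unitary_H: "unitary_corep (H \<alpha>)" for \<alpha>
    using H by (simp add: maximal_irreducible_coreps_def irreducible_unitary_corep_def)
  have zero_H: "dual_act (H \<alpha>) h v = 0" if v: "v \<in> corep_space (H \<alpha>)" for \<alpha> v
  proof (rule dual_act_zero_if_zero_on_irreducibles[OF unitary_H _ _ _ v])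
    show "star k \<in> stabilizer B" if "k \<in> stabilizer B" for k by (rule stabilizer_star[OF B that])
    show "subrep (stabilizer B) (H \<alpha>) (corep_space (H \<alpha>))"
      by (simp add: subrep_def subspace_corep_space dual_act_in_corep_space)
    fix W v assume W: "irreducible_subrep (stabilizer B) (H \<alpha>) W" and v: "v \<in> W"
    obtain \<beta> where "equivalent_subrep (stabilizer B) (H \<alpha>) W (H (p \<beta>)) (G \<beta>)"
      using G W unfolding maximal_stabilizer_irreps_def by blast
    then show "dual_act (H \<alpha>) h v = 0"
      by (rule equivalent_subrep_zero[OF _ irreducible_subrepD(1)[OF W] h zero v])
  qed
  have zero_U: "dual_act U h v = 0" if U: "unitary_corep U" and v: "v \<in> corep_space U" for U :: "'a corep" and v
  proof (rule dual_act_zero_if_zero_on_irreducibles[OF U _ _ _ v])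
    show "subrep UNIV U (corep_space U)"
      by (simp add: subrep_def subspace_corep_space dual_act_in_corep_space)
    fix W v assume W: "irreducible_subrep UNIV U W" and v: "v \<in> W"
    obtain V T where V: "irreducible_unitary_corep V" "clinear T" "bij_betw T (corep_space V) W"
      "\<And>h v. v \<in> corep_space V \<Longrightarrow> T (dual_act V h v) = dual_act U h (T v)"
      using irreducible_subrep_corep[OF U W] by metis
    obtain \<alpha> where \<alpha>: "equivalent_corep V (H \<alpha>)"
      using H V(1) unfolding maximal_irreducible_coreps_def by blast
    obtain x where x: "x \<in> corep_space V" "v = T x" using V(3) v by (auto simp: bij_betw_def)
    have "dual_act V h x = 0"
      using \<alpha>[unfolded equivalent_corep_def]
    proof (rule equivalent_subrep_zero[OF _ _ UNIV_I zero_H x(1)])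
      show "subrep UNIV V (corep_space V)"
        by (simp add: subrep_def subspace_corep_space dual_act_in_corep_space)
    qed
    then show "dual_act U h v = 0"
      using V(4)[OF x(1), of h] x(2) clinear_0[OF V(2)] by simp
  qed auto
  have "dual_apply h a = 0" if "a \<in> complex_vector.span
      {coef U i j | U i j. unitary_corep U \<and> i < cdim U \<and> j < cdim U}" for a :: 'a
    using that
  proof (induction rule: complex_vector.span_induct_alt)
    case base
    then show ?case by (rule clinear_0[OF clinear_dual_apply])
  next
    case (step c z a)
    then obtain U i j where z: "z = coef U i j" "unitary_corep U" "i < cdim U" "j < cdim U" by blast
    \<comment> \<open>The unit vector at \<open>j\<close> picks out the \<open>j\<close>-th column,
      whose entry at \<open>i\<close> is the value of \<open>h\<close> on the coefficient.\<close>
    have "dual_act U h (\<lambda>k. if k = j then 1 else 0) = 0"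
      using z by (intro zero_U) (auto simp: corep_space_def)
    then have "dual_act U h (\<lambda>k. if k = j then 1 else 0) i = 0" by simp
    then have "dual_apply h z = 0"
      using z by (simp add: dual_act_apply if_distrib[of "(*) _"] cong: if_cong)
    then show ?case
      using step.IH by (simp add: clinear_add[OF clinear_dual_apply] clinear_scale[OF clinear_dual_apply])
  qed
  then show ?thesis
    by (intro dual_eqI) (simp add: span_matrix_coefficients zero_dual.rep_eq)
qed

section \<open>Finite support and finite-dimensional left ideals\<close>

lemma module_hom_clinear: "clinear f \<Longrightarrow> module_hom scaleC scaleC f"
  by (simp add: module_hom_iff_linear)

lemma clinear_zero_on_span:
  assumes "clinear L" and "\<And>x. x \<in> S \<Longrightarrow> L x = 0" and "x \<in> complex_vector.span S"
  shows "L x = 0"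
  using assms(3)
  by (induction rule: complex_vector.span_induct_alt)
    (simp_all add: clinear_0 clinear_add clinear_scale assms(1,2))

text \<open>Restriction to the finite set \<open>E\<close>, padded by zero outside, is linear and
  injective on \<open>X\<close>, so an independent subset of \<open>X\<close> has at most
  \<open>card E\<close> elements.\<close>

lemma finite_span_if_separated:
  fixes X :: "'a::complex_vector dual set"
  assumes X: "complex_vector.subspace X" and E: "finite E"
    and sep: "\<And>h. h \<in> X \<Longrightarrow> (\<And>a. a \<in> E \<Longrightarrow> dual_apply h a = 0) \<Longrightarrow> h = 0"
  obtains S where "finite S" and "X \<subseteq> complex_vector.span S"
proof -
  define L where "L h = (\<lambda>a. if a \<in> E then dual_apply h a else 0)" for h :: "'a dual"
  have L: "clinear L"
    by (auto simp: L_def clinear_iff fun_eq_iff dual_apply_add dual_apply_scaleC)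
  obtain S where S: "S \<subseteq> X" "complex_vector.independent S" "X \<subseteq> complex_vector.span S"
    using complex_vector.maximal_independent_subset by blast
  have inj: "inj_on L X"
  proof (rule inj_onI)
    fix h k assume hk: "h \<in> X" "k \<in> X" "L h = L k"
    have "h - k = 0"
    proof (rule sep)
      show "h - k \<in> X" using hk X by (simp add: complex_vector.subspace_diff)
      show "dual_apply (h - k) a = 0" if "a \<in> E" for a
        using fun_cong[OF hk(3), of a] that by (simp add: L_def minus_dual.rep_eq)
    qed
    then show "h = k" by simp
  qed
  have "complex_vector.span S \<subseteq> X" by (rule complex_vector.span_minimal[OF S(1) X])
  then have "complex_vector.independent (L ` S)"
    using module_hom.independent_injective_image[OF module_hom_clinear[OF L] S(2)] inj inj_on_subset by blast
  then have fin: "finite (L ` S)"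
  proof (rule finite_independent_supported[OF _ _ E, THEN conjunct1])
    show "f a = 0" if "f \<in> L ` S" "a \<notin> E" for f a using that by (auto simp: L_def)
  qed
  have "finite S" using finite_imageD[OF fin inj_on_subset[OF inj S(1)]] .
  with S(3) that show thesis by blast
qed

text \<open>\<open>L i\<close> vanishes on the span of the other vectors but not at
  \<open>g i\<close>, as a dual basis does up to scaling.\<close>

lemma independent_if_diagonal:
  assumes L: "\<And>i. clinear (L i)" and diag: "\<And>i. i \<in> F \<Longrightarrow> L i (g i) \<noteq> 0"
    and off: "\<And>i j. i \<in> F \<Longrightarrow> j \<in> F \<Longrightarrow> i \<noteq> j \<Longrightarrow> L i (g j) = 0"
  shows "inj_on g F" and "complex_vector.independent (g ` F)"
proof -
  show "inj_on g F" using diag off by (metis inj_onI)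
  show "complex_vector.independent (g ` F)"
  proof
    assume "complex_vector.dependent (g ` F)"
    then obtain i where i: "i \<in> F" "g i \<in> complex_vector.span (g ` F - {g i})"
      unfolding complex_vector.dependent_def by blast
    have "L i (g i) = 0"
      by (rule clinear_zero_on_span[OF L _ i(2)]) (use off i(1) in blast)
    with diag i(1) show False by blast
  qed
qed

text \<open>Here \<open>N\<close> is a left ideal of \<open>X\<close>, so the orbit of
  \<open>v\<close> under \<open>N\<close> is invariant. If \<open>W\<close> is irreducible, the
  orbit is zero or all of \<open>W\<close>.\<close>

lemma subrep_ideal_image:
  assumes U: "unitary_corep U" and W: "subrep X U W" "v \<in> W"
    and N: "complex_vector.subspace N" "N \<subseteq> X" "\<And>k h. k \<in> X \<Longrightarrow> h \<in> N \<Longrightarrow> k * h \<in> N"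
  shows "subrep X U ((\<lambda>h. dual_act U h v) ` N)" and "(\<lambda>h. dual_act U h v) ` N \<subseteq> W"
proof -
  show sub: "(\<lambda>h. dual_act U h v) ` N \<subseteq> W"
    using subrepD(3)[OF W(1) _ W(2)] N(2) by blast
  have "complex_vector.subspace ((\<lambda>h. dual_act U h v) ` N)"
    by (rule module_hom.subspace_image[OF module_hom_clinear[OF clinear_dual_act_left] N(1)])
  moreover have "dual_act U k w \<in> (\<lambda>h. dual_act U h v) ` N"
    if "k \<in> X" "w \<in> (\<lambda>h. dual_act U h v) ` N" for k w
    using that N(3) by (auto simp flip: dual_act_mult[OF U])
  ultimately show "subrep X U ((\<lambda>h. dual_act U h v) ` N)"
    using sub subrepD(2)[OF W(1)] unfolding subrep_def by blast
qed

text \<open>Writing \<open>t\<close> as a finite sum of elementary tensors leaves finitely many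
  second legs. The order of quantifiers matters: \<open>Y\<close> is chosen before \<open>f\<close>,
  which will depend on an arbitrary functional.\<close>

lemma tensor_lift_finite_right:
  obtains Y where "finite Y"
    and "\<And>f :: 'a \<Rightarrow> 'b \<Rightarrow> 'c::complex_vector. cbilinear f \<Longrightarrow>
      tensor_lift f (t :: ('a::complex_vector, 'b::complex_vector) tensor) \<in> complex_vector.span (\<Union>y\<in>Y. range (\<lambda>x. f x y))"
proof -
  have "\<exists>Y. finite Y \<and> (\<forall>f :: 'a \<Rightarrow> 'b \<Rightarrow> 'c. cbilinear f \<longrightarrow>
      tensor_lift f t \<in> complex_vector.span (\<Union>y\<in>Y. range (\<lambda>x. f x y)))"
  proof (induction t rule: tensor_induct)
    case zero
    then show ?case by (intro exI[of _ "{}"]) simp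
  next
    case (add a b t)
    then obtain Y where Y: "finite Y" "\<And>f :: 'a \<Rightarrow> 'b \<Rightarrow> 'c. cbilinear f \<Longrightarrow>
      tensor_lift f t \<in> complex_vector.span (\<Union>y\<in>Y. range (\<lambda>x. f x y))" by blast
    have "tensor_lift f (a \<otimes> b + t) \<in> complex_vector.span (\<Union>y\<in>insert b Y. range (\<lambda>x. f x y))"
      if f: "cbilinear f" for f :: "'a \<Rightarrow> 'b \<Rightarrow> 'c"
    proof -
      have "f a b \<in> complex_vector.span (\<Union>y\<in>insert b Y. range (\<lambda>x. f x y))"
        by (rule complex_vector.span_base) blast
      moreover have "tensor_lift f t \<in> complex_vector.span (\<Union>y\<in>insert b Y. range (\<lambda>x. f x y))"
        using Y(2)[OF f] complex_vector.span_mono[of "\<Union>y\<in>Y. range (\<lambda>x. f x y)" "\<Union>y\<in>insert b Y. range (\<lambda>x. f x y)"]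
        by blast
      ultimately show ?thesis
        by (simp only: tensor_lift_add tensor_lift_tensor[OF cbilinear_balanced[OF f]] complex_vector.span_add)
    qed
    with Y(1) show ?case by (intro exI[of _ "insert b Y"]) simp
  qed
  with that show thesis by blast
qed

section \<open>Finitely supported elements of the stabilizer\<close>

context
  fixes B :: "'a::cqg_hopf_star_algebra set"
    and H :: "'i \<Rightarrow> 'a corep" and p :: "'j \<Rightarrow> 'i" and G :: "'j \<Rightarrow> (nat \<Rightarrow> complex) set"
  assumes B: "left_coideal_star_subalgebra B" and H: "maximal_irreducible_coreps H"
    and G: "maximal_stabilizer_irreps B H p G"
begin

abbreviation "act \<beta> \<equiv> dual_act (H (p \<beta>))"

lemma unitary_H: "unitary_corep (H \<alpha>)"
  using H by (simp add: maximal_irreducible_coreps_def irreducible_unitary_corep_def)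

lemma irreducible_G: "irreducible_subrep (stabilizer B) (H (p \<beta>)) (G \<beta>)"
  using G by (simp add: maximal_stabilizer_irreps_def)

lemmas subrep_G = irreducible_subrepD(1)[OF irreducible_G]

lemma act_G: "h \<in> stabilizer B \<Longrightarrow> v \<in> G \<beta> \<Longrightarrow> act \<beta> h v \<in> G \<beta>"
  by (rule subrepD(3)[OF subrep_G])

lemmas act_mult = dual_act_mult[OF unitary_H]

lemma act_one: "v \<in> G \<beta> \<Longrightarrow> act \<beta> 1 v = v"
  using subrepD(2)[OF subrep_G] by (intro dual_act_one[OF unitary_H]) blast

lemma act_diff: "act \<beta> (h - k) v = act \<beta> h v - act \<beta> k v"
  using clinear_add[OF clinear_dual_act_left, of "H (p \<beta>)" "h - k" k v] by simp

text \<open>If no such \<open>h\<close> existed, sending \<open>h (u \<gamma>)\<close> to \<open>h (u \<beta>)\<close>, for \<open>h\<close> annihilating \<open>u\<close> elsewhere,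
  would make the simple modules \<open>G \<gamma>\<close> and \<open>G \<beta>\<close> equivalent.\<close>

lemma separating_stabilizer_element:
  assumes "finite F" and "\<beta> \<notin> F" and "\<And>\<gamma>. \<gamma> \<in> insert \<beta> F \<Longrightarrow> u \<gamma> \<in> G \<gamma> \<and> u \<gamma> \<noteq> 0"
  obtains h where "h \<in> stabilizer B" and "\<And>\<gamma>. \<gamma> \<in> F \<Longrightarrow> act \<gamma> h (u \<gamma>) = 0" and "act \<beta> h (u \<beta>) \<noteq> 0"
proof -
  have "\<exists>h\<in>stabilizer B. (\<forall>\<gamma>\<in>F. act \<gamma> h (u \<gamma>) = 0) \<and> act \<beta> h (u \<beta>) \<noteq> 0"
    using assms
  proof (induction F arbitrary: \<beta> rule: finite_induct)
    case empty
    have "u \<beta> \<in> G \<beta>" "u \<beta> \<noteq> 0" using empty by blast+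
    then have "act \<beta> 1 (u \<beta>) \<noteq> 0" by (metis act_one)
    then show ?case using stabilizer_one[OF B] by blast
  next
    case (insert \<gamma> F)
    \<comment> \<open>The left ideal annihilating \<open>u\<close> on \<open>F\<close>. The
      induction hypothesis, applied to \<open>\<gamma>\<close> and to \<open>\<beta>\<close>, gives
      elements of \<open>N\<close> that do not annihilate \<open>u \<gamma>\<close> and
      \<open>u \<beta>\<close>, respectively.\<close>
    define N where "N = {h \<in> stabilizer B. \<forall>\<delta>\<in>F. act \<delta> h (u \<delta>) = 0}"
    have N_sub: "N \<subseteq> stabilizer B" by (auto simp: N_def)
    have N: "complex_vector.subspace N"
      using subspace_stabilizer[OF B] unfolding N_def
      by (auto simp: complex_vector.subspace_def clinear_0[OF clinear_dual_act_left]
          clinear_add[OF clinear_dual_act_left] clinear_scale[OF clinear_dual_act_left])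
    have N_ideal: "k * h \<in> N" if "k \<in> stabilizer B" "h \<in> N" for k h
      using that by (simp add: N_def act_mult stabilizer_mult[OF B] clinear_0[OF clinear_dual_act])
    have N_diff: "h - k \<in> N" if "h \<in> N" "k \<in> N" for h k
      using that N by (rule complex_vector.subspace_diff[rotated 1])
    have u: "u \<gamma> \<in> G \<gamma>" "u \<beta> \<in> G \<beta>" using insert.prems by auto
    obtain h\<gamma> where h\<gamma>: "h\<gamma> \<in> N" "act \<gamma> h\<gamma> (u \<gamma>) \<noteq> 0"
      using insert.IH[of \<gamma>] insert.hyps insert.prems unfolding N_def by blast
    obtain h\<beta> where h\<beta>: "h\<beta> \<in> N" "act \<beta> h\<beta> (u \<beta>) \<noteq> 0"
      using insert.IH[of \<beta>] insert.hyps insert.prems unfolding N_def by blast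
    have im: "(\<lambda>h. act \<delta> h (u \<delta>)) ` N = G \<delta>"
      if "u \<delta> \<in> G \<delta>" "h \<in> N" "act \<delta> h (u \<delta>) \<noteq> 0" for \<delta> h
      using irreducible_subrepD(2)[OF irreducible_G subrep_ideal_image[OF unitary_H subrep_G that(1) N N_sub N_ideal] _ that(3)]
        that(2) by blast
    show ?case
    proof (rule ccontr)
      assume neg: "\<not> ?thesis"
      have kill: "act \<beta> h (u \<beta>) = 0" if "h \<in> N" "act \<gamma> h (u \<gamma>) = 0" for h
        using neg that unfolding N_def by blast
      define K where "K = {h \<in> N. act \<beta> h (u \<beta>) = 0}"
      have "complex_vector.subspace K"
        using N unfolding K_def
        by (auto simp: complex_vector.subspace_def clinear_0[OF clinear_dual_act_left]
            clinear_add[OF clinear_dual_act_left] clinear_scale[OF clinear_dual_act_left])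
      moreover have "k * h \<in> K" if "k \<in> stabilizer B" "h \<in> K" for k h
        using that N_ideal by (simp add: K_def act_mult clinear_0[OF clinear_dual_act])
      moreover have "K \<subseteq> stabilizer B" using N_sub by (auto simp: K_def)
      ultimately have K: "subrep (stabilizer B) (H (p \<gamma>)) ((\<lambda>h. act \<gamma> h (u \<gamma>)) ` K)"
        "(\<lambda>h. act \<gamma> h (u \<gamma>)) ` K \<subseteq> G \<gamma>"
        using subrep_ideal_image[OF unitary_H subrep_G u(1), of K] by blast+
      \<comment> \<open>Otherwise the orbit of \<open>u \<gamma>\<close> under \<open>K\<close> is
        all of \<open>G \<gamma>\<close>, and subtracting an element of \<open>K\<close> from
        \<open>h\<beta>\<close> makes it annihilate \<open>u \<gamma>\<close> without changing its
        value at \<open>u \<beta>\<close>. This contradicts \<open>kill\<close>.\<close>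
      have kill': "act \<gamma> h (u \<gamma>) = 0" if h: "h \<in> N" "act \<beta> h (u \<beta>) = 0" for h
      proof (rule ccontr)
        assume "act \<gamma> h (u \<gamma>) \<noteq> 0"
        moreover have "h \<in> K" using h by (simp add: K_def)
        ultimately have "(\<lambda>h. act \<gamma> h (u \<gamma>)) ` K = G \<gamma>"
          using irreducible_subrepD(2)[OF irreducible_G K] by blast
        moreover have "act \<gamma> h\<beta> (u \<gamma>) \<in> G \<gamma>" using h\<beta>(1) N_sub u(1) act_G by blast
        ultimately obtain k where k: "k \<in> K" "act \<gamma> h\<beta> (u \<gamma>) = act \<gamma> k (u \<gamma>)" by blast
        then have "k \<in> N" "act \<gamma> (h\<beta> - k) (u \<gamma>) = 0" by (simp_all add: K_def act_diff)
        then have "act \<beta> (h\<beta> - k) (u \<beta>) = 0" using kill N_diff[OF h\<beta>(1)] by blast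
        then show False using k(1) h\<beta>(2) by (simp add: K_def act_diff)
      qed
      \<comment> \<open>Any preimage \<open>h\<close> of \<open>w\<close> may be chosen: by
        \<open>kill\<close> the value at \<open>u \<beta>\<close> does not depend on it, while
        \<open>kill'\<close> will give injectivity.\<close>
      define T where "T w = act \<beta> (SOME h. h \<in> N \<and> act \<gamma> h (u \<gamma>) = w) (u \<beta>)" for w
      have T: "T (act \<gamma> h (u \<gamma>)) = act \<beta> h (u \<beta>)" if h: "h \<in> N" for h
      proof -
        define k where "k = (SOME k. k \<in> N \<and> act \<gamma> k (u \<gamma>) = act \<gamma> h (u \<gamma>))"
        have k: "k \<in> N \<and> act \<gamma> k (u \<gamma>) = act \<gamma> h (u \<gamma>)"
          unfolding k_def by (rule someI[of _ h]) (simp add: h)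
        then have "act \<beta> (k - h) (u \<beta>) = 0" by (intro kill) (simp_all add: act_diff N_diff h)
        then show ?thesis by (simp add: T_def k_def[symmetric] act_diff)
      qed
      have G\<gamma>: "w \<in> G \<gamma> \<longleftrightarrow> (\<exists>h\<in>N. w = act \<gamma> h (u \<gamma>))" for w
        using im[OF u(1) h\<gamma>] by blast
      have lin: "clinear_on (G \<gamma>) T"
        unfolding clinear_on_def
      proof (intro conjI ballI allI)
        fix v w assume "v \<in> G \<gamma>" "w \<in> G \<gamma>"
        then obtain h k where hk: "h \<in> N" "v = act \<gamma> h (u \<gamma>)" "k \<in> N" "w = act \<gamma> k (u \<gamma>)"
          using G\<gamma> by blast
        then have "h + k \<in> N" using N by (simp add: complex_vector.subspace_add)
        then show "T (v + w) = T v + T w"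
          using T[of "h + k"] hk by (simp add: T clinear_add[OF clinear_dual_act_left])
      next
        fix c v assume "v \<in> G \<gamma>"
        then obtain h where h: "h \<in> N" "v = act \<gamma> h (u \<gamma>)" using G\<gamma> by blast
        then have "c *\<^sub>C h \<in> N" using N by (simp add: complex_vector.subspace_scale)
        then show "T (c *\<^sub>C v) = c *\<^sub>C T v"
          using T[of "c *\<^sub>C h"] h by (simp add: T clinear_scale[OF clinear_dual_act_left])
      qed
      have bij: "bij_betw T (G \<gamma>) (G \<beta>)"
        unfolding bij_betw_def
      proof
        show "inj_on T (G \<gamma>)"
        proof (rule inj_onI)
          fix v w assume vw: "v \<in> G \<gamma>" "w \<in> G \<gamma>" "T v = T w"
          then obtain h k where hk: "h \<in> N" "v = act \<gamma> h (u \<gamma>)" "k \<in> N" "w = act \<gamma> k (u \<gamma>)"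
            using G\<gamma> by blast
          then have "act \<beta> (h - k) (u \<beta>) = 0" using vw(3) by (simp add: T act_diff)
          then have "act \<gamma> (h - k) (u \<gamma>) = 0" using kill' N_diff hk by blast
          then show "v = w" using hk by (simp add: act_diff)
        qed
        have "T ` (\<lambda>h. act \<gamma> h (u \<gamma>)) ` N = (\<lambda>h. act \<beta> h (u \<beta>)) ` N"
          unfolding image_image using T by (intro image_cong) auto
        then show "T ` G \<gamma> = G \<beta>"
          using im[OF u(1) h\<gamma>] im[OF u(2) h\<beta>] by simp
      qed
      have act: "T (act \<gamma> k v) = act \<beta> k (T v)" if k: "k \<in> stabilizer B" and v: "v \<in> G \<gamma>" for k v
      proof -
        obtain h where h: "h \<in> N" "v = act \<gamma> h (u \<gamma>)" using v G\<gamma> by blast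
        then show ?thesis using T[OF N_ideal[OF k h(1)]] by (simp add: act_mult T)
      qed
      have "equivalent_subrep (stabilizer B) (H (p \<gamma>)) (G \<gamma>) (H (p \<beta>)) (G \<beta>)"
        unfolding equivalent_subrep_def using lin bij act by blast
      then have "\<gamma> = \<beta>" using G unfolding maximal_stabilizer_irreps_def by blast
      then show False using insert.prems(1) by blast
    qed
  qed
  with that show thesis by blast
qed

lemma stabilizer_dualD:
  assumes "\<omega> \<in> stabilizer_dual B H p G"
  shows "\<omega> \<in> stabilizer B" and "finite {\<beta>. \<exists>v\<in>G \<beta>. act \<beta> \<omega> v \<noteq> 0}"
  using assms by (auto simp: stabilizer_dual_def)

lemma stabilizer_dualI:
  assumes "\<omega>' \<in> stabilizer B" and "\<omega> \<in> stabilizer_dual B H p G"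
    and "\<And>\<beta> v. v \<in> G \<beta> \<Longrightarrow> (\<And>w. w \<in> G \<beta> \<Longrightarrow> act \<beta> \<omega> w = 0) \<Longrightarrow> act \<beta> \<omega>' v = 0"
  shows "\<omega>' \<in> stabilizer_dual B H p G"
proof -
  have "{\<beta>. \<exists>v\<in>G \<beta>. act \<beta> \<omega>' v \<noteq> 0} \<subseteq> {\<beta>. \<exists>v\<in>G \<beta>. act \<beta> \<omega> v \<noteq> 0}"
    using assms(3) by blast
  then show ?thesis
    using assms(1) stabilizer_dualD(2)[OF assms(2)] finite_subset unfolding stabilizer_dual_def by blast
qed

lemma stabilizer_dual_mult_left:
  assumes "h \<in> stabilizer B" "\<omega> \<in> stabilizer_dual B H p G"
  shows "h * \<omega> \<in> stabilizer_dual B H p G"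
  by (rule stabilizer_dualI[OF _ assms(2)])
    (simp_all add: stabilizer_mult[OF B] assms stabilizer_dualD(1)[OF assms(2)] act_mult clinear_0[OF clinear_dual_act])

text \<open>The support does not grow: if \<open>\<omega>\<close> is zero on
  \<open>G \<beta>\<close>, then moving \<open>star \<omega>\<close> across the inner product shows
  that each vector \<open>act \<beta> (star \<omega>) v\<close> has norm zero.\<close>

lemma stabilizer_dual_star:
  assumes \<omega>: "\<omega> \<in> stabilizer_dual B H p G"
  shows "star \<omega> \<in> stabilizer_dual B H p G"
proof (rule stabilizer_dualI[OF _ \<omega>])
  show star: "star \<omega> \<in> stabilizer B" by (rule stabilizer_star[OF B stabilizer_dualD(1)[OF \<omega>]])
  fix \<beta> v assume v: "v \<in> G \<beta>" and zero: "\<And>w. w \<in> G \<beta> \<Longrightarrow> act \<beta> \<omega> w = 0"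
  let ?w = "act \<beta> (star \<omega>) v" and ?n = "cdim (H (p \<beta>))"
  have w: "?w \<in> G \<beta>" by (rule act_G[OF star v])
  have "ip ?n ?w ?w = ip ?n (act \<beta> \<omega> ?w) v"
    by (rule ip_dual_act[OF unitary_H, symmetric])
  also have "\<dots> = 0"
    unfolding zero[OF w] by (simp add: ip_def)
  finally show "?w = 0"
    by (rule ip_self_eq_0) (simp add: dual_act_apply)
qed

lemma subspace_stabilizer_dual: "complex_vector.subspace (stabilizer_dual B H p G)"
proof (rule complex_vector.subspaceI)
  show "0 \<in> stabilizer_dual B H p G"
    using complex_vector.subspace_0[OF subspace_stabilizer[OF B]]
    by (simp add: stabilizer_dual_def clinear_0[OF clinear_dual_act_left])
  fix \<omega> c assume \<omega>: "\<omega> \<in> stabilizer_dual B H p G"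
  show "c *\<^sub>C \<omega> \<in> stabilizer_dual B H p G"
    by (rule stabilizer_dualI[OF _ \<omega>])
      (simp_all add: complex_vector.subspace_scale[OF subspace_stabilizer[OF B]] stabilizer_dualD(1)[OF \<omega>]
        clinear_scale[OF clinear_dual_act_left])
  fix \<eta> assume \<eta>: "\<eta> \<in> stabilizer_dual B H p G"
  have "{\<beta>. \<exists>v\<in>G \<beta>. act \<beta> (\<omega> + \<eta>) v \<noteq> 0} \<subseteq>
      {\<beta>. \<exists>v\<in>G \<beta>. act \<beta> \<omega> v \<noteq> 0} \<union> {\<beta>. \<exists>v\<in>G \<beta>. act \<beta> \<eta> v \<noteq> 0}"
    by (auto simp: clinear_add[OF clinear_dual_act_left])
  then show "\<omega> + \<eta> \<in> stabilizer_dual B H p G"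
    using \<omega> \<eta> complex_vector.subspace_add[OF subspace_stabilizer[OF B]]
    unfolding stabilizer_dual_def by (auto intro: finite_subset)
qed

text \<open>The right-hand side mentions no \<open>G \<beta>\<close>, so it can be checked for
  slices, whose effect on the individual \<open>G \<beta>\<close> is not transparent.\<close>

lemma stabilizer_dual_iff_finite_ideal:
  assumes \<omega>: "\<omega> \<in> stabilizer B"
  shows "\<omega> \<in> stabilizer_dual B H p G \<longleftrightarrow>
    (\<exists>S. finite S \<and> (\<forall>h\<in>stabilizer B. h * \<omega> \<in> complex_vector.span S))"
proof
  assume fin: "\<omega> \<in> stabilizer_dual B H p G"
  \<comment> \<open>The coefficients of the finitely many blocks met by \<open>\<omega>\<close>. If
    \<open>h * \<omega>\<close> vanishes on \<open>E\<close>, it is zero on these blocks, and on the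
    others because \<open>\<omega>\<close> is; faithfulness then makes it zero.\<close>
  define E where "E = (\<Union>\<beta>\<in>{\<beta>. \<exists>v\<in>G \<beta>. act \<beta> \<omega> v \<noteq> 0}.
    case_prod (coef (H (p \<beta>))) ` ({..<cdim (H (p \<beta>))} \<times> {..<cdim (H (p \<beta>))}))"
  have E: "finite E" unfolding E_def using stabilizer_dualD(2)[OF fin] by blast
  have "complex_vector.subspace ((\<lambda>h. h * \<omega>) ` stabilizer B)"
    by (intro module_hom.subspace_image[OF module_hom_clinear] subspace_stabilizer[OF B]
        clinear_dual_mult clinear_ident)
  moreover have "k = 0" if k: "k \<in> (\<lambda>h. h * \<omega>) ` stabilizer B" and 0: "\<And>a. a \<in> E \<Longrightarrow> dual_apply k a = 0" for k
  proof -
    obtain h where h: "h \<in> stabilizer B" "k = h * \<omega>" using k by blast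
    show ?thesis
    proof (rule stabilizer_faithful[OF B H G])
      show "k \<in> stabilizer B" using h stabilizer_mult[OF B] \<omega> by simp
      fix \<beta> v assume v: "v \<in> G \<beta>"
      show "act \<beta> k v = 0"
      proof (cases "act \<beta> \<omega> v = 0")
        case True
        then show ?thesis by (simp add: h act_mult clinear_0[OF clinear_dual_act])
      next
        case False
        then have "coef (H (p \<beta>)) i j \<in> E" if "i < cdim (H (p \<beta>))" "j < cdim (H (p \<beta>))" for i j
          using v that unfolding E_def by force
        then show ?thesis by (auto simp: fun_eq_iff dual_act_apply 0)
      qed
    qed
  qed
  ultimately obtain S where "finite S" "(\<lambda>h. h * \<omega>) ` stabilizer B \<subseteq> complex_vector.span S"
    using finite_span_if_separated[OF _ E] by metis
  then show "\<exists>S. finite S \<and> (\<forall>h\<in>stabilizer B. h * \<omega> \<in> complex_vector.span S)" by blast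
next
  assume "\<exists>S. finite S \<and> (\<forall>h\<in>stabilizer B. h * \<omega> \<in> complex_vector.span S)"
  then obtain S where S: "finite S" "\<And>h. h \<in> stabilizer B \<Longrightarrow> h * \<omega> \<in> complex_vector.span S" by blast
  define D where "D = {\<beta>. \<exists>v\<in>G \<beta>. act \<beta> \<omega> v \<noteq> 0}"
  have "\<forall>\<beta>. \<exists>v. \<beta> \<in> D \<longrightarrow> v \<in> G \<beta> \<and> act \<beta> \<omega> v \<noteq> 0" by (auto simp: D_def)
  then obtain v where v: "\<And>\<beta>. \<beta> \<in> D \<Longrightarrow> v \<beta> \<in> G \<beta> \<and> act \<beta> \<omega> (v \<beta>) \<noteq> 0" by metis
  have "card F \<le> card S" if F: "F \<subseteq> D" "finite F" for F
  proof -
    \<comment> \<open>Separating elements make the evaluations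
      \<open>k \<mapsto> act \<beta> k (v \<beta>)\<close> diagonal on the products
      \<open>h \<beta> * \<omega>\<close>, so \<open>F\<close> cannot have more elements than the
      spanning set \<open>S\<close>.\<close>
    have "\<exists>h. h \<in> stabilizer B \<and> (\<forall>\<gamma>\<in>F - {\<beta>}. act \<gamma> h (act \<gamma> \<omega> (v \<gamma>)) = 0) \<and> act \<beta> h (act \<beta> \<omega> (v \<beta>)) \<noteq> 0"
      if "\<beta> \<in> F" for \<beta>
      using separating_stabilizer_element[of "F - {\<beta>}" \<beta> "\<lambda>\<gamma>. act \<gamma> \<omega> (v \<gamma>)"] F v that act_G[OF \<omega>]
      by (smt (verit) Diff_iff finite_Diff insertCI insertE insert_Diff subset_iff)
    then obtain h where h: "\<And>\<beta>. \<beta> \<in> F \<Longrightarrow> h \<beta> \<in> stabilizer B"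
      "\<And>\<beta> \<gamma>. \<beta> \<in> F \<Longrightarrow> \<gamma> \<in> F \<Longrightarrow> \<gamma> \<noteq> \<beta> \<Longrightarrow> act \<gamma> (h \<beta>) (act \<gamma> \<omega> (v \<gamma>)) = 0"
      "\<And>\<beta>. \<beta> \<in> F \<Longrightarrow> act \<beta> (h \<beta>) (act \<beta> \<omega> (v \<beta>)) \<noteq> 0"
      by (metis Diff_iff singletonD)
    have *: "inj_on (\<lambda>\<beta>. h \<beta> * \<omega>) F" "complex_vector.independent ((\<lambda>\<beta>. h \<beta> * \<omega>) ` F)"
      using h(2,3)
      by (intro independent_if_diagonal[of "\<lambda>\<beta> k. act \<beta> k (v \<beta>)"] clinear_dual_act_left; simp add: act_mult)+
    have "(\<lambda>\<beta>. h \<beta> * \<omega>) ` F \<subseteq> complex_vector.span S" using h(1) S(2) by blast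
    then have "card ((\<lambda>\<beta>. h \<beta> * \<omega>) ` F) \<le> card S"
      using complex_vector.independent_span_bound[OF S(1) *(2)] by blast
    then show ?thesis by (simp add: card_image[OF *(1)])
  qed
  then have "finite D" using finite_if_finite_subsets_card_bdd by blast
  then show "\<omega> \<in> stabilizer_dual B H p G" using \<omega> by (simp add: stabilizer_dual_def D_def)
qed

text \<open>By \<open>mult_slice\<close>, \<open>h * dual_slice 1 \<omega> c\<close> is a sum of
  slices, at second legs of \<open>c\<close>, of elements of the ideal generated by
  \<open>\<omega>\<close>. Finitely many legs and a finite spanning set of that ideal suffice for
  all \<open>h\<close> at once.\<close>

lemma stabilizer_dual_slice:
  assumes \<omega>: "\<omega> \<in> stabilizer_dual B H p G"
  shows "dual_slice 1 \<omega> c \<in> stabilizer_dual B H p G"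
proof -
  note I = stabilizer_dualD(1)[OF \<omega>]
  obtain S where S: "finite S" "\<And>h. h \<in> stabilizer B \<Longrightarrow> h * \<omega> \<in> complex_vector.span S"
    using \<omega> stabilizer_dual_iff_finite_ideal[OF I] by blast
  obtain Y where Y: "finite Y" "\<And>f :: 'a \<Rightarrow> 'a \<Rightarrow> 'a dual. cbilinear f \<Longrightarrow>
      sweedler c f \<in> complex_vector.span (\<Union>y\<in>Y. range (\<lambda>x. f x y))"
    using tensor_lift_finite_right[of "comult c"] by metis
  define S' where "S' = (\<Union>y\<in>Y. (\<lambda>k. dual_slice 1 k y) ` S)"
  have "h * dual_slice 1 \<omega> c \<in> complex_vector.span S'" if h: "h \<in> stabilizer B" for h
  proof -
    let ?f = "\<lambda>x y. dual_slice 1 (dual_slice 1 h (antipode_inv x) * \<omega>) y"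
    have "?f x y \<in> complex_vector.span S'" if y: "y \<in> Y" for x y
    proof -
      have "dual_slice 1 h (antipode_inv x) * \<omega> \<in> complex_vector.span S"
        by (rule S(2)[OF stabilizer_slice[OF B h]])
      then have "?f x y \<in> (\<lambda>k. dual_slice 1 k y) ` complex_vector.span S" by (rule imageI)
      also have "\<dots> = complex_vector.span ((\<lambda>k. dual_slice 1 k y) ` S)"
        by (rule module_hom.span_image[OF module_hom_clinear, symmetric]) (intro dual_intros)
      also have "\<dots> \<subseteq> complex_vector.span S'"
        using y by (intro complex_vector.span_mono) (auto simp: S'_def)
      finally show ?thesis .
    qed
    then have "complex_vector.span (\<Union>y\<in>Y. range (\<lambda>x. ?f x y)) \<subseteq> complex_vector.span S'"
      by (intro complex_vector.span_minimal complex_vector.subspace_span) auto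
    moreover have "cbilinear ?f"
      by (intro dual_intros clinear_dual_mult)
    ultimately show ?thesis using Y(2) unfolding mult_slice by blast
  qed
  moreover have "finite S'" using S(1) Y(1) by (simp add: S'_def)
  ultimately show ?thesis
    using stabilizer_dual_iff_finite_ideal[OF stabilizer_slice[OF B I]] by blast
qed

end

section \<open>The double coideal\<close>

lemma clinear_plus: "clinear f \<Longrightarrow> clinear g \<Longrightarrow> clinear (\<lambda>x. f x + g x)"
  by (simp add: clinear_iff scaleC_add_right algebra_simps)

lemma clinear_eq_on_span:
  assumes "clinear f" and "clinear g" and "\<And>x. x \<in> S \<Longrightarrow> f x = g x" and "x \<in> complex_vector.span S"
  shows "f x = g x"
  using assms(4)
  by (induction rule: complex_vector.span_induct_alt)
    (simp_all add: clinear_0 clinear_add clinear_scale assms(1-3))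

lemma dual_mult_one [simp]: "h * 1 = h" "1 * h = h" for h :: "'a::hopf_star_algebra dual"
proof -
  have "dual_apply (h * 1) a = dual_apply h a" "dual_apply (1 * h) a = dual_apply h a" for a
    using sw_counit_right[OF clinear_dual_apply, where a = a] sw_counit_left[OF clinear_dual_apply, where a = a]
    by (simp_all add: times_dual.rep_eq one_dual.rep_eq mult.commute)
  then show "h * 1 = h" "1 * h = h" by (simp_all only: dual_eqI)
qed

lemma dual_mult_apply_one: "dual_apply (h * k) 1 = dual_apply h 1 * dual_apply k 1"
  for h :: "'a::hopf_star_algebra dual"
  unfolding times_dual.rep_eq comult_one one_tensor_def
  by (rule tensor_lift_tensor) (intro cbilinear_balanced dual_intros)

lemma dual_slice_one: "dual_slice 1 1 c = counit c *\<^sub>C (1 :: 'a::hopf_star_algebra dual)"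
  by (rule dual_eqI) (simp add: dual_slice.rep_eq one_dual.rep_eq dual_apply_scaleC counit_mult)

lemma counit_antipode: "counit (antipode a) = counit (a :: 'a::hopf_star_algebra)"
proof -
  have "counit (antipode a) = sweedler a (\<lambda>x y. counit y *\<^sub>C counit (antipode x))"
    by (rule sw_counit_right[symmetric]) (intro clinear_intros)
  also have "\<dots> = counit (sweedler a (\<lambda>x y. antipode x * y))"
    by (subst clinear_tensor_lift_pull[OF clinear_counit])
      (intro clinear_intros, simp add: counit_mult mult.commute)
  finally show ?thesis by (simp add: antipode_left clinear_scale[OF clinear_counit] counit_one)
qed

lemma counit_antipode_inv: "counit (antipode_inv a) = counit (a :: 'a::hopf_star_algebra)"
  using counit_antipode[of "antipode_inv a"] by simp

lemma dual_antipode_inv_one: "dual_antipode_inv 1 = (1 :: 'a::hopf_star_algebra dual)"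
  by (rule dual_eqI) (simp add: dual_antipode_inv.rep_eq one_dual.rep_eq counit_antipode_inv)

lemma star_dual_one: "star 1 = (1 :: 'a::hopf_star_algebra dual)"
  by (rule dual_eqI) (simp add: star_dual.rep_eq one_dual.rep_eq counit_star counit_antipode)

lemma star_dual_add: "star (h + k) = star h + star k"
  and star_dual_scaleC: "star (c *\<^sub>C h) = cnj c *\<^sub>C star h" for h k :: "'a::hopf_star_algebra dual"
  by (rule dual_eqI, simp add: star_dual.rep_eq dual_apply_add dual_apply_scaleC)+

lemma clinear_Double: "clinear Double"
  by (simp add: clinear_iff plus_double.abs_eq scaleC_double.abs_eq)

lemma clinear_double_tensor: "clinear double_tensor"
  by (simp add: clinear_iff plus_double.rep_eq scaleC_double.rep_eq)

lemmas double_intros = dual_intros clinear_dual_mult clinear_compose'[OF clinear_Double]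
  clinear_compose'[OF clinear_double_tensor] clinear_double_cross

lemma double_of_alg_mult_dual:
  fixes a :: "'a::hopf_star_algebra"
  shows "double_of_alg a * double_of_dual h = Double (a \<otimes> h)"
proof -
  have "double_cross (1 :: 'a dual) 1 = 1 \<otimes> 1"
    unfolding double_cross_def comult_one one_tensor_def
    by (subst tensor_lift_tensor, intro cbilinear_balanced dual_intros,
        unfold comult_one one_tensor_def,
        subst tensor_lift_tensor, intro cbilinear_balanced dual_intros)
      (simp add: dual_slice_one counit_one)
  then show ?thesis
    unfolding double_of_alg_def double_of_dual_def double_mult
    by simp (subst tensor_lift_tensor, intro cbilinear_balanced double_intros, simp)
qed

lemma clinear_double_mult:
  "clinear g \<Longrightarrow> clinear (\<lambda>x. g x * (t::'a::hopf_star_algebra double))"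
  "clinear g \<Longrightarrow> clinear (\<lambda>x. (t::'a::hopf_star_algebra double) * g x)"
  unfolding times_double_def by (intro double_intros; assumption)+

lemma star_double_add: "star (s + t) = star s + star (t :: 'a::hopf_star_algebra double)"
  unfolding star_double_def by (simp add: plus_double.rep_eq tensor_lift_add plus_double.abs_eq)

text \<open>The map underlying \<open>star\<close> is conjugate-linear in both arguments, hence
  balanced though not bilinear, and \<open>tensor_lift_tensor\<close> still applies.\<close>

lemma star_Double: "star (Double (a \<otimes> h)) = Double (double_cross (star h) (star a))"
  unfolding star_double_def Double_inverse[OF UNIV_I]
  by (subst tensor_lift_tensor)
    (simp_all add: balanced_def star_dual_add star_dual_scaleC star_add star_scaleC
      clinear_add[OF clinear_double_cross(1)[OF clinear_ident]] clinear_scale[OF clinear_double_cross(1)[OF clinear_ident]]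
      clinear_add[OF clinear_double_cross(2)[OF clinear_ident]] clinear_scale[OF clinear_double_cross(2)[OF clinear_ident]])

lemma double_counit_Double: "double_counit (Double (a \<otimes> h)) = counit a * dual_apply h 1"
  unfolding double_counit_def Double_inverse[OF UNIV_I]
  by (rule tensor_lift_tensor) (intro cbilinear_balanced double_intros clinear_compose'[OF clinear_dual_eval])

lemma clinear_double_counit: "clinear double_counit"
  unfolding double_counit_def by (intro double_intros clinear_compose'[OF clinear_dual_eval])

text \<open>The third leg of \<open>x\<close> lies in \<open>B\<close> and enters the slice on the
  left, where a stabilizer element reduces it to its counit; the counit law then removes it.\<close>

lemma double_cross_stabilizer:
  assumes B: "left_coideal_star_subalgebra B" and x: "x \<in> B" and h: "h \<in> stabilizer B"
  shows "double_cross h x = sweedler x (\<lambda>x1 x2. x2 \<otimes> dual_slice 1 h (antipode_inv x1))"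
proof -
  have slice: "dual_slice b h c = counit b *\<^sub>C dual_slice 1 h c" if "b \<in> B" for b c
    by (rule dual_eqI) (simp add: dual_slice.rep_eq dual_apply_scaleC stabilizerD[OF B h that] mult.assoc)
  have "double_cross h x = sweedler x (\<lambda>y b. counit b *\<^sub>C sweedler y (\<lambda>y1 y2. y2 \<otimes> dual_slice 1 h (antipode_inv y1)))"
    unfolding double_cross_def
  proof (rule tensor_lift_cong_span[OF left_coidealD(3)[OF B x]])
    fix y b assume b: "b \<in> B"
    show "sweedler y (\<lambda>y1 y2. y2 \<otimes> dual_slice b h (antipode_inv y1))
        = counit b *\<^sub>C sweedler y (\<lambda>y1 y2. y2 \<otimes> dual_slice 1 h (antipode_inv y1))"
      unfolding slice[OF b] tensor_scale_right
      by (rule clinear_tensor_lift_pull[OF clinear_scaleC, symmetric]) (intro dual_intros)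
  qed (intro dual_intros)+
  also have "\<dots> = sweedler x (\<lambda>x1 x2. x2 \<otimes> dual_slice 1 h (antipode_inv x1))"
    by (rule sw_counit_right) (intro dual_intros)
  finally show ?thesis .
qed

lemma double_mult_stabilizer:
  assumes B: "left_coideal_star_subalgebra B" and b: "b \<in> B" and h: "h \<in> stabilizer B"
  shows "Double (a \<otimes> h) * Double (b \<otimes> k)
    = sweedler b (\<lambda>x y. Double ((a * y) \<otimes> (dual_slice 1 h (antipode_inv x) * k)))"
proof -
  let ?f = "\<lambda>b' h'. (a * b') \<otimes> (h' * k)"
  have f: "cbilinear ?f" by (intro double_intros)
  have "Double (tensor_lift ?f (double_cross h b))
      = sweedler b (\<lambda>x y. Double (tensor_lift ?f (y \<otimes> dual_slice 1 h (antipode_inv x))))"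
    unfolding double_cross_stabilizer[OF B b h]
    by (rule clinear_tensor_lift_pull[OF clinear_compose'[OF clinear_Double clinear_tensor_lift[OF f]]])
      (intro double_intros)
  then show ?thesis
    by (simp only: double_mult tensor_lift_tensor[OF cbilinear_balanced[OF f]])
qed

lemma dual_slice_apply_one: "dual_apply (dual_slice 1 h c) 1 = dual_apply h c"
  by (simp add: dual_slice.rep_eq)

text \<open>Serves three maps \<open>g\<close>: a linear extension \<open>L\<close> of the cocycle,
  \<open>y \<mapsto> L (a * y)\<close>, and the counit.\<close>

lemma clinear_right_act:
  assumes "clinear g"
  shows "g (x \<lhd> dual_antipode_inv h) = sweedler x (\<lambda>y z. dual_apply h (antipode_inv y) *\<^sub>C g z)"
proof -
  have "g (x \<lhd> dual_antipode_inv h) = sweedler x (\<lambda>y z. g (dual_apply h (antipode_inv y) *\<^sub>C z))"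
    unfolding right_act_def dual_antipode_inv.rep_eq
    by (rule clinear_tensor_lift_pull[OF assms]) (intro dual_intros)
  then show ?thesis by (simp add: clinear_scale[OF assms])
qed

text \<open>The pairing consumes the first leg of \<open>comult x\<close> and leaves a combination
  of second legs, which lie in \<open>B\<close>.\<close>

lemma right_act_in_left_coideal:
  assumes B: "left_coideal_star_subalgebra B" and x: "x \<in> B"
  shows "x \<lhd> h \<in> B"
  unfolding right_act_def
  by (rule tensor_lift_in_span[OF left_coidealD(3)[OF B x] _ star_subalgebraD(1)[OF left_coidealD(1)[OF B]]])
    (intro dual_intros, rule complex_vector.subspace_scale[OF star_subalgebraD(1)[OF left_coidealD(1)[OF B]]])

lemma right_act_one: "x \<lhd> 1 = x"
  by (simp add: right_act_def one_dual.rep_eq counit_left)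

section \<open>A spanning set of the double coideal\<close>

lemma star_subalgebra_hull: "star_subalgebra (star_subalgebra hull X)"
  for X :: "'a::hopf_star_algebra double set"
  by (rule hull_in) (auto simp: star_subalgebra_def complex_vector.subspace_def)

text \<open>Elements of \<open>B\<close> appear in the double as \<open>x \<otimes> 1\<close>, so
  with the unit adjoined a single family of products contains both kinds of generators. The sum need
  not be direct: \<open>1\<close> may already lie in \<open>X\<close>.\<close>

definition unitization :: "'a::hopf_star_algebra dual set \<Rightarrow> 'a dual set" where
  "unitization X = {c *\<^sub>C 1 + \<omega> | c \<omega>. \<omega> \<in> X}"

lemma unitizationI: "\<omega> \<in> X \<Longrightarrow> c *\<^sub>C 1 + \<omega> \<in> unitization X"
  by (auto simp: unitization_def)

lemma unitizationE:
  assumes "h \<in> unitization X"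
  obtains c \<omega> where "\<omega> \<in> X" and "h = c *\<^sub>C 1 + \<omega>"
  using assms by (auto simp: unitization_def)

context
  fixes B :: "'a::cqg_hopf_star_algebra set"
    and H :: "'i \<Rightarrow> 'a corep" and p :: "'j \<Rightarrow> 'i" and G :: "'j \<Rightarrow> (nat \<Rightarrow> complex) set"
    and Ic :: "'a dual set"
  assumes B: "left_coideal_star_subalgebra B" and H: "maximal_irreducible_coreps H"
    and G: "maximal_stabilizer_irreps B H p G" and Ic: "Ic = stabilizer_dual B H p G"
begin

lemma subspace_Ic: "complex_vector.subspace Ic"
  using subspace_stabilizer_dual[OF B H G] by (simp add: Ic)

lemma unitization_Ic:
  shows unitization_one: "1 \<in> unitization Ic"
    and Ic_unitization: "\<omega> \<in> Ic \<Longrightarrow> \<omega> \<in> unitization Ic"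
    and unitization_stabilizer: "h \<in> unitization Ic \<Longrightarrow> h \<in> stabilizer B"
    and unitization_slice: "h \<in> unitization Ic \<Longrightarrow> dual_slice 1 h a \<in> unitization Ic"
    and unitization_mult: "h \<in> unitization Ic \<Longrightarrow> k \<in> unitization Ic \<Longrightarrow> h * k \<in> unitization Ic"
    and unitization_star: "h \<in> unitization Ic \<Longrightarrow> star h \<in> unitization Ic"
proof -
  note S = complex_vector.subspace_0[OF subspace_Ic] complex_vector.subspace_add[OF subspace_Ic]
    complex_vector.subspace_scale[OF subspace_Ic]
  note lin = clinear_add[OF clinear_dual_slice(2)[OF clinear_ident]] clinear_scale[OF clinear_dual_slice(2)[OF clinear_ident]]
    clinear_add[OF clinear_dual_mult(1)[OF clinear_ident]] clinear_scale[OF clinear_dual_mult(1)[OF clinear_ident]]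
    clinear_add[OF clinear_dual_mult(2)[OF clinear_ident]] clinear_scale[OF clinear_dual_mult(2)[OF clinear_ident]]
  show "1 \<in> unitization Ic" using unitizationI[OF S(1), of 1] by (simp add: scaleC_one)
  show "\<omega> \<in> Ic \<Longrightarrow> \<omega> \<in> unitization Ic" for \<omega> using unitizationI[of \<omega> Ic 0] by simp
  have stab: "\<omega> \<in> stabilizer B" if "\<omega> \<in> Ic" for \<omega>
    using stabilizer_dualD(1)[OF B H G] that by (simp add: Ic)
  show "h \<in> stabilizer B" if "h \<in> unitization Ic" for h
    using that stab subspace_stabilizer[OF B] stabilizer_one[OF B]
    by (auto elim!: unitizationE simp: complex_vector.subspace_add complex_vector.subspace_scale)
  show "dual_slice 1 h a \<in> unitization Ic" if "h \<in> unitization Ic" for h a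
    using that stabilizer_dual_slice[OF B H G]
    by (auto elim!: unitizationE intro!: unitizationI simp: lin dual_slice_one scaleC_scaleC Ic)
  show "star h \<in> unitization Ic" if "h \<in> unitization Ic" for h
    using that stabilizer_dual_star[OF B H G]
    by (auto elim!: unitizationE intro!: unitizationI simp: star_dual_add star_dual_scaleC star_dual_one Ic)
  show "h * k \<in> unitization Ic" if hk: "h \<in> unitization Ic" "k \<in> unitization Ic" for h k
  proof -
    obtain c \<omega> d \<eta> where *: "\<omega> \<in> Ic" "h = c *\<^sub>C 1 + \<omega>" "\<eta> \<in> Ic" "k = d *\<^sub>C 1 + \<eta>"
      using hk by (auto elim!: unitizationE)
    have "\<omega> * \<eta> \<in> Ic"
      using stabilizer_dual_mult_left[OF B H G, of \<omega> \<eta>] stab[OF *(1)] *(3) by (simp add: Ic)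
    then have "c *\<^sub>C \<eta> + (d *\<^sub>C \<omega> + \<omega> * \<eta>) \<in> Ic" using * S by simp
    moreover have "h * k = (c * d) *\<^sub>C 1 + (c *\<^sub>C \<eta> + (d *\<^sub>C \<omega> + \<omega> * \<eta>))"
      by (simp add: * lin scaleC_scaleC scaleC_add_right)
    ultimately show ?thesis using unitizationI by metis
  qed
qed

lemma Double_in_double_coideal:
  assumes x: "x \<in> B" and h: "h \<in> unitization Ic"
  shows "Double (x \<otimes> h) \<in> B \<bowtie> Ic"
proof -
  note X = star_subalgebraD[OF star_subalgebra_hull[of "double_of_alg ` B \<union> double_of_dual ` Ic"], folded double_coideal_def]
  have gen: "double_of_alg x \<in> B \<bowtie> Ic" "\<omega> \<in> Ic \<Longrightarrow> double_of_dual \<omega> \<in> B \<bowtie> Ic" for \<omega>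
    using x hull_subset[of "double_of_alg ` B \<union> double_of_dual ` Ic" star_subalgebra]
    by (auto simp: double_coideal_def)
  obtain c \<omega> where c: "\<omega> \<in> Ic" "h = c *\<^sub>C 1 + \<omega>" using h by (rule unitizationE)
  have "Double (x \<otimes> h) = c *\<^sub>C double_of_alg x + double_of_alg x * double_of_dual \<omega>"
    unfolding c(2) double_of_alg_mult_dual
    by (simp add: double_of_alg_def tensor_add_right tensor_scale_right
        clinear_add[OF clinear_Double] clinear_scale[OF clinear_Double])
  then show ?thesis
    using gen X(1,2) c(1) by (simp add: complex_vector.subspace_add complex_vector.subspace_scale)
qed

text \<open>Reordering a product or an adjoint by the commutation relation yields second legs from
  \<open>B\<close> and slices of elements of \<open>unitization Ic\<close>. Both sets are stable
  under what occurs, so the span is already a star-subalgebra containing the generators.\<close>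

lemma double_coideal_eq_span:
  "B \<bowtie> Ic = complex_vector.span {Double (x \<otimes> h) | x h. x \<in> B \<and> h \<in> unitization Ic}" (is "_ = complex_vector.span ?D")
proof
  note sB = star_subalgebraD[OF left_coidealD(1)[OF B]]
  have base: "Double (x \<otimes> h) \<in> complex_vector.span ?D" if "x \<in> B" "h \<in> unitization Ic" for x h
    using that by (intro complex_vector.span_base) blast
  have prod: "z * w \<in> complex_vector.span ?D" if zw: "z \<in> ?D" "w \<in> ?D" for z w
  proof -
    obtain a h b k where *: "a \<in> B" "h \<in> unitization Ic" "z = Double (a \<otimes> h)"
      "b \<in> B" "k \<in> unitization Ic" "w = Double (b \<otimes> k)" using zw by blast
    show ?thesis
      unfolding *(3,6) double_mult_stabilizer[OF B *(4) unitization_stabilizer[OF *(2)]]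
      by (rule tensor_lift_in_span[OF left_coidealD(3)[OF B *(4)] _ complex_vector.subspace_span])
        (intro double_intros, intro base sB(2) unitization_mult unitization_slice * | assumption)+
  qed
  have prod': "s * w \<in> complex_vector.span ?D" if "s \<in> complex_vector.span ?D" "w \<in> ?D" for s w
  proof -
    have "complex_vector.span ((\<lambda>s. s * w) ` ?D) \<subseteq> complex_vector.span ?D"
      using prod that(2) by (intro complex_vector.span_minimal complex_vector.subspace_span) blast
    then show ?thesis
      using module_hom.span_image[OF module_hom_clinear[OF clinear_double_mult(1)[OF clinear_ident, of w]], of ?D] that(1)
      by blast
  qed
  have prod'': "s * t \<in> complex_vector.span ?D" if "s \<in> complex_vector.span ?D" "t \<in> complex_vector.span ?D" for s t
  proof -
    have "complex_vector.span ((\<lambda>t. s * t) ` ?D) \<subseteq> complex_vector.span ?D"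
      using prod' that(1) by (intro complex_vector.span_minimal complex_vector.subspace_span) blast
    then show ?thesis
      using module_hom.span_image[OF module_hom_clinear[OF clinear_double_mult(2)[OF clinear_ident, of s]], of ?D] that(2)
      by blast
  qed
  have star_base: "star (Double (a \<otimes> h)) \<in> complex_vector.span ?D" if "a \<in> B" "h \<in> unitization Ic" for a h
  proof -
    have a: "star a \<in> B" and h: "star h \<in> unitization Ic"
      using sB(3) unitization_star that by blast+
    have "star (Double (a \<otimes> h)) = sweedler (star a) (\<lambda>x y. Double (y \<otimes> dual_slice 1 (star h) (antipode_inv x)))"
      unfolding star_Double double_cross_stabilizer[OF B a unitization_stabilizer[OF h]]
      by (rule clinear_tensor_lift_pull[OF clinear_Double]) (intro double_intros)
    also have "\<dots> \<in> complex_vector.span ?D"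
      by (rule tensor_lift_in_span[OF left_coidealD(3)[OF B a] _ complex_vector.subspace_span])
        (intro double_intros, intro base unitization_slice h, assumption)
    finally show ?thesis .
  qed
  have star: "star s \<in> complex_vector.span ?D" if "s \<in> complex_vector.span ?D" for s
    using that
  proof (induction rule: complex_vector.span_induct_alt)
    case base
    have "star (0 :: 'a double) + star (0 :: 'a double) = star (0 :: 'a double)"
      using star_double_add[of "0 :: 'a double" 0] by simp
    then show ?case by (simp add: complex_vector.span_zero)
  next
    case (step c z s)
    then obtain a h where *: "a \<in> B" "h \<in> unitization Ic" "z = Double (a \<otimes> h)" by blast
    \<comment> \<open>With the scalar absorbed into \<open>a\<close>, additivity of
      \<open>star\<close> is enough for the induction.\<close>
    have "c *\<^sub>C z = Double ((c *\<^sub>C a) \<otimes> h)"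
      by (simp add: * tensor_scale_left clinear_scale[OF clinear_Double])
    moreover have "c *\<^sub>C a \<in> B" using sB(1) *(1) by (simp add: complex_vector.subspace_scale)
    ultimately show ?case
      using star_base *(2) step.IH by (simp only: star_double_add complex_vector.span_add)
  qed
  have "double_of_alg ` B \<union> double_of_dual ` Ic \<subseteq> complex_vector.span ?D"
    using base unitization_one Ic_unitization left_coidealD(2)[OF B]
    by (auto simp: double_of_alg_def double_of_dual_def)
  moreover have "star_subalgebra (complex_vector.span ?D)"
    using prod'' star complex_vector.subspace_span by (auto simp: star_subalgebra_def)
  ultimately show "B \<bowtie> Ic \<subseteq> complex_vector.span ?D"
    unfolding double_coideal_def by (rule hull_minimal)
  show "complex_vector.span ?D \<subseteq> B \<bowtie> Ic"
    using Double_in_double_coideal star_subalgebraD(1)[OF star_subalgebra_hull, folded double_coideal_def]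
    by (intro complex_vector.span_minimal) (auto simp: double_coideal_def star_subalgebra_hull star_subalgebraD(1))
qed

end

section \<open>Yetter-Drinfeld condition and extension of the cocycle\<close>

theorem theorem3p7:
  fixes B :: "'a::cqg_hopf_star_algebra set"
    and H :: "'i \<Rightarrow> 'a corep"
    and p :: "'j \<Rightarrow> 'i" and G :: "'j \<Rightarrow> (nat \<Rightarrow> complex) set"
    and Ic :: "'a dual set"
    and \<pi> :: "'a double \<Rightarrow> 'h::complex_inner \<Rightarrow> 'h"
    and C :: "'a \<Rightarrow> 'h"
  assumes "left_coideal_star_subalgebra B"
    and "maximal_irreducible_coreps H"
    and "maximal_stabilizer_irreps B H p G"
    and "Ic = stabilizer_dual B H p G"
    and "star_representation (B \<bowtie> Ic) \<pi>"
    and "cocycle B (\<lambda>x. \<pi> (double_of_alg x)) counit C"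
  shows "(\<forall>x\<in>B. \<forall>\<omega>\<in>Ic. \<pi> (double_of_dual \<omega>) (C x) = C (x \<lhd> dual_antipode_inv \<omega>)) \<longleftrightarrow>
    (\<exists>C'. cocycle (B \<bowtie> Ic) \<pi> double_counit C' \<and>
       (\<forall>x\<in>B. C' (double_of_alg x) = C x) \<and>
       (\<forall>x\<in>B. \<forall>\<omega>\<in>Ic.
          C' (double_of_alg x * double_of_dual \<omega>) = dual_apply \<omega> 1 *\<^sub>C C x))"
    (is "?YD \<longleftrightarrow> (\<exists>C'. ?ext C')")
proof -
  note B = assms(1)
  note ctx = assms(1-4)
  note sB = star_subalgebraD[OF left_coidealD(1)[OF B]] and one_B = left_coidealD(2)[OF B]
  note D = double_coideal_eq_span[OF ctx]
  note mem = Double_in_double_coideal[OF ctx]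
  note J1 = unitization_one[OF ctx] and J = Ic_unitization[OF ctx] and J_stab = unitization_stabilizer[OF ctx]
  have X: "complex_vector.subspace (B \<bowtie> Ic)" unfolding D by (rule complex_vector.subspace_span)
  have C_lin: "clinear_on B C"
    and C_mult: "\<And>x y. x \<in> B \<Longrightarrow> y \<in> B \<Longrightarrow> C (x * y) = \<pi> (double_of_alg x) (C y) + counit y *\<^sub>C C x"
    using assms(6) by (auto simp: cocycle_def)
  have \<pi>: "\<And>s. s \<in> B \<bowtie> Ic \<Longrightarrow> clinear (\<pi> s)" "clinear_on (B \<bowtie> Ic) \<pi>" "\<pi> 1 = id"
    "\<And>s t. s \<in> B \<bowtie> Ic \<Longrightarrow> t \<in> B \<bowtie> Ic \<Longrightarrow> \<pi> (s * t) = \<pi> s \<circ> \<pi> t"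
    using assms(5) by (auto simp: star_representation_def)
  obtain L where L: "clinear L" "\<And>x. x \<in> B \<Longrightarrow> L x = C x"
    using clinear_on_extend[OF sB(1) C_lin] by blast
  have act_B: "x \<lhd> dual_antipode_inv h \<in> B" if "x \<in> B" for x h
    by (rule right_act_in_left_coideal[OF B that])
  note act_C = clinear_right_act[OF L(1)]
  show ?thesis
  proof
    assume "\<exists>C'. ?ext C'"
    then obtain C' where C': "clinear_on (B \<bowtie> Ic) C'"
      "\<And>s t. s \<in> B \<bowtie> Ic \<Longrightarrow> t \<in> B \<bowtie> Ic \<Longrightarrow> C' (s * t) = \<pi> s (C' t) + double_counit t *\<^sub>C C' s"
      "\<And>x. x \<in> B \<Longrightarrow> C' (double_of_alg x) = C x"
      "\<And>x \<omega>. x \<in> B \<Longrightarrow> \<omega> \<in> Ic \<Longrightarrow> C' (double_of_alg x * double_of_dual \<omega>) = dual_apply \<omega> 1 *\<^sub>C C x"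
      by (auto simp: cocycle_def)
    \<comment> \<open>The cocycle identity at \<open>1 * 1\<close> reads
      \<open>C 1 = C 1 + C 1\<close>. Hence \<open>C 1 = 0\<close>, and the prescribed values make
      \<open>C'\<close> vanish on all \<open>double_of_dual \<omega>\<close>.\<close>
    have "double_of_alg 1 = (1 :: 'a double)" by (simp add: double_of_alg_def one_double_def)
    then have C1: "C 1 = 0" using C_mult[OF one_B one_B] \<pi>(3) by (simp add: counit_one scaleC_one)
    show ?YD
    proof (intro ballI)
      fix x \<omega> assume x: "x \<in> B" and \<omega>: "\<omega> \<in> Ic"
      have "double_of_alg 1 * double_of_dual \<omega> = double_of_dual \<omega>"
        unfolding double_of_alg_mult_dual by (simp add: double_of_dual_def)
      then have "C' (double_of_dual \<omega>) = 0" using C'(4)[OF one_B \<omega>] C1 by simp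
      moreover have "double_of_dual \<omega> \<in> B \<bowtie> Ic" "double_of_alg x \<in> B \<bowtie> Ic"
        using mem[OF one_B J[OF \<omega>]] mem[OF x J1] by (simp_all add: double_of_dual_def double_of_alg_def)
      ultimately have "\<pi> (double_of_dual \<omega>) (C x) = C' (double_of_dual \<omega> * double_of_alg x)"
        using C'(2,3) x by simp
      also have "\<dots> = C' (sweedler x (\<lambda>y z. Double (z \<otimes> dual_slice 1 \<omega> (antipode_inv y))))"
        using double_mult_stabilizer[OF B x J_stab[OF J[OF \<omega>]], of 1 1]
        by (simp add: double_of_dual_def double_of_alg_def)
      \<comment> \<open>The slices lie in \<open>Ic\<close>, so each term has a prescribed value,
        and the counit of a slice is \<open>\<omega>\<close> at \<open>antipode_inv y\<close>. Since
        \<open>C'\<close> is linear on the double coideal only, it is pulled inside by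
        \<open>tensor_lift_linear_on\<close>.\<close>
      also have "\<dots> = sweedler x (\<lambda>y z. dual_apply \<omega> (antipode_inv y) *\<^sub>C L z)"
      proof (rule tensor_lift_linear_on[OF left_coidealD(3)[OF B x] _ X _ C'(1)])
        fix y z assume z: "z \<in> B"
        have slice: "dual_slice 1 \<omega> (antipode_inv y) \<in> Ic"
          using stabilizer_dual_slice[OF assms(1-3)] \<omega> by (simp add: assms(4))
        then show "Double (z \<otimes> dual_slice 1 \<omega> (antipode_inv y)) \<in> B \<bowtie> Ic" using mem[OF z] J by blast
        show "C' (Double (z \<otimes> dual_slice 1 \<omega> (antipode_inv y))) = dual_apply \<omega> (antipode_inv y) *\<^sub>C L z"
          using C'(4)[OF z slice] L(2)[OF z] by (simp add: double_of_alg_mult_dual dual_slice_apply_one)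
      qed (intro double_intros clinear_compose'[OF L(1)])+
      also have "\<dots> = C (x \<lhd> dual_antipode_inv \<omega>)"
        using act_C[of x \<omega>] L(2)[OF act_B[OF x]] by simp
      finally show "\<pi> (double_of_dual \<omega>) (C x) = C (x \<lhd> dual_antipode_inv \<omega>)" .
    qed
  next
    assume YD: ?YD
    \<comment> \<open>The condition passes to the adjoined unit, because \<open>\<pi> 1\<close> is
      the identity and the unit of the dual acts trivially on \<open>x\<close>.\<close>
    have YD': "\<pi> (Double (1 \<otimes> h)) (C x) = C (x \<lhd> dual_antipode_inv h)"
      if x: "x \<in> B" and h: "h \<in> unitization Ic" for x h
    proof -
      obtain c \<omega> where c: "\<omega> \<in> Ic" "h = c *\<^sub>C 1 + \<omega>" using h by (rule unitizationE)
      have m: "1 \<in> B \<bowtie> Ic" "double_of_dual \<omega> \<in> B \<bowtie> Ic"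
        using mem[OF one_B J1] mem[OF one_B J[OF c(1)]] by (simp_all add: one_double_def double_of_dual_def)
      have "Double (1 \<otimes> h) = c *\<^sub>C 1 + double_of_dual \<omega>"
        by (simp add: c(2) one_double_def double_of_dual_def tensor_add_right tensor_scale_right
            clinear_add[OF clinear_Double] clinear_scale[OF clinear_Double])
      then have "\<pi> (Double (1 \<otimes> h)) (C x) = c *\<^sub>C C x + C (x \<lhd> dual_antipode_inv \<omega>)"
        using \<pi>(2,3) m X YD x c(1) by (simp add: clinear_onD complex_vector.subspace_scale)
      also have "\<dots> = L (c *\<^sub>C x + x \<lhd> dual_antipode_inv \<omega>)"
        using x act_B[OF x] by (simp add: clinear_add[OF L(1)] clinear_scale[OF L(1)] L(2))
      also have "c *\<^sub>C x + x \<lhd> dual_antipode_inv \<omega> = x \<lhd> dual_antipode_inv h"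
      proof -
        have *: "clinear (\<lambda>h. x \<lhd> dual_antipode_inv h)"
          unfolding right_act_def dual_antipode_inv.rep_eq
          by (intro dual_intros clinear_compose'[OF clinear_dual_eval])
        show ?thesis
          unfolding c(2) clinear_add[OF *] clinear_scale[OF *] by (simp add: dual_antipode_inv_one right_act_one)
      qed
      finally show ?thesis using L(2)[OF act_B[OF x]] by simp
    qed
    \<comment> \<open>Using \<open>L\<close> instead of \<open>C\<close> makes this linear on the
      whole double, so it can be pulled into Sweedler sums without membership conditions.\<close>
    define C' where "C' s = tensor_lift (\<lambda>a h. dual_apply h 1 *\<^sub>C L a) (double_tensor s)" for s
    note I = double_intros clinear_compose'[OF clinear_dual_eval] clinear_compose'[OF L(1)]
    have C': "clinear C'" unfolding C'_def by (intro I)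
    have C'_Double: "C' (Double (a \<otimes> h)) = dual_apply h 1 *\<^sub>C L a" for a h
      unfolding C'_def Double_inverse[OF UNIV_I] by (rule tensor_lift_tensor) (intro cbilinear_balanced I)
    \<comment> \<open>With \<open>\<pi>\<close> replaced by a linear extension, both sides of the
      cocycle identity become globally linear in \<open>s\<close>.\<close>
    obtain P where P: "clinear P" "\<And>s. s \<in> B \<bowtie> Ic \<Longrightarrow> P s = \<pi> s"
      using clinear_on_extend[OF X \<pi>(2)] by blast
    have P_eval: "clinear (\<lambda>s. P s v)" for v
      using P(1) by (simp add: clinear_iff)
    let ?D = "{Double (x \<otimes> h) | x h. x \<in> B \<and> h \<in> unitization Ic}"
    \<comment> \<open>On spanning elements, reordering \<open>h\<close> and \<open>b\<close>
      produces \<open>?b\<close>. The cocycle identity of \<open>C\<close> for \<open>a * ?b\<close>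
      and the Yetter-Drinfeld condition for \<open>C ?b\<close> then give the claim.\<close>
    have gen: "C' (s * t) = \<pi> s (C' t) + double_counit t *\<^sub>C C' s" if st: "s \<in> ?D" "t \<in> ?D" for s t
    proof -
      obtain a h b k where *: "a \<in> B" "h \<in> unitization Ic" "s = Double (a \<otimes> h)"
        "b \<in> B" "k \<in> unitization Ic" "t = Double (b \<otimes> k)" using st by blast
      let ?b = "b \<lhd> dual_antipode_inv h"
      have "C' (s * t) = sweedler b (\<lambda>x y. C' (Double ((a * y) \<otimes> (dual_slice 1 h (antipode_inv x) * k))))"
        unfolding *(3,6) double_mult_stabilizer[OF B *(4) J_stab[OF *(2)]]
        by (rule clinear_tensor_lift_pull[OF C']) (intro I)
      also have "\<dots> = sweedler b (\<lambda>x y. dual_apply k 1 *\<^sub>C dual_apply h (antipode_inv x) *\<^sub>C L (a * y))"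
        by (simp add: C'_Double dual_mult_apply_one dual_slice_apply_one scaleC_scaleC mult.commute)
      also have "\<dots> = dual_apply k 1 *\<^sub>C sweedler b (\<lambda>x y. dual_apply h (antipode_inv x) *\<^sub>C L (a * y))"
        by (rule clinear_tensor_lift_pull[OF clinear_scaleC, symmetric]) (intro I)
      also have "\<dots> = dual_apply k 1 *\<^sub>C L (a * ?b)"
        by (subst clinear_right_act[where g = "\<lambda>y. L (a * y)"]) (intro I, rule refl)
      also have "L (a * ?b) = \<pi> (double_of_alg a) (C ?b) + counit ?b *\<^sub>C C a"
        using L(2) sB(2) *(1) act_B[OF *(4)] C_mult by simp
      also have "C ?b = \<pi> (Double (1 \<otimes> h)) (C b)" using YD'[OF *(4,2)] by simp
      also have "\<pi> (double_of_alg a) (\<pi> (Double (1 \<otimes> h)) (C b)) = \<pi> s (C b)"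
      proof -
        have "s = double_of_alg a * Double (1 \<otimes> h)"
          using double_of_alg_mult_dual[of a h] by (simp add: *(3) double_of_dual_def)
        then show ?thesis
          using \<pi>(4) mem[OF *(1) J1] mem[OF one_B *(2)] by (simp add: double_of_alg_def)
      qed
      \<comment> \<open>The left side is \<open>h\<close> at \<open>antipode_inv b\<close>, and
        \<open>stabilizer_antipode_inv\<close> splits off the counit of \<open>b\<close>.\<close>
      also have "counit ?b = counit b * dual_apply h 1"
      proof -
        have "counit ?b = sweedler b (\<lambda>x y. counit y *\<^sub>C dual_apply h (antipode_inv x))"
          by (simp add: clinear_right_act[OF clinear_counit] mult.commute)
        also have "\<dots> = dual_apply h (antipode_inv b)" by (rule sw_counit_right) (intro I)
        finally show ?thesis using stabilizer_antipode_inv[OF B J_stab[OF *(2)] *(4), of 1] by simp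
      qed
      finally have "C' (s * t) = dual_apply k 1 *\<^sub>C (\<pi> s (C b) + (counit b * dual_apply h 1) *\<^sub>C C a)" .
      moreover have "clinear (\<pi> s)" using \<pi>(1) mem[OF *(1,2)] by (simp add: *(3))
      ultimately show ?thesis
        by (simp add: *(3,6) C'_Double L(2) *(1,4) double_counit_Double scaleC_add_right scaleC_scaleC
            clinear_scale mult_ac)
    qed
    \<comment> \<open>The identity extends from spanning elements by linearity, first in
      \<open>s\<close> and afterwards in \<open>t\<close>.\<close>
    have gen': "C' (s * t) = \<pi> s (C' t) + double_counit t *\<^sub>C C' s" if s: "s \<in> B \<bowtie> Ic" and t: "t \<in> ?D" for s t
    proof -
      have "C' (s * t) = P s (C' t) + double_counit t *\<^sub>C C' s"
      proof (rule clinear_eq_on_span[where S = ?D and x = s])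
        show "clinear (\<lambda>s. C' (s * t))" by (intro clinear_compose'[OF C'] clinear_double_mult clinear_ident)
        show "clinear (\<lambda>s. P s (C' t) + double_counit t *\<^sub>C C' s)"
          by (intro clinear_plus P_eval clinear_scaleC_right C')
        show "C' (s * t) = P s (C' t) + double_counit t *\<^sub>C C' s" if "s \<in> ?D" for s
          using gen[OF that t] P(2) that mem by auto
      qed (use s D in simp)
      then show ?thesis using P(2)[OF s] by simp
    qed
    have "C' (s * t) = \<pi> s (C' t) + double_counit t *\<^sub>C C' s" if s: "s \<in> B \<bowtie> Ic" and t: "t \<in> B \<bowtie> Ic" for s t
    proof (rule clinear_eq_on_span[where S = ?D and x = t])
      show "clinear (\<lambda>t. C' (s * t))" by (intro clinear_compose'[OF C'] clinear_double_mult clinear_ident)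
      show "clinear (\<lambda>t. \<pi> s (C' t) + double_counit t *\<^sub>C C' s)"
        by (intro clinear_plus clinear_compose'[OF \<pi>(1)[OF s]] clinear_scaleC_left C' clinear_double_counit)
      show "C' (s * t) = \<pi> s (C' t) + double_counit t *\<^sub>C C' s" if "t \<in> ?D" for t
        by (rule gen'[OF s that])
    qed (use t D in simp)
    then have "cocycle (B \<bowtie> Ic) \<pi> double_counit C'"
      using C' by (auto simp: cocycle_def clinear_on_def clinear_iff)
    moreover have "C' (double_of_alg x) = C x" if "x \<in> B" for x
      using that by (simp add: double_of_alg_def C'_Double one_dual.rep_eq counit_one scaleC_one L(2))
    moreover have "C' (double_of_alg x * double_of_dual \<omega>) = dual_apply \<omega> 1 *\<^sub>C C x" if "x \<in> B" for x \<omega>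
      using that by (simp add: double_of_alg_mult_dual C'_Double L(2))
    ultimately show "\<exists>C'. ?ext C'" by blast
  qed
qed

end
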